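(* Let $\{n_k\}_{k\ge1}$ be a strictly increasing sequence of positive integers and let $\{s_k\}_{k\ge1}$, $\{t_k\}_{k\ge1}$ be sequences of positive real numbers with $s_k\to\infty$ and $t_k\to\infty$ as $k\to\infty$. Assume that (1) $n_k/k\to\infty$ as $k\to\infty$; (2) $\lim_{k\to\infty}\frac{\log s_k}{\log t_k}=1$; (3) the limits $\alpha:=\lim_{k\to\infty}\frac1{n_k}\sum_{j=1}^k\log s_j$ and $\beta:=\lim_{k\to\infty}\frac1{n_k}\log s_k$ exist in $[0,\infty]$. Let $E_S$ be the set of $x\in\mathbb I$ such that the family $\{a_j(x)\}_{j\notin\{n_k:k\in\mathbb N\}}$ is bounded, let $E_L$ be the set of $x\in\mathbb I$ such that $s_k<a_{n_k}(x)\le s_k+t_k$ for all sufficiently large $k\in\mathbb N$, and let $E:=E_S\cap E_L$. Then: (i) if $\alpha\in(0,\infty)$, then $\dim_{\rm H}E=\dim_{\rm H}E_L=\theta(\alpha,\beta)$, where $\theta(\alpha,\beta)$ is the unique solution $\theta\in(1/2,\infty)$ of $$\mathrm P(\theta)=(2\alpha-\beta)\theta-(\alpha-\beta);$$ (ii) if $\alpha=0$, then $\dim_{\rm H}E=\dim_{\rm H}E_L=1$; (iii) if $\alpha=\infty$, then $$\dim_{\rm H}E=\frac1{2+\xi},\qquad \xi:=\limsup_{k\to\infty}\frac{\log s_{k+1}}{\log s_1+\cdots+\log s_k}\in[0,\infty],$$ and $$\dim_{\rm H}E_L=\frac1{\gamma+1},\qquad \gamma:=\limsup_{k\to\infty}\exp\left(\frac{\log\log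 s_k}{n_k}\right)\in[1,\infty].$$
   Context: $\mathbb N=\{1,2,3,\dots\}$ and $\mathbb I:=[0,1)\setminus\mathbb Q$. For $x\in\mathbb I$, $a_1(x),a_2(x),\dots\in\mathbb N$ are the coefficients (partial quotients) of its continued fraction expansion $x=[a_1(x),a_2(x),\dots]=1/(a_1(x)+1/(a_2(x)+\cdots))$. For positive integers $a_1,\dots,a_n$, $q_n(a_1,\dots,a_n)$ is the denominator (in lowest terms) of the rational number $[a_1,\dots,a_n]=1/(a_1+1/(a_2+\cdots+1/a_n))$. The Diophantine pressure function is $$\mathrm P(\theta):=\lim_{n\to\infty}\frac1n\log\sum_{a_1,\dots,a_n\in\mathbb N}q_n(a_1,\dots,a_n)^{-2\theta},\qquad \theta>\tfrac12.$$ $\dim_{\rm H}$ denotes Hausdorff dimension, and the convention $1/\infty=0$ is used. The quantities $\frac{\log s_k}{\log t_k}$ and $\log\log s_k$ are considered for large $k$. *)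

theory Defs
  imports "HOL-Analysis.Analysis"
begin

definition irr_unit :: "real set" where
  "irr_unit = {0..<1} - \<rat>"

primrec cfrac :: "nat list \<Rightarrow> rat" where
  "cfrac [] = 0"
| "cfrac (a # as) = 1 / (of_nat a + cfrac as)"

definition cfrac_denom :: "nat list \<Rightarrow> int" where
  "cfrac_denom as = snd (quotient_of (cfrac as))"

text \<open>
  \<open>cfrac_expansion x a\<close> says that \<open>x = 1/(a 1 + 1/(a 2 + \<dots>))\<close>. Digits are indexed from 1; the
  value at index 0 is the integer part, which is 0 for \<open>x \<in> irr_unit\<close>, so that the expansion of
  such an \<open>x\<close> is unique as a function on \<^typ>\<open>nat\<close>.
\<close>

definition cfrac_expansion :: "real \<Rightarrow> (nat \<Rightarrow> nat) \<Rightarrow> bool" where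
  "cfrac_expansion x a \<longleftrightarrow>
     a 0 = 0 \<and> (\<forall>j\<ge>1. a j \<ge> 1) \<and>
     (\<lambda>m. of_rat (cfrac (map a [1..<Suc m])) :: real) \<longlonglongrightarrow> x"

definition partial_quotient :: "nat \<Rightarrow> real \<Rightarrow> nat" where
  "partial_quotient j x = (THE a. cfrac_expansion x a) j"

definition pressure :: "real \<Rightarrow> real" where
  "pressure \<theta> =
     lim (\<lambda>m. ln (\<Sum>\<^sub>\<infinity>as\<in>{as :: nat list. length as = m \<and> (\<forall>a\<in>set as. a \<ge> 1)}.
                    real_of_int (cfrac_denom as) powr (- 2 * \<theta>)) / real m)"

text \<open>
  The Hausdorff measures are only meant for \<open>r > 0\<close>: since \<^term>\<open>0 powr 0 = (0::real)\<close>, the case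
  \<open>r = 0\<close> is not the counting measure. The boundedness condition is needed because
  \<^const>\<open>diameter\<close> is a real number, with no meaningful value on unbounded sets.
  Finite covers are included, as the sets \<open>U i\<close> may be empty.
\<close>

definition hausdorff_premeasure :: "real \<Rightarrow> real \<Rightarrow> 'a::metric_space set \<Rightarrow> ennreal" where
  "hausdorff_premeasure r \<delta> A =
     (INF U \<in> {U :: nat \<Rightarrow> 'a set. A \<subseteq> (\<Union>i. U i) \<and> (\<forall>i. bounded (U i) \<and> diameter (U i) \<le> \<delta>)}.
        (\<Sum>i. ennreal (diameter (U i) powr r)))"

definition hausdorff_measure :: "real \<Rightarrow> 'a::metric_space set \<Rightarrow> ennreal" where
  "hausdorff_measure r A = (SUP \<delta>\<in>{0<..}. hausdorff_premeasure r \<delta> A)"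

definition hausdorff_dim :: "'a::metric_space set \<Rightarrow> ereal" where
  "hausdorff_dim A = (INF r\<in>{r. r > 0 \<and> hausdorff_measure r A = 0}. ereal r)"

text \<open>The sequences \<open>n\<close>, \<open>s\<close>, \<open>t\<close> are indexed from 1; their values at 0 are irrelevant.\<close>

definition E_S :: "(nat \<Rightarrow> nat) \<Rightarrow> real set" where
  "E_S n = {x \<in> irr_unit. bdd_above ((\<lambda>j. partial_quotient j x) ` ({1..} - n ` {1..}))}"

definition E_L :: "(nat \<Rightarrow> nat) \<Rightarrow> (nat \<Rightarrow> real) \<Rightarrow> (nat \<Rightarrow> real) \<Rightarrow> real set" where
  "E_L n s t = {x \<in> irr_unit. \<forall>\<^sub>F k in sequentially.
     s k < real (partial_quotient (n k) x) \<and> real (partial_quotient (n k) x) \<le> s k + t k}"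

text \<open>
  The defining equation of \<open>\<theta>(\<alpha>,\<beta>)\<close>. It is used for \<open>0 < \<alpha> < \<infinity>\<close>, in which case \<open>\<beta> \<le> \<alpha>\<close> is finite
  as well.
\<close>

definition pressure_solution :: "ereal \<Rightarrow> ereal \<Rightarrow> real \<Rightarrow> bool" where
  "pressure_solution \<alpha> \<beta> \<theta> \<longleftrightarrow>
     \<theta> > 1/2 \<and> ereal (pressure \<theta>) = (2 * \<alpha> - \<beta>) * ereal \<theta> - (\<alpha> - \<beta>)"

end

theory Submission
  imports Defs "HOL-Probability.Probability"
begin

text \<open>
  Upper bounds come from covering by the cylinders of order \<open>n\<^sub>k - 1\<close>, cut down to
  \<open>a\<^bsub>n k\<^esub> > s\<^sub>k\<close>. Since \<open>q(u a v)\<close> and \<open>a q(u v)\<close> agree up to a factor 4, and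
  \<open>k = o(n\<^sub>k)\<close>, the prescribed digits split off and the free ones contribute
  \<open>exp (n\<^sub>k P(r))\<close>, or \<open>M\<close> to the power \<open>n\<^sub>k\<close> if they are bounded by \<open>M\<close>. The bound
  \<open>1/(\<gamma> + 1)\<close> is Luczak's theorem for digits that are infinitely often doubly exponentially large.

  Lower bounds come from a mass distribution. The prescribed digits are independent and uniform;
  the free ones are bounded by \<open>M\<close> and consist of independent blocks of length \<open>l\<close> with weights
  proportional to \<open>q\<^sup>-\<^sup>2\<^sup>\<theta>\<close>. As \<open>q\<close> is multiplicative up to a factor 2 per block, this product
  measure replaces a Gibbs measure once \<open>l\<close> is large. For \<open>1/(\<gamma> + 1)\<close> all digits are prescribed,
  the free positions receiving doubly exponentially growing windows.
\<close>

section \<open>Continued fractions\<close>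

text \<open>The pressure equation is the balance of one exponent. A word of order n_k - 1 cut down
  to a_{n_k} > s_k has diameter about 1/(s_k q^2). Summing r-th powers gives exp (n_k P(r)) for the
  free letters, about t_j s_j^(-2r) for each prescribed digit with j < k, and s_k^(-r) for the one
  that is not enumerated. As log t_j ~ log s_j, dividing the logarithm by n_k leaves P(r) + (1 -
  2r)(\<alpha> - \<beta>) - r \<beta>, which vanishes exactly when P(r) = (2\<alpha> - \<beta>) r -
  (\<alpha> - \<beta>). If \<alpha> = \<infinity>, terms of order n_k are negligible against S_k =
  log s_1 + ... + log s_k, and the exponent becomes (1 - 2r) S_k - r log s_{k+1}, whence 1/(2 +
  \<xi>). The obstacle for E_L is that sums over unbounded free letters diverge for r <= 1/2: this
  covering stops at 1/2, and a smaller dimension must come from the gigantic digits that produce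
  \<gamma>. In the lower bounds the same exponent compares mass with diameter; its worst place is
  just before n_{k+1}, where a ball sees only part of a window.\<close>

text \<open>
  For \<open>w = [a\<^sub>1, \<dots>, a\<^sub>m]\<close> with convergents \<open>p\<^sub>i/q\<^sub>i\<close>, \<open>cf_val w y\<close> is
  \<open>[a\<^sub>1, \<dots>, a\<^sub>m + y] = (p\<^sub>m + p\<^bsub>m-1\<^esub> y) / (q\<^sub>m + q\<^bsub>m-1\<^esub> y)\<close> and \<open>cf_den w y\<close> is the
  denominator \<open>q\<^sub>m + q\<^bsub>m-1\<^esub> y\<close>; in particular \<open>cf_den w 0 = q\<^sub>m\<close>. Writing it as a product over
  the tails makes it multiplicative for concatenation (\<open>cf_den_append\<close>).
\<close>

primrec cf_val :: "nat list \<Rightarrow> real \<Rightarrow> real" where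
  "cf_val [] y = y"
| "cf_val (a # w) y = 1 / (real a + cf_val w y)"

primrec cf_den :: "nat list \<Rightarrow> real \<Rightarrow> real" where
  "cf_den [] y = 1"
| "cf_den (a # w) y = (real a + cf_val w y) * cf_den w y"

definition pos_word :: "nat list \<Rightarrow> bool" where
  "pos_word w \<longleftrightarrow> (\<forall>a\<in>set w. 1 \<le> a)"

lemma pos_word_simps [simp]:
  "pos_word []" "pos_word (a # w) \<longleftrightarrow> 1 \<le> a \<and> pos_word w"
  "pos_word (u @ v) \<longleftrightarrow> pos_word u \<and> pos_word v"
  by (auto simp: pos_word_def)

lemma cf_val_append: "cf_val (u @ v) y = cf_val u (cf_val v y)"
  by (induction u) auto

lemma cf_den_append: "cf_den (u @ v) y = cf_den u (cf_val v y) * cf_den v y"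
  by (induction u) (auto simp: cf_val_append)

lemma cf_val_nonneg: "0 \<le> y \<Longrightarrow> 0 \<le> cf_val w y"
  by (induction w) auto

lemma cf_val_le_1: "pos_word w \<Longrightarrow> 0 \<le> y \<Longrightarrow> y \<le> 1 \<Longrightarrow> cf_val w y \<le> 1"
proof (cases w)
  case (Cons a v)
  assume "pos_word w" "0 \<le> y"
  then show ?thesis using Cons cf_val_nonneg[of y v] by (auto simp: field_simps)
qed auto

lemma cf_den_pos: "pos_word w \<Longrightarrow> 0 \<le> y \<Longrightarrow> 0 < cf_den w y"
  using cf_val_nonneg by (induction w) (auto simp: add_pos_nonneg)

text \<open>The continuant recurrence, peeled from the left and valid for every tail
  \<open>y\<close>. It no longer mentions \<open>cf_val\<close>, so monotonicity, the bound by
  \<open>1 + y\<close> and affinity follow by inductions that step over two letters.\<close>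

lemma cf_den_Cons2:
  assumes "1 \<le> b" "0 \<le> y"
  shows "cf_den (a # b # w) y = real a * cf_den (b # w) y + cf_den w y"
proof -
  have "real b + cf_val w y > 0" using assms cf_val_nonneg[of y w] by linarith
  then show ?thesis by (simp add: field_simps)
qed

lemma cf_den_mono:
  "pos_word w \<Longrightarrow> 0 \<le> y \<Longrightarrow> y \<le> z \<Longrightarrow> cf_den w y \<le> cf_den w z"
proof (induction w rule: induct_list012)
  case (3 a b w)
  then show ?case
    by (auto simp: cf_den_Cons2 simp del: cf_den.simps intro!: add_mono mult_left_mono)
qed auto

lemma cf_den_upper:
  "pos_word w \<Longrightarrow> 0 \<le> y \<Longrightarrow> cf_den w y \<le> (1 + y) * cf_den w 0"
proof (induction w rule: induct_list012)
  case (2 a)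
  then show ?case using mult_right_mono[of 1 "real a" y] by (auto simp: algebra_simps)
next
  case (3 a b w)
  have "real a * cf_den (b # w) y + cf_den w y
      \<le> real a * ((1 + y) * cf_den (b # w) 0) + (1 + y) * cf_den w 0"
    using 3 by (intro add_mono mult_left_mono) auto
  then show ?case using 3 by (simp add: cf_den_Cons2 algebra_simps del: cf_den.simps)
qed auto

text \<open>The slope is q_(m-1), but its existence is all that the telescoping of cylinder lengths
  asks for. The restriction to \<open>0 \<le> y\<close> is inherited from the recurrence, which
  needs \<open>real b + cf_val w y\<close> to be nonzero.\<close>

lemma cf_den_affine:
  "pos_word w \<Longrightarrow> \<exists>q'. \<forall>y\<ge>0. cf_den w y = cf_den w 0 + q' * y"
proof (induction w rule: induct_list012)
  case 1
  show ?case by (auto intro: exI[of _ 0])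
next
  case (2 a)
  show ?case by (auto intro: exI[of _ 1])
next
  case (3 a b w)
  obtain p where p: "\<forall>y\<ge>0. cf_den w y = cf_den w 0 + p * y"
    using 3 by (metis pos_word_simps(2))
  obtain q where q: "\<forall>y\<ge>0. cf_den (b # w) y = cf_den (b # w) 0 + q * y"
    using 3 by (metis pos_word_simps(2))
  have b: "1 \<le> b" using 3 by simp
  have "cf_den (a # b # w) y = cf_den (a # b # w) 0 + (a * q + p) * y" if "0 \<le> y" for y
    unfolding cf_den_Cons2[OF b that] cf_den_Cons2[OF b order_refl]
      p[rule_format, OF that] q[rule_format, OF that]
    by (simp add: algebra_simps del: cf_den.simps)
  then show ?case by blast
qed

lemma cf_den_le_double:
  assumes "pos_word w" "0 \<le> y" "y \<le> 1"
  shows "cf_den w y \<le> 2 * cf_den w 0"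
proof -
  have "(1 + y) * cf_den w 0 \<le> 2 * cf_den w 0"
    using assms cf_den_pos[of w 0] by (intro mult_right_mono) auto
  then show ?thesis using cf_den_upper[of w y] assms by linarith
qed

lemma cf_den_ge_1: "pos_word w \<Longrightarrow> 1 \<le> cf_den w 0"
proof (induction w)
  case (Cons a w)
  have "1 * 1 \<le> (real a + cf_val w 0) * cf_den w 0"
    using Cons cf_val_nonneg[of 0 w] by (intro mult_mono) auto
  then show ?case by simp
qed auto

text \<open>With the next bound this is multiplicativity up to a factor 2: in
  \<open>cf_den (u @ v) 0\<close> the factor \<open>cf_den u\<close> is evaluated at
  \<open>cf_val v 0\<close>, a point of [0,1], where it lies between its value at 0 and twice that
  value.\<close>

lemma cf_den_append_ge:
  assumes "pos_word u" "pos_word v"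
  shows "cf_den u 0 * cf_den v 0 \<le> cf_den (u @ v) 0"
  using assms cf_den_pos[of v 0] by (auto simp: cf_den_append intro!: mult_right_mono cf_den_mono cf_val_nonneg)

lemma cf_den_append_le:
  assumes "pos_word u" "pos_word v"
  shows "cf_den (u @ v) 0 \<le> 2 * cf_den u 0 * cf_den v 0"
  using assms cf_den_pos[of v 0]
  by (auto simp: cf_den_append intro!: mult_right_mono cf_den_le_double cf_val_nonneg cf_val_le_1)

text \<open>Cutting a letter out of the middle costs only a constant: \<open>cf_den u\<close> varies
  by at most a factor 2 over [0,1], and the denominator of \<open>a # v\<close> lies between
  \<open>a\<close> and \<open>a + 1\<close> times that of \<open>v\<close>. With the matching upper
  bound below, prescribed digits can be stripped from a word one at a time.\<close>

lemma cf_den_insert_ge: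
  assumes "pos_word u" "pos_word v" "1 \<le> a"
  shows "real a / 2 * cf_den (u @ v) 0 \<le> cf_den (u @ a # v) 0"
proof -
  have "real a / 2 * cf_den (u @ v) 0 = (cf_den u (cf_val v 0) / 2) * (real a * cf_den v 0)"
    by (simp add: cf_den_append)
  also have "\<dots> \<le> cf_den u (cf_val (a # v) 0) * cf_den (a # v) 0"
  proof (intro mult_mono)
    have "cf_den u (cf_val v 0) \<le> 2 * cf_den u 0"
      using assms by (intro cf_den_le_double cf_val_nonneg cf_val_le_1) auto
    also have "\<dots> \<le> 2 * cf_den u (cf_val (a # v) 0)"
      using assms cf_val_nonneg[of 0 "a # v"] by (intro mult_left_mono cf_den_mono) auto
    finally show "cf_den u (cf_val v 0) / 2 \<le> cf_den u (cf_val (a # v) 0)" by simp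
    show "real a * cf_den v 0 \<le> cf_den (a # v) 0"
      using assms cf_den_pos[of v 0] cf_val_nonneg[of 0 v] by (auto intro!: mult_right_mono)
    show "0 \<le> cf_den u (cf_val (a # v) 0)"
      using assms cf_den_pos cf_val_nonneg[of 0 "a # v"] by (intro less_imp_le) blast
    show "0 \<le> real a * cf_den v 0"
      using assms cf_den_pos[of v 0] by auto
  qed
  finally show ?thesis by (simp add: cf_den_append del: cf_den.simps cf_val.simps)
qed

lemma cf_den_insert_le:
  assumes "pos_word u" "pos_word v" "1 \<le> a"
  shows "cf_den (u @ a # v) 0 \<le> 2 * (real a + 1) * cf_den (u @ v) 0"
proof -
  have "cf_den u (cf_val (a # v) 0) * cf_den (a # v) 0
      \<le> (2 * cf_den u (cf_val v 0)) * ((real a + 1) * cf_den v 0)"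
  proof (intro mult_mono)
    have "cf_den u (cf_val (a # v) 0) \<le> 2 * cf_den u 0"
      using assms by (intro cf_den_le_double cf_val_nonneg cf_val_le_1) auto
    also have "\<dots> \<le> 2 * cf_den u (cf_val v 0)"
      using assms cf_val_nonneg[of 0 v] by (intro mult_left_mono cf_den_mono) auto
    finally show "cf_den u (cf_val (a # v) 0) \<le> 2 * cf_den u (cf_val v 0)" .
    show "cf_den (a # v) 0 \<le> (real a + 1) * cf_den v 0"
      using assms cf_den_pos[of v 0] cf_val_le_1[of v 0] by (auto intro!: mult_right_mono)
    show "0 \<le> 2 * cf_den u (cf_val v 0)"
      using assms cf_den_pos[of u "cf_val v 0"] cf_val_nonneg[of 0 v] by simp
    show "0 \<le> cf_den (a # v) 0"
      using assms cf_den_pos[of "a # v" 0] by auto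
  qed
  then show ?thesis by (simp add: cf_den_append algebra_simps)
qed

text \<open>In q(a b w) = a q(b w) + q(w) both terms are at least q(w), so two letters double the
  denominator. This rate makes cylinders shrink and later gives the pressure a slope of at most -ln
  2.\<close>

lemma cf_den_ge_power2: "pos_word w \<Longrightarrow> 2 ^ (length w div 2) \<le> cf_den w 0"
proof (induction w rule: induct_list012)
  case (3 a b w)
  have "1 * cf_den w 0 \<le> (real b + cf_val w 0) * cf_den w 0"
    using 3(3) cf_den_pos[of w 0] cf_val_nonneg[of 0 w] by (intro mult_right_mono) auto
  then have "2 * cf_den w 0 \<le> 1 * cf_den (b # w) 0 + cf_den w 0" by simp
  also have "\<dots> \<le> real a * cf_den (b # w) 0 + cf_den w 0"
    using 3(3) cf_den_pos[of "b # w" 0] by (intro add_mono mult_right_mono) auto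
  finally show ?case using 3 by (simp add: cf_den_Cons2 del: cf_den.simps)
qed auto

lemma cf_den_le_power:
  assumes "\<forall>a\<in>set w. 1 \<le> a \<and> a \<le> M"
  shows "cf_den w 0 \<le> (real M + 1) ^ length w"
  using assms
proof (induction w)
  case (Cons a w)
  then have "pos_word w" by (auto simp: pos_word_def)
  then have "cf_den (a # w) 0 \<le> (real M + 1) * (real M + 1) ^ length w"
    using Cons cf_val_le_1[of w 0] cf_den_pos[of w 0] cf_val_nonneg[of 0 w]
    by (simp, intro mult_mono) auto
  then show ?case by simp
qed auto

lemma cf_den_ge_last:
  assumes "pos_word w" "1 \<le> a"
  shows "real a \<le> cf_den (w @ [a]) 0"
proof -
  have "1 * real a \<le> cf_den w 0 * real a"
    using cf_den_ge_1[of w] assms by (intro mult_right_mono) auto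
  also have "\<dots> \<le> cf_den (w @ [a]) 0"
    using cf_den_append_ge[of w "[a]"] assms by simp
  finally show ?thesis by simp
qed

text \<open>\<open>cf_val w\<close> is a Moebius map of determinant 1 or -1, so the distortion is an
  exact identity. Upper bounds for cylinder diameters and lower bounds for gaps both come from
  it.\<close>

lemma cf_val_diff:
  "pos_word w \<Longrightarrow> 0 \<le> y \<Longrightarrow> 0 \<le> z \<Longrightarrow>
     \<bar>cf_val w y - cf_val w z\<bar> = \<bar>y - z\<bar> / (cf_den w y * cf_den w z)"
proof (induction w)
  case (Cons a w)
  have 1: "real a + cf_val w y > 0" "real a + cf_val w z > 0"
    using Cons cf_val_nonneg[of y w] cf_val_nonneg[of z w] by (auto simp: add_pos_nonneg)
  have "cf_val (a # w) y - cf_val (a # w) z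
      = - (cf_val w y - cf_val w z) / ((real a + cf_val w y) * (real a + cf_val w z))"
    using 1 by (simp add: field_simps)
  then have "\<bar>cf_val (a # w) y - cf_val (a # w) z\<bar>
      = \<bar>cf_val w y - cf_val w z\<bar> / ((real a + cf_val w y) * (real a + cf_val w z))"
    using 1 by (simp add: abs_mult)
  then show ?case using Cons by (simp add: mult_ac)
qed auto

lemma cf_val_dist_le:
  assumes "pos_word w" "0 \<le> y" "0 \<le> z"
  shows "\<bar>cf_val w y - cf_val w z\<bar> \<le> \<bar>y - z\<bar> / (cf_den w 0)\<^sup>2"
proof -
  have "(cf_den w 0)\<^sup>2 \<le> cf_den w y * cf_den w z"
    using assms cf_den_pos[of w 0] cf_den_pos[of w y]
    unfolding power2_eq_square by (intro mult_mono cf_den_mono) auto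
  then show ?thesis
    using assms by (auto simp: cf_val_diff intro!: divide_left_mono mult_pos_pos zero_less_power cf_den_pos)
qed

lemma cf_val_dist_ge:
  assumes "pos_word w" "0 \<le> y" "0 \<le> z" "y \<le> 1" "z \<le> 1"
  shows "\<bar>y - z\<bar> / (4 * (cf_den w 0)\<^sup>2) \<le> \<bar>cf_val w y - cf_val w z\<bar>"
proof -
  have "cf_den w y * cf_den w z \<le> (2 * cf_den w 0) * (2 * cf_den w 0)"
    using assms cf_den_pos[of w 0] cf_den_pos[of w z] cf_den_pos[of w y]
    by (intro mult_mono cf_den_le_double) auto
  then have "cf_den w y * cf_den w z \<le> 4 * (cf_den w 0)\<^sup>2"
    by (simp add: power2_eq_square)
  then show ?thesis
    using assms
    by (auto simp: cf_val_diff intro!: divide_left_mono mult_pos_pos zero_less_power cf_den_pos)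
qed

lemma of_rat_cfrac: "of_rat (cfrac w) = cf_val w 0"
  by (induction w) (auto simp: of_rat_divide of_rat_add)

text \<open>The induction carries the reduced pair (p, q): one step turns it into (q, a q + p),
  which stays coprime, so nothing cancels and the continuant is the denominator in lowest terms.
  Carrying \<open>0 \<le> p\<close> keeps the new denominator positive.\<close>

lemma quotient_of_cfrac:
  assumes "pos_word w"
  shows "\<exists>p q. quotient_of (cfrac w) = (p, q) \<and> real_of_int q = cf_den w 0 \<and> 0 \<le> p"
  using assms
proof (induction w)
  case (Cons a w)
  then obtain p q where pq: "quotient_of (cfrac w) = (p, q)" "real_of_int q = cf_den w 0" "0 \<le> p"
    by auto
  have q: "0 < q" and cop: "coprime p q"
    using pq quotient_of_denom_pos quotient_of_coprime by blast+
  have v: "cfrac w = of_int p / of_int q" using pq quotient_of_div by blast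
  have a: "1 \<le> a" using Cons by simp
  have N: "0 < int a * q + p" using a q pq(3) by (simp add: add_pos_nonneg)
  have e: "cfrac (a # w) = of_int q / of_int (int a * q + p)"
    using q N by (simp add: v) (simp add: field_simps)
  have "coprime q (int a * q + p)"
    using cop by (simp add: coprime_iff_gcd_eq_1 gcd_add_mult gcd.commute)
  then have "quotient_of (Fract q (int a * q + p)) = (q, int a * q + p)"
    using N by (simp add: quotient_of_Fract Rat.normalize_def Let_def)
  then have "quotient_of (cfrac (a # w)) = (q, int a * q + p)"
    unfolding e by (simp only: Fract_of_int_quotient)
  moreover have "real_of_int (int a * q + p) = cf_den (a # w) 0"
  proof -
    have "cf_val w 0 = real_of_int p / real_of_int q"
      using v of_rat_cfrac[of w] by (simp add: of_rat_divide)
    then show ?thesis using q pq(2) by (simp add: field_simps)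
  qed
  ultimately show ?case using q by auto
qed auto

lemma cfrac_denom_eq: "pos_word w \<Longrightarrow> real_of_int (cfrac_denom w) = cf_den w 0"
  using quotient_of_cfrac[of w] by (auto simp: cfrac_denom_def)

section \<open>Infinite expansions and the irrationals of the unit interval\<close>

definition prefix :: "(nat \<Rightarrow> nat) \<Rightarrow> nat \<Rightarrow> nat list" where
  "prefix a m = map a [1..<Suc m]"

definition pos_seq :: "(nat \<Rightarrow> nat) \<Rightarrow> bool" where
  "pos_seq a \<longleftrightarrow> (\<forall>j\<ge>1. 1 \<le> a j)"

definition cf_lim :: "(nat \<Rightarrow> nat) \<Rightarrow> real" where
  "cf_lim a = lim (\<lambda>m. cf_val (prefix a m) 0)"

lemma length_prefix [simp]: "length (prefix a m) = m"
  by (simp add: prefix_def)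

lemma prefix_0 [simp]: "prefix a 0 = []"
  by (simp add: prefix_def)

lemma prefix_Suc: "prefix a (Suc m) = prefix a m @ [a (Suc m)]"
  by (simp add: prefix_def)

lemma prefix_add: "prefix a (m + k) = prefix a m @ prefix (\<lambda>j. a (m + j)) k"
  by (induction k) (auto simp: prefix_Suc)

lemma nth_prefix: "i < m \<Longrightarrow> prefix a m ! i = a (Suc i)"
  by (simp add: prefix_def del: upt_Suc)

lemma pos_word_prefix: "pos_seq a \<Longrightarrow> pos_word (prefix a m)"
  by (auto simp: prefix_def pos_seq_def pos_word_def)

lemma pos_seq_shift: "pos_seq a \<Longrightarrow> pos_seq (\<lambda>j. a (m + j))"
  by (auto simp: pos_seq_def)

lemma power2_div2_tendsto: "(\<lambda>m. (1/2 :: real) ^ (m div 2)) \<longlonglongrightarrow> 0"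
proof -
  have "filterlim (\<lambda>m::nat. m div 2) at_top at_top"
    unfolding filterlim_at_top
  proof
    fix Z :: nat
    show "\<forall>\<^sub>F m in sequentially. Z \<le> m div 2"
      by (rule eventually_sequentiallyI[of "2 * Z"]) simp
  qed
  then show ?thesis
    by (rule filterlim_compose[of "\<lambda>k. (1/2 :: real) ^ k", OF LIMSEQ_realpow_zero, rotated 2]) auto
qed

lemma cf_val_dist_bound:
  assumes "pos_word w" "0 \<le> y" "0 \<le> z" "y \<le> 1" "z \<le> 1"
  shows "\<bar>cf_val w y - cf_val w z\<bar> \<le> (1/2) ^ (length w div 2)"
proof -
  have q: "2 ^ (length w div 2) \<le> cf_den w 0" "1 \<le> cf_den w 0"
    using assms cf_den_ge_power2 cf_den_ge_1 by auto
  then have "cf_den w 0 * 1 \<le> cf_den w 0 * cf_den w 0" by (intro mult_left_mono) auto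
  then have "2 ^ (length w div 2) \<le> (cf_den w 0)\<^sup>2"
    using q(1) unfolding power2_eq_square by linarith
  then have "\<bar>y - z\<bar> / (cf_den w 0)\<^sup>2 \<le> 1 / 2 ^ (length w div 2)"
    using assms by (intro frac_le) auto
  then show ?thesis using cf_val_dist_le[of w y z] assms by (simp add: power_one_over)
qed

lemma cf_lim_tendsto:
  assumes "pos_seq a"
  shows "(\<lambda>m. cf_val (prefix a m) 0) \<longlonglongrightarrow> cf_lim a"
proof -
  have "Cauchy (\<lambda>m. cf_val (prefix a m) 0)"
  proof (rule CauchyI')
    fix e :: real assume "0 < e"
    then obtain M where M: "\<And>m. M \<le> m \<Longrightarrow> (1/2 :: real) ^ (m div 2) < e"
      using order_tendstoD(2)[OF power2_div2_tendsto, of e] unfolding eventually_sequentially by blast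
    have "norm (cf_val (prefix a m) 0 - cf_val (prefix a n) 0) < e" if mn: "M \<le> m" "m < n" for m n
    proof -
      obtain k where n: "n = m + k" using mn by (metis less_imp_add_positive)
      have w: "pos_word (prefix a m)" "pos_word (prefix (\<lambda>j. a (m + j)) k)"
        by (rule pos_word_prefix[OF assms], rule pos_word_prefix[OF pos_seq_shift[OF assms]])
      have "\<bar>cf_val (prefix a m) 0 - cf_val (prefix a n) 0\<bar> \<le> (1/2) ^ (m div 2)"
        using cf_val_dist_bound[OF w(1), of 0] w
        by (simp add: n prefix_add cf_val_append cf_val_nonneg cf_val_le_1)
      also have "\<dots> < e" using M that by simp
      finally show ?thesis by simp
    qed
    then show "\<exists>M. \<forall>m\<ge>M. \<forall>n>m. dist (cf_val (prefix a m) 0) (cf_val (prefix a n) 0) < e"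
      unfolding dist_norm
      by blast
  qed
  then show ?thesis
    unfolding cf_lim_def by (simp add: Cauchy_convergent_iff convergent_LIMSEQ_iff)
qed

lemma cf_lim_nonneg: "pos_seq a \<Longrightarrow> 0 \<le> cf_lim a"
  by (rule LIMSEQ_le_const[OF cf_lim_tendsto]) (auto simp: cf_val_nonneg)

text \<open>Denominators are at least 1, so \<open>cf_val (prefix a m)\<close> is 1-Lipschitz on
  nonnegative tails and the limit passes inside.\<close>

lemma cf_lim_eq_cf_val:
  assumes "pos_seq a"
  shows "cf_lim a = cf_val (prefix a m) (cf_lim (\<lambda>j. a (m + j)))"
proof -
  let ?b = "\<lambda>j. a (m + j)"
  have b: "pos_seq ?b" by (rule pos_seq_shift[OF assms])
  have w: "pos_word (prefix a m)" using assms by (rule pos_word_prefix)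
  have "(\<lambda>k. cf_val (prefix a m) (cf_val (prefix ?b k) 0)) \<longlonglongrightarrow> cf_lim a"
    using LIMSEQ_ignore_initial_segment[OF cf_lim_tendsto[OF assms], of m]
    by (simp add: add.commute[of _ m] prefix_add cf_val_append)
  moreover have "(\<lambda>k. cf_val (prefix a m) (cf_val (prefix ?b k) 0)) \<longlonglongrightarrow> cf_val (prefix a m) (cf_lim ?b)"
  proof (rule LIM_zero_cancel, rule tendsto_0_le[where K = 1])
    show "(\<lambda>k. cf_val (prefix ?b k) 0 - cf_lim ?b) \<longlonglongrightarrow> 0"
      using cf_lim_tendsto[OF b] by (rule LIM_zero)
    have "\<bar>cf_val (prefix a m) y - cf_val (prefix a m) z\<bar> \<le> \<bar>y - z\<bar>" if "0 \<le> y" "0 \<le> z" for y z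
    proof -
      have "\<bar>y - z\<bar> / (cf_den (prefix a m) 0)\<^sup>2 \<le> \<bar>y - z\<bar> / 1"
        using cf_den_ge_1[OF w] by (intro divide_left_mono) auto
      then show ?thesis using cf_val_dist_le[OF w that] by simp
    qed
    then show "\<forall>\<^sub>F k in sequentially. norm (cf_val (prefix a m) (cf_val (prefix ?b k) 0) -
        cf_val (prefix a m) (cf_lim ?b)) \<le> norm (cf_val (prefix ?b k) 0 - cf_lim ?b) * 1"
      using b by (auto simp: cf_val_nonneg cf_lim_nonneg)
  qed
  ultimately show ?thesis using LIMSEQ_unique by blast
qed

lemma cf_lim_Suc:
  assumes "pos_seq a"
  shows "cf_lim a = 1 / (real (a 1) + cf_lim (\<lambda>j. a (Suc j)))"
  using cf_lim_eq_cf_val[OF assms, of 1] by (simp add: prefix_def)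

lemma cf_lim_pos: "pos_seq a \<Longrightarrow> 0 < cf_lim a"
  using cf_lim_Suc[of a] cf_lim_nonneg[of "\<lambda>j. a (Suc j)"] pos_seq_shift[of a 1]
  by (auto simp: pos_seq_def add_pos_nonneg)

lemma cf_lim_less_1:
  assumes "pos_seq a" shows "cf_lim a < 1"
proof -
  have "0 < cf_lim (\<lambda>j. a (Suc j))" "1 \<le> a 1"
    using cf_lim_pos pos_seq_shift[OF assms, of 1] assms by (auto simp: pos_seq_def)
  then show ?thesis unfolding cf_lim_Suc[OF assms] by simp
qed

text \<open>Euclidean descent: if x = p/d, the tail of x is d/p - a_1, which has the denominator p,
  and 0 < p < d because x lies in (0,1). Denominators would decrease forever.\<close>

lemma cf_lim_irrational:
  assumes "pos_seq a" shows "cf_lim a \<notin> \<rat>"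
proof -
  have *: False if "pos_seq a" "cf_lim a * real d = of_int p" "0 < d" for d p a
    using that
  proof (induction d arbitrary: a p rule: less_induct)
    case (less d)
    let ?b = "\<lambda>j. a (Suc j)"
    have b: "pos_seq ?b" using pos_seq_shift[OF less(2), of 1] by simp
    have x: "0 < cf_lim a" "cf_lim a < 1" using less cf_lim_pos cf_lim_less_1 by auto
    have p: "0 < p" "p < int d"
    proof -
      have "0 < real_of_int p" using x less(3,4) by (metis mult_pos_pos of_nat_0_less_iff)
      then show "0 < p" by simp
      have "cf_lim a * real d < 1 * real d" using x less(4) by (intro mult_strict_right_mono) auto
      then show "p < int d" using less(3) by simp
    qed
    have ab: "0 < real (a 1) + cf_lim ?b"
      using less(2) cf_lim_pos[OF b] by (auto simp: pos_seq_def add_nonneg_pos)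
    have "cf_lim a * (real (a 1) + cf_lim ?b) = 1"
      using ab cf_lim_Suc[OF less(2)] by simp
    then have "cf_lim a * real d * (real (a 1) + cf_lim ?b) = real d"
      by (metis mult.assoc mult.commute mult.right_neutral)
    then have "real_of_int p * (real (a 1) + cf_lim ?b) = real d" unfolding less(3) .
    then have "cf_lim ?b * real_of_int p = real_of_int (int d - int (a 1) * p)"
      by (simp add: algebra_simps)
    then have "cf_lim ?b * real (nat p) = real_of_int (int d - int (a 1) * p)" using p by simp
    then show False using less.IH[OF _ b] p by (metis nat_less_iff zero_less_nat_eq order.strict_implies_order)
  qed
  show ?thesis
  proof
    assume "cf_lim a \<in> \<rat>"
    then obtain p d where "0 < d" "cf_lim a = of_int p / of_nat d"
      using Rats_cases'[of "cf_lim a"] by (metis of_int_of_nat_eq zero_less_imp_eq_int of_nat_0_less_iff)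
    then show False using *[OF assms, of d p] by simp
  qed
qed

lemma cf_lim_in_irr_unit: "pos_seq a \<Longrightarrow> cf_lim a \<in> irr_unit"
  using cf_lim_pos[of a] cf_lim_less_1[of a] cf_lim_irrational[of a] by (auto simp: irr_unit_def)

lemma cf_lim_first_digit:
  assumes "pos_seq a" "pos_seq b" "cf_lim a = cf_lim b"
  shows "a 1 = b 1" "cf_lim (\<lambda>j. a (Suc j)) = cf_lim (\<lambda>j. b (Suc j))"
proof -
  let ?x = "cf_lim (\<lambda>j. a (Suc j))" and ?y = "cf_lim (\<lambda>j. b (Suc j))"
  have xy: "0 < ?x" "?x < 1" "0 < ?y" "?y < 1"
    using pos_seq_shift[OF assms(1), of 1] pos_seq_shift[OF assms(2), of 1]
    by (auto intro: cf_lim_pos cf_lim_less_1)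
  have "1 / (real (a 1) + ?x) = 1 / (real (b 1) + ?y)"
    using assms cf_lim_Suc by metis
  then have e: "real (a 1) + ?x = real (b 1) + ?y" by simp
  then show "a 1 = b 1" using xy by linarith
  then show "?x = ?y" using e by simp
qed

lemma cf_lim_inject:
  assumes "pos_seq a" "pos_seq b" "cf_lim a = cf_lim b" "1 \<le> j"
  shows "a j = b j"
proof -
  have "a (Suc j) = b (Suc j)" for j
    using assms(1-3)
  proof (induction j arbitrary: a b)
    case 0
    then show ?case using cf_lim_first_digit by simp
  next
    case (Suc j)
    show ?case
      using Suc.IH[of "\<lambda>j. a (Suc j)" "\<lambda>j. b (Suc j)"] Suc.prems cf_lim_first_digit[of a b]
        pos_seq_shift[of a 1] pos_seq_shift[of b 1] by simp
  qed
  from this[of "j - 1"] show ?thesis using assms(4) by simp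
qed

lemma cfrac_expansion_iff:
  "cfrac_expansion x a \<longleftrightarrow> a 0 = 0 \<and> pos_seq a \<and> x = cf_lim a"
  using cf_lim_tendsto[of a] LIMSEQ_unique[of _ x "cf_lim a"]
  by (auto simp: cfrac_expansion_def pos_seq_def of_rat_cfrac prefix_def)

text \<open>One step of the Gauss map. Irrationality excludes 0 and passes to the remainder, so the
  step can be iterated.\<close>

lemma irr_unit_step:
  assumes "x \<in> irr_unit"
  shows "\<exists>a y. 1 \<le> a \<and> y \<in> irr_unit \<and> x = 1 / (real a + y)"
proof -
  have x: "0 < x" "x < 1" "x \<notin> \<rat>"
    using assms by (auto simp: irr_unit_def less_le)
  define a where "a = nat \<lfloor>1 / x\<rfloor>"
  define y where "y = 1 / x - real a"
  have fl: "1 \<le> \<lfloor>1 / x\<rfloor>" using x by (simp add: le_floor_iff)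
  have a: "1 \<le> a" "real a = of_int \<lfloor>1 / x\<rfloor>" using fl unfolding a_def by linarith+
  have "0 \<le> y" "y < 1" unfolding y_def a(2) by linarith+
  moreover have "y \<notin> \<rat>"
  proof
    assume "y \<in> \<rat>"
    then have "1 / (y + real a) \<in> \<rat>" by (intro Rats_divide Rats_add) auto
    then show False using x by (simp add: y_def)
  qed
  ultimately show ?thesis
    using a x by (intro exI[of _ a] exI[of _ y]) (auto simp: irr_unit_def y_def)
qed

lemma cfrac_expansion_exists:
  assumes "x \<in> irr_unit"
  shows "\<exists>a. cfrac_expansion x a"
proof -
  obtain d T where dT: "\<And>x. x \<in> irr_unit \<Longrightarrow> 1 \<le> d x" "\<And>x. x \<in> irr_unit \<Longrightarrow> T x \<in> irr_unit"
    and x_eq: "\<And>x. x \<in> irr_unit \<Longrightarrow> x = 1 / (real (d x) + T x)"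
    using irr_unit_step by metis
  define a where "a j = (if j = 0 then 0 else d ((T ^^ (j - 1)) x))" for j
  have T: "(T ^^ m) x \<in> irr_unit" for m
    using assms dT by (induction m) auto
  have a: "pos_seq a" using T dT by (auto simp: pos_seq_def a_def)
  have x: "x = cf_val (prefix a m) ((T ^^ m) x)" for m
  proof (induction m)
    case (Suc m)
    have "cf_val (prefix a (Suc m)) ((T ^^ Suc m) x)
        = cf_val (prefix a m) (1 / (real (d ((T ^^ m) x)) + T ((T ^^ m) x)))"
      by (simp add: prefix_Suc cf_val_append a_def)
    also have "\<dots> = cf_val (prefix a m) ((T ^^ m) x)"
      using x_eq[OF T[of m]] by (rule arg_cong[OF sym])
    finally show ?case using Suc by simp
  qed simp
  have "(\<lambda>m. cf_val (prefix a m) 0) \<longlonglongrightarrow> x"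
  proof (rule LIM_zero_cancel, rule tendsto_0_le[where K = 1])
    show "(\<lambda>m. (1/2 :: real) ^ (m div 2)) \<longlonglongrightarrow> 0" by (rule power2_div2_tendsto)
    have "norm (cf_val (prefix a m) 0 - x) \<le> (1/2) ^ (m div 2)" for m
      using cf_val_dist_bound[of "prefix a m" 0 "(T ^^ m) x"] x[of m] T[of m] pos_word_prefix[OF a]
      by (auto simp: irr_unit_def)
    then show "\<forall>\<^sub>F m in sequentially. norm (cf_val (prefix a m) 0 - x) \<le> norm ((1/2 :: real) ^ (m div 2)) * 1"
      by simp
  qed
  then have "x = cf_lim a" using LIMSEQ_unique cf_lim_tendsto[OF a] by blast
  then show ?thesis using a by (auto simp: cfrac_expansion_iff a_def intro!: exI[of _ a])
qed

text \<open>The arguments are exchanged so that \<open>digits x\<close> is itself a sequence, ready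
  for \<open>prefix\<close> and \<open>cf_lim\<close>.\<close>

definition digits :: "real \<Rightarrow> nat \<Rightarrow> nat" where
  "digits x j = partial_quotient j x"

lemma cfrac_expansion_digits:
  assumes "x \<in> irr_unit" shows "cfrac_expansion x (digits x)"
proof -
  obtain a where a: "cfrac_expansion x a" using cfrac_expansion_exists[OF assms] by blast
  have "\<exists>!a. cfrac_expansion x a"
  proof (rule ex1I[of _ a], rule a)
    fix b assume b: "cfrac_expansion x b"
    show "b = a"
    proof
      fix j show "b j = a j"
        using a b cf_lim_inject[of b a j] by (cases "j = 0") (auto simp: cfrac_expansion_iff)
    qed
  qed
  from theI'[OF this] show ?thesis
    by (simp add: digits_def[abs_def] partial_quotient_def)
qed

lemma digits_pos_seq: "x \<in> irr_unit \<Longrightarrow> pos_seq (digits x)"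
  and cf_lim_digits: "x \<in> irr_unit \<Longrightarrow> cf_lim (digits x) = x"
  using cfrac_expansion_digits[of x] by (auto simp: cfrac_expansion_iff)

lemma digits_cf_lim:
  assumes "pos_seq a" "1 \<le> j"
  shows "digits (cf_lim a) j = a j"
  using assms cf_lim_in_irr_unit cf_lim_digits digits_pos_seq cf_lim_inject by metis

section \<open>Hausdorff measure and dimension\<close>

lemma hausdorff_premeasure_le_cover:
  assumes "A \<subseteq> (\<Union>i. U i)" "\<And>i. bounded (U i)" "\<And>i. diameter (U i) \<le> \<delta>"
  shows "hausdorff_premeasure r \<delta> A \<le> (\<Sum>i. ennreal (diameter (U i) powr r))"
  unfolding hausdorff_premeasure_def using assms by (intro INF_lower) auto

lemma hausdorff_premeasure_subset:
  "A \<subseteq> B \<Longrightarrow> hausdorff_premeasure r \<delta> A \<le> hausdorff_premeasure r \<delta> B"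
  unfolding hausdorff_premeasure_def by (intro INF_superset_mono) auto

lemma hausdorff_measure_subset:
  "A \<subseteq> B \<Longrightarrow> hausdorff_measure r A \<le> hausdorff_measure r B"
  unfolding hausdorff_measure_def by (intro SUP_mono') (rule hausdorff_premeasure_subset)

lemma hausdorff_dim_subset:
  assumes "A \<subseteq> B" shows "hausdorff_dim A \<le> hausdorff_dim B"
proof -
  have "hausdorff_measure r A = 0" if "hausdorff_measure r B = 0" for r
    using hausdorff_measure_subset[OF assms, of r] that by simp
  then show ?thesis
    unfolding hausdorff_dim_def by (intro INF_superset_mono) auto
qed

lemma hausdorff_dim_nonneg: "0 \<le> hausdorff_dim A"
  unfolding hausdorff_dim_def by (intro INF_greatest) auto

lemma hausdorff_dim_le:
  assumes "hausdorff_measure r A = 0" "0 < r"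
  shows "hausdorff_dim A \<le> ereal r"
  unfolding hausdorff_dim_def using assms by (intro INF_lower) auto

lemma hausdorff_dim_leI:
  assumes "\<And>r. c < r \<Longrightarrow> 0 < r \<Longrightarrow> hausdorff_measure r A = 0" "0 \<le> c"
  shows "hausdorff_dim A \<le> ereal c"
proof (rule ereal_le_epsilon2)
  fix e :: real assume "0 < e"
  then show "hausdorff_dim A \<le> ereal c + ereal e"
    using assms hausdorff_dim_le[of "c + e" A] by simp
qed

lemma hausdorff_measure_0I:
  assumes "\<And>\<delta>. 0 < \<delta> \<Longrightarrow> hausdorff_premeasure r \<delta> A = 0"
  shows "hausdorff_measure r A = 0"
  unfolding hausdorff_measure_def using assms by (simp add: SUP_eq_const)

text \<open>The right-hand side may be taken finite, so every piece has a cover that is optimal up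
  to e/2^(i+1); a pairing function merges these covers into one sequence.\<close>

lemma hausdorff_premeasure_UN_le:
  "hausdorff_premeasure r \<delta> (\<Union>i::nat. A i) \<le> (\<Sum>i. hausdorff_premeasure r \<delta> (A i))"
proof (rule ennreal_le_epsilon)
  fix e :: real
  assume fin: "(\<Sum>i. hausdorff_premeasure r \<delta> (A i)) < top" and e: "0 < e"
  have "\<exists>U. A i \<subseteq> (\<Union>j. U j) \<and> (\<forall>j. bounded (U j) \<and> diameter (U j) \<le> \<delta>) \<and>
      (\<Sum>j. ennreal (diameter (U j) powr r)) \<le> hausdorff_premeasure r \<delta> (A i) + ennreal (e * (1/2) ^ Suc i)" for i
  proof -
    have "hausdorff_premeasure r \<delta> (A i) < top"
      using fin ennreal_suminf_lessD by blast
    then have "hausdorff_premeasure r \<delta> (A i) < hausdorff_premeasure r \<delta> (A i) + ennreal (e * (1/2) ^ Suc i)"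
      using e ennreal_add_left_cancel_less[of "hausdorff_premeasure r \<delta> (A i)" 0] by (auto simp: ennreal_zero_less_mult_iff)
    then show ?thesis
      unfolding hausdorff_premeasure_def[of r \<delta> "A i"] INF_less_iff by (auto intro: less_imp_le)
  qed
  then obtain U where U: "\<And>i. A i \<subseteq> (\<Union>j. U i j)" "\<And>i j. bounded (U i j)" "\<And>i j. diameter (U i j) \<le> \<delta>"
    "\<And>i. (\<Sum>j. ennreal (diameter (U i j) powr r)) \<le> hausdorff_premeasure r \<delta> (A i) + ennreal (e * (1/2) ^ Suc i)"
    by metis
  define V where "V n = (case prod_decode n of (i, j) \<Rightarrow> U i j)" for n
  have "(\<Union>i. A i) \<subseteq> (\<Union>n. V n)"
  proof
    fix x assume "x \<in> (\<Union>i. A i)"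
    then obtain i j where "x \<in> U i j" using U(1) by blast
    then have "x \<in> V (prod_encode (i, j))" by (simp add: V_def)
    then show "x \<in> (\<Union>n. V n)" by blast
  qed
  then have "hausdorff_premeasure r \<delta> (\<Union>i. A i) \<le> (\<Sum>n. ennreal (diameter (V n) powr r))"
    by (rule hausdorff_premeasure_le_cover) (auto simp: V_def U split: prod.split)
  also have "\<dots> = (\<Sum>i. \<Sum>j. ennreal (diameter (U i j) powr r))"
    using suminf_ennreal_2dimen[of _ "\<lambda>(i, j). ennreal (diameter (U i j) powr r)"]
    by (simp add: V_def split_beta)
  also have "\<dots> \<le> (\<Sum>i. hausdorff_premeasure r \<delta> (A i) + ennreal (e * (1/2) ^ Suc i))"
    by (intro suminf_le U) auto
  also have "\<dots> = (\<Sum>i. hausdorff_premeasure r \<delta> (A i)) + (\<Sum>i. ennreal (e * (1/2) ^ Suc i))"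
    by (intro suminf_add[symmetric]) auto
  also have "(\<Sum>i. ennreal (e * (1/2) ^ Suc i)) = ennreal e"
  proof -
    have "(\<lambda>i. e * (1/2) ^ Suc i) sums (e * 1)"
      by (intro sums_mult power_half_series)
    then show ?thesis using e by (intro suminf_ennreal_eq) auto
  qed
  finally show "hausdorff_premeasure r \<delta> (\<Union>i. A i) \<le> (\<Sum>i. hausdorff_premeasure r \<delta> (A i)) + ennreal e" .
qed

lemma hausdorff_measure_null_UN:
  fixes A :: "'b \<Rightarrow> 'a::metric_space set"
  assumes "countable I" "\<And>i. i \<in> I \<Longrightarrow> hausdorff_measure r (A i) = 0"
  shows "hausdorff_measure r (\<Union>i\<in>I. A i) = 0"
proof (cases "I = {}")
  case True
  have "hausdorff_premeasure r \<delta> ({} :: 'a set) \<le> (\<Sum>i::nat. ennreal (diameter ({} :: 'a set) powr r))"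
    if "0 < \<delta>" for \<delta>
    using that by (intro hausdorff_premeasure_le_cover) auto
  then show ?thesis using True by (intro hausdorff_measure_0I) auto
next
  case False
  show ?thesis
  proof (rule hausdorff_measure_0I)
    fix \<delta> :: real assume "0 < \<delta>"
    have "hausdorff_premeasure r \<delta> (A i) = 0" if "i \<in> I" for i
      using assms(2)[OF that] \<open>0 < \<delta>\<close> unfolding hausdorff_measure_def
      by (metis SUP_upper greaterThan_iff le_zero_eq)
    then have "(\<Sum>i. hausdorff_premeasure r \<delta> (A (from_nat_into I i))) = 0"
      using from_nat_into[OF False] by simp
    moreover have "(\<Union>i\<in>I. A i) = (\<Union>i. A (from_nat_into I i))"
      using range_from_nat_into[OF False assms(1)] by (metis image_image)
    ultimately show "hausdorff_premeasure r \<delta> (\<Union>i\<in>I. A i) = 0"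
      using hausdorff_premeasure_UN_le[of r \<delta> "\<lambda>i. A (from_nat_into I i)"] by simp
  qed
qed

lemma nn_integral_count_space_eq_suminf:
  fixes h :: "'b::countable \<Rightarrow> ennreal"
  shows "(\<integral>\<^sup>+w. h w \<partial>count_space W) = (\<Sum>i. if i \<in> to_nat ` W then h (from_nat i) else 0)"
proof -
  have "(\<Sum>i. if i \<in> to_nat ` W then h (from_nat i) else 0)
      = (\<integral>\<^sup>+i. h (from_nat i) * indicator (to_nat ` W) i \<partial>count_space UNIV)"
    unfolding nn_integral_count_space_nat by (intro arg_cong[where f = suminf]) (auto simp: indicator_def)
  also have "\<dots> = (\<integral>\<^sup>+i. h (from_nat i) \<partial>count_space (to_nat ` W))"
    by (rule nn_integral_count_space_indicator[symmetric]) simp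
  also have "\<dots> = (\<integral>\<^sup>+w. h (from_nat (to_nat w)) \<partial>count_space W)"
    by (rule nn_integral_bij_count_space[symmetric]) (auto simp: bij_betw_def inj_on_def)
  finally show ?thesis by simp
qed

text \<open>Covers will be indexed by words. Writing their sums as integrals for the counting
  measure gives Tonelli and monotone convergence without summability conditions, and
  \<open>d\<close> allows an upper estimate in place of the diameter.\<close>

lemma hausdorff_premeasure_le_nn_integral:
  fixes V :: "'b::countable \<Rightarrow> 'a::metric_space set"
  assumes cover: "A \<subseteq> (\<Union>w\<in>W. V w)"
    and "\<And>w. w \<in> W \<Longrightarrow> bounded (V w)"
    and "\<And>w. w \<in> W \<Longrightarrow> diameter (V w) \<le> d w" "\<And>w. w \<in> W \<Longrightarrow> d w \<le> \<delta>" "0 \<le> \<delta>" "0 < r"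
  shows "hausdorff_premeasure r \<delta> A \<le> (\<integral>\<^sup>+w. ennreal (d w powr r) \<partial>count_space W)"
proof -
  define U where "U i = (if i \<in> to_nat ` W then V (from_nat i) else {})" for i
  have "hausdorff_premeasure r \<delta> A \<le> (\<Sum>i. ennreal (diameter (U i) powr r))"
  proof (rule hausdorff_premeasure_le_cover)
    show "A \<subseteq> (\<Union>i. U i)"
    proof
      fix x assume "x \<in> A"
      then obtain w where "w \<in> W" "x \<in> V w" using cover by blast
      then have "x \<in> U (to_nat w)" by (simp add: U_def)
      then show "x \<in> (\<Union>i. U i)" by blast
    qed
    show "bounded (U i)" for i using assms by (auto simp: U_def)
    show "diameter (U i) \<le> \<delta>" for i
      using order_trans[OF assms(3,4)] assms(5) by (auto simp: U_def)
  qed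
  also have "\<dots> \<le> (\<Sum>i. if i \<in> to_nat ` W then ennreal (d (from_nat i) powr r) else 0)"
    using assms by (intro suminf_le) (auto simp: U_def intro!: ennreal_leI powr_mono2 diameter_ge_0)
  also have "\<dots> = (\<integral>\<^sup>+w. ennreal (d w powr r) \<partial>count_space W)"
    by (rule nn_integral_count_space_eq_suminf[symmetric])
  finally show ?thesis .
qed

section \<open>Sums over words\<close>

text \<open>The alphabet depends on the position, because prescribed and free digits have different
  ranges. Positions count from 1 and list indices from 0, hence \<open>A (Suc i)\<close>.\<close>

definition words :: "(nat \<Rightarrow> nat set) \<Rightarrow> nat \<Rightarrow> nat list set" where
  "words A m = {w. length w = m \<and> (\<forall>i<m. w ! i \<in> A (Suc i))}"

lemma words_0 [simp]: "words A 0 = {[]}"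
  by (auto simp: words_def)

lemma words_append_iff:
  assumes "length u = m"
  shows "u @ v \<in> words A (m + k) \<longleftrightarrow> u \<in> words A m \<and> v \<in> words (\<lambda>i. A (m + i)) k"
proof
  assume *: "u @ v \<in> words A (m + k)"
  have "u ! i \<in> A (Suc i)" if "i < m" for i
    using * that assms by (auto simp: words_def nth_append dest: spec[of _ i])
  moreover have "v ! i \<in> A (m + Suc i)" if "i < k" for i
    using * that assms by (auto simp: words_def nth_append dest: spec[of _ "m + i"])
  ultimately show "u \<in> words A m \<and> v \<in> words (\<lambda>i. A (m + i)) k"
    using * assms by (auto simp: words_def)
next
  assume *: "u \<in> words A m \<and> v \<in> words (\<lambda>i. A (m + i)) k"
  have "(u @ v) ! i \<in> A (Suc i)" if i: "i < m + k" for i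
  proof (cases "i < m")
    case True
    then show ?thesis using * assms by (auto simp: words_def nth_append)
  next
    case False
    then have "i - m < k" using i by simp
    then have "v ! (i - m) \<in> A (m + Suc (i - m))" using * unfolding words_def by blast
    moreover have "m + Suc (i - m) = Suc i" using False by simp
    ultimately show ?thesis using False assms by (simp add: nth_append)
  qed
  then show "u @ v \<in> words A (m + k)" using * by (auto simp: words_def)
qed

lemma words_pos:
  assumes "w \<in> words A m" "\<And>i. 1 \<le> i \<Longrightarrow> A i \<subseteq> {1..}"
  shows "pos_word w"
  unfolding pos_word_def
proof
  fix a assume "a \<in> set w"
  then obtain i where "i < length w" "w ! i = a" by (auto simp: in_set_conv_nth)
  then have "a \<in> A (Suc i)" using assms(1) by (auto simp: words_def)
  then show "1 \<le> a" using assms(2)[of "Suc i"] by auto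
qed

lemma prefix_in_words: "(\<And>j. 1 \<le> j \<Longrightarrow> j \<le> m \<Longrightarrow> a j \<in> A j) \<Longrightarrow> prefix a m \<in> words A m"
  by (auto simp: words_def nth_prefix)

lemma words_const: "words (\<lambda>_. D) m = {w. length w = m \<and> set w \<subseteq> D}"
  by (auto simp: words_def in_set_conv_nth subset_iff)

lemma nn_integral_count_space_indicator_UNIV:
  "(\<integral>\<^sup>+x. f x \<partial>count_space X) = (\<integral>\<^sup>+x. f x * indicator X x \<partial>count_space UNIV)"
  by (simp add: nn_integral_restrict_space[symmetric] restrict_count_space)

lemma nn_integral_count_space_Times:
  "(\<integral>\<^sup>+x. \<integral>\<^sup>+y. f x y \<partial>count_space Y \<partial>count_space X) = (\<integral>\<^sup>+(x, y). f x y \<partial>count_space (X \<times> Y))"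
proof -
  have "(\<integral>\<^sup>+x. \<integral>\<^sup>+y. f x y \<partial>count_space Y \<partial>count_space X)
      = (\<integral>\<^sup>+x. \<integral>\<^sup>+y. f x y * indicator (X \<times> Y) (x, y) \<partial>count_space UNIV \<partial>count_space UNIV)"
    unfolding nn_integral_count_space_indicator_UNIV[of X]
      nn_integral_count_space_indicator_UNIV[of Y]
    by (intro nn_integral_cong) (auto simp: indicator_def)
  also have "\<dots> = (\<integral>\<^sup>+z. (case z of (x, y) \<Rightarrow> f x y) * indicator (X \<times> Y) z \<partial>count_space UNIV)"
    using nn_integral_fst_count_space[of "\<lambda>z. (case z of (x, y) \<Rightarrow> f x y) * indicator (X \<times> Y) z"] by simp
  also have "\<dots> = (\<integral>\<^sup>+(x, y). f x y \<partial>count_space (X \<times> Y))"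
    by (rule nn_integral_count_space_indicator[symmetric]) simp
  finally show ?thesis .
qed

lemma nn_integral_count_space_subset:
  assumes "T \<subseteq> W"
  shows "(\<integral>\<^sup>+w. f w \<partial>count_space T) \<le> (\<integral>\<^sup>+w. f w \<partial>count_space W)"
proof -
  have "(\<integral>\<^sup>+w. f w * indicator T w \<partial>count_space UNIV) \<le> (\<integral>\<^sup>+w. f w * indicator W w \<partial>count_space UNIV)"
    using assms by (intro nn_integral_mono) (auto simp: indicator_def)
  then show ?thesis
    by (simp only: nn_integral_count_space_indicator_UNIV[of T] nn_integral_count_space_indicator_UNIV[of W])
qed

lemma nn_integral_words_append:
  "(\<integral>\<^sup>+w. f w \<partial>count_space (words A (m + k)))
    = (\<integral>\<^sup>+u. \<integral>\<^sup>+v. f (u @ v) \<partial>count_space (words (\<lambda>i. A (m + i)) k) \<partial>count_space (words A m))"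
proof -
  let ?A' = "\<lambda>i. A (m + i)"
  have "bij_betw (\<lambda>(u, v). u @ v) (words A m \<times> words ?A' k) (words A (m + k))"
  proof (rule bij_betwI')
    fix x y assume "x \<in> words A m \<times> words ?A' k" "y \<in> words A m \<times> words ?A' k"
    then have "length (fst x) = m" "length (fst y) = m" by (auto simp only: mem_Times_iff words_def mem_Collect_eq)
    then show "((case x of (u, v) \<Rightarrow> u @ v) = (case y of (u, v) \<Rightarrow> u @ v)) = (x = y)"
      by (simp add: split_beta prod_eq_iff)
  next
    fix x assume "x \<in> words A m \<times> words ?A' k"
    then obtain u v where x: "x = (u, v)" "u \<in> words A m" "v \<in> words ?A' k" by blast
    then have "length u = m" by (simp add: words_def)
    from words_append_iff[OF this, of v A k] x
    show "(case x of (u, v) \<Rightarrow> u @ v) \<in> words A (m + k)" by simp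
  next
    fix w assume w: "w \<in> words A (m + k)"
    then have "length (take m w) = m" "take m w @ drop m w = w" by (auto simp: words_def)
    then have "(take m w, drop m w) \<in> words A m \<times> words ?A' k"
      using words_append_iff[of "take m w" m "drop m w" A k] w by simp
    then show "\<exists>x\<in>words A m \<times> words ?A' k. w = (case x of (u, v) \<Rightarrow> u @ v)"
      by (rule rev_bexI) simp
  qed
  from nn_integral_bij_count_space[OF this, of f] show ?thesis
    by (simp add: nn_integral_count_space_Times split_beta')
qed

lemma nn_integral_words_1:
  "(\<integral>\<^sup>+w. f w \<partial>count_space (words A (Suc 0))) = (\<integral>\<^sup>+a. f [a] \<partial>count_space (A (Suc 0)))"
proof -
  have "bij_betw (\<lambda>a. [a]) (A (Suc 0)) (words A (Suc 0))"
    by (rule bij_betwI') (auto simp: words_def length_Suc_conv)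
  from nn_integral_bij_count_space[OF this, of f] show ?thesis by simp
qed

lemma nn_integral_words_Suc:
  "(\<integral>\<^sup>+w. f w \<partial>count_space (words A (Suc m)))
    = (\<integral>\<^sup>+u. \<integral>\<^sup>+a. f (u @ [a]) \<partial>count_space (A (Suc m)) \<partial>count_space (words A m))"
  using nn_integral_words_append[of A m 1 f] by (simp add: nn_integral_words_1)

text \<open>The partition function of the potential -2r log q over the alphabet \<open>D\<close>. It
  is \<open>ennreal\<close>-valued because for infinite \<open>D\<close> the sum may
  diverge.\<close>

definition zsum :: "nat set \<Rightarrow> real \<Rightarrow> nat \<Rightarrow> ennreal" where
  "zsum D r m = (\<integral>\<^sup>+w. ennreal (cf_den w 0 powr (- 2 * r)) \<partial>count_space (words (\<lambda>_. D) m))"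

lemma zsum_0 [simp]: "zsum D r 0 = 1"
  by (simp add: zsum_def nn_integral_count_space_finite)

lemma zsum_mult:
  "zsum D r m * zsum D r k = (\<integral>\<^sup>+u. \<integral>\<^sup>+v. ennreal (cf_den u 0 powr (- 2 * r) * cf_den v 0 powr (- 2 * r))
      \<partial>count_space (words (\<lambda>_. D) k) \<partial>count_space (words (\<lambda>_. D) m))"
  by (simp add: zsum_def ennreal_mult' nn_integral_cmult nn_integral_multc)

lemma zsum_add_le:
  assumes "D \<subseteq> {1..}" "0 \<le> r"
  shows "zsum D r (m + k) \<le> zsum D r m * zsum D r k"
  unfolding zsum_mult unfolding zsum_def nn_integral_words_append
proof (intro nn_integral_mono ennreal_leI)
  fix u v assume "u \<in> space (count_space (words (\<lambda>_. D) m))" "v \<in> space (count_space (words (\<lambda>i. D) k))"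
  then have p: "pos_word u" "pos_word v" using assms words_pos[of _ "\<lambda>_. D"] by auto
  show "cf_den (u @ v) 0 powr (- 2 * r) \<le> cf_den u 0 powr (- 2 * r) * cf_den v 0 powr (- 2 * r)"
    using p assms cf_den_pos[of u 0] cf_den_pos[of v 0]
    by (subst powr_mult[symmetric]) (auto intro!: powr_mono2' cf_den_append_ge)
qed

text \<open>The factor 2 of \<open>cf_den_append_le\<close>, raised to the power 2r, is the constant
  \<open>4 powr r\<close>, which reappears in all estimates of the pressure.\<close>

lemma zsum_add_ge:
  assumes "D \<subseteq> {1..}" "0 \<le> r"
  shows "zsum D r m * zsum D r k \<le> ennreal (4 powr r) * zsum D r (m + k)"
proof -
  have "zsum D r m * zsum D r k \<le> (\<integral>\<^sup>+u. \<integral>\<^sup>+v. ennreal (4 powr r * cf_den (u @ v) 0 powr (- 2 * r))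
      \<partial>count_space (words (\<lambda>_. D) k) \<partial>count_space (words (\<lambda>_. D) m))"
    unfolding zsum_mult
  proof (intro nn_integral_mono ennreal_leI)
    fix u v assume "u \<in> space (count_space (words (\<lambda>_. D) m))" "v \<in> space (count_space (words (\<lambda>i. D) k))"
    then have p: "pos_word u" "pos_word v" using assms words_pos[of _ "\<lambda>_. D"] by auto
    have pos: "0 < cf_den u 0" "0 < cf_den v 0" "0 < cf_den (u @ v) 0" using p by (auto intro: cf_den_pos)
    have "cf_den u 0 powr (- 2 * r) * cf_den v 0 powr (- 2 * r)
        = 4 powr r * (2 * cf_den u 0 * cf_den v 0) powr (- 2 * r)"
    proof -
      have "(4::real) powr r * 2 powr (- 2 * r) = 1"
        using powr_powr[of 2 2 r] by (simp add: powr_minus)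
      then show ?thesis using pos by (simp add: powr_mult)
    qed
    also have "\<dots> \<le> 4 powr r * cf_den (u @ v) 0 powr (- 2 * r)"
      using p pos assms by (intro mult_left_mono powr_mono2' cf_den_append_le) auto
    finally show "cf_den u 0 powr (- 2 * r) * cf_den v 0 powr (- 2 * r)
        \<le> 4 powr r * cf_den (u @ v) 0 powr (- 2 * r)" .
  qed
  also have "\<dots> = ennreal (4 powr r) * zsum D r (m + k)"
    unfolding zsum_def nn_integral_words_append by (simp add: ennreal_mult' nn_integral_cmult)
  finally show ?thesis .
qed

lemma nn_integral_count_space_ge1:
  "(\<integral>\<^sup>+a. f a \<partial>count_space {1::nat..}) = (\<Sum>i. f (Suc i))"
proof -
  have "bij_betw Suc UNIV {1..}"
    by (rule bij_betwI') (auto simp: Suc_le_eq gr0_conv_Suc)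
  from nn_integral_bij_count_space[OF this, of f] show ?thesis
    by (simp add: nn_integral_count_space_nat)
qed

lemma zsum_1_finite:
  assumes "1 / 2 < r" shows "zsum {1..} r 1 < top"
proof -
  have "summable (\<lambda>i. real (Suc i) powr (- 2 * r))"
    using summable_real_powr_iff[of "- 2 * r"] assms by (subst summable_Suc_iff) auto
  then have "(\<Sum>i. ennreal (real (Suc i) powr (- 2 * r))) < top"
    by (subst suminf_ennreal2) auto
  then show ?thesis
    by (simp add: zsum_def nn_integral_words_1 nn_integral_count_space_ge1[unfolded One_nat_def] del: of_nat_Suc)
qed

lemma zsum_power_le:
  assumes "0 \<le> r" shows "zsum {1..} r m \<le> zsum {1..} r 1 ^ m"
proof (induction m)
  case (Suc m)
  have "zsum {1..} r (Suc m) \<le> zsum {1..} r m * zsum {1..} r 1"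
    using zsum_add_le[of "{1..}" r m 1] assms by simp
  also have "\<dots> \<le> zsum {1..} r 1 ^ m * zsum {1..} r 1"
    by (intro mult_right_mono Suc) auto
  finally show ?case by (simp add: mult.commute)
qed simp

lemma zsum_finite:
  assumes "1 / 2 < r" shows "zsum {1..} r m < top"
proof -
  have "zsum {1..} r 1 ^ m < top" using zsum_1_finite[OF assms] by (simp add: power_less_top_ennreal)
  then show ?thesis using zsum_power_le[of r m] assms by (auto intro: le_less_trans)
qed

lemma zsum_pos:
  assumes "D \<subseteq> {1..}" "D \<noteq> {}"
  shows "0 < zsum D r m"
proof -
  obtain a where a: "a \<in> D" using assms by blast
  let ?w = "replicate m a"
  have w: "?w \<in> words (\<lambda>_. D) m" using a by (auto simp: words_const)
  then have "0 < cf_den ?w 0"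
    using words_pos[of ?w "\<lambda>_. D"] assms by (intro cf_den_pos) auto
  then have "0 < ennreal (cf_den ?w 0 powr (- 2 * r))" by simp
  also have "\<dots> = (\<integral>\<^sup>+w. ennreal (cf_den w 0 powr (- 2 * r)) \<partial>count_space {?w})"
    by (simp add: nn_integral_count_space_finite)
  also have "\<dots> \<le> zsum D r m"
    unfolding zsum_def using w by (intro nn_integral_count_space_subset) auto
  finally show ?thesis .
qed

lemma zsum_finite_alphabet:
  assumes "finite D"
  shows "zsum D r m = ennreal (\<Sum>w\<in>words (\<lambda>_. D) m. cf_den w 0 powr (- 2 * r))"
proof -
  have "finite (words (\<lambda>_. D) m)"
    using finite_lists_length_eq[OF assms, of m] by (simp add: words_const conj_commute)
  then show ?thesis by (simp add: zsum_def nn_integral_count_space_finite)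
qed

text \<open>A word of length \<open>m\<close> uses finitely many letters, so the words over
  \<open>{1..M}\<close> exhaust all words as \<open>M\<close> grows, and monotone convergence
  applies. This is how the lower bounds restrict to bounded free digits with little loss of
  pressure.\<close>

lemma zsum_truncate:
  assumes "x < zsum {1..} r m"
  shows "\<exists>M\<ge>1. x < zsum {1..M} r m"
proof -
  let ?f = "\<lambda>w. ennreal (cf_den w 0 powr (- 2 * r))"
  let ?g = "\<lambda>M w. ?f w * indicator (words (\<lambda>_. {1..M}) m) w"
  have mono: "words (\<lambda>_. {1..M}) m \<subseteq> words (\<lambda>_. {1..M'}) m" if "M \<le> M'" for M M'
    using that by (auto simp: words_const subset_iff)
  have sup: "(SUP M. ?g M w) = ?f w * indicator (words (\<lambda>_. {1..}) m) w" for w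
  proof (cases "w \<in> words (\<lambda>_. {1..}) m")
    case True
    then have "w \<in> words (\<lambda>_. {1..Max (set w)}) m" by (auto simp: words_const)
    then have "?f w \<le> (SUP M. ?g M w)"
      by (intro SUP_upper2[of "Max (set w)"]) auto
    moreover have "(SUP M. ?g M w) \<le> ?f w" by (intro SUP_least) (auto simp: indicator_def)
    ultimately show ?thesis using True by auto
  next
    case False
    then have "w \<notin> words (\<lambda>_. {1..M}) m" for M by (auto simp: words_const)
    then show ?thesis using False by simp
  qed
  have inc: "incseq ?g"
  proof (rule incseq_SucI, rule le_funI)
    fix M w show "?g M w \<le> ?g (Suc M) w"
      using mono[of M "Suc M"] by (auto simp: indicator_def)
  qed
  have "zsum {1..} r m = (\<integral>\<^sup>+w. (SUP M. ?g M w) \<partial>count_space UNIV)"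
    by (simp only: sup zsum_def nn_integral_count_space_indicator_UNIV[of "words (\<lambda>_. {1..}) m"])
  also have "\<dots> = (SUP M. \<integral>\<^sup>+w. ?g M w \<partial>count_space UNIV)"
    by (rule nn_integral_monotone_convergence_SUP[OF inc]) auto
  also have "\<dots> = (SUP M. zsum {1..M} r m)"
    by (simp only: zsum_def nn_integral_count_space_indicator_UNIV[of "words (\<lambda>_. {1..M}) m" for M])
  finally obtain M where M: "x < zsum {1..M} r m" using assms by (auto simp: less_SUP_iff)
  have "zsum {1..M} r m \<le> zsum {1..max M 1} r m"
    unfolding zsum_def by (intro nn_integral_count_space_subset mono) simp
  then show ?thesis using M by (intro exI[of _ "max M 1"]) auto
qed

section \<open>The pressure function\<close>

lemma infsum_eq_nn_integral:
  assumes "\<And>w. w \<in> W \<Longrightarrow> 0 \<le> f w" "(\<integral>\<^sup>+w. ennreal (f w) \<partial>count_space W) < top"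
  shows "f summable_on W" "ennreal (infsum f W) = (\<integral>\<^sup>+w. ennreal (f w) \<partial>count_space W)"
proof -
  have int: "integrable (count_space W) f"
    using assms by (intro integrableI_nonneg) (auto simp: AE_count_space)
  then have abs: "Infinite_Set_Sum.abs_summable_on f W"
    by (simp add: Infinite_Set_Sum.abs_summable_on_def)
  show "f summable_on W"
    using abs abs_summable_equivalent abs_summable_summable by blast
  have "(\<integral>\<^sup>+w. ennreal (f w) \<partial>count_space W) = ennreal (infsetsum f W)"
    unfolding infsetsum_def using assms by (intro nn_integral_eq_integral int) (auto simp: AE_count_space)
  then show "ennreal (infsum f W) = (\<integral>\<^sup>+w. ennreal (f w) \<partial>count_space W)"
    using infsetsum_infsum[OF abs] by simp
qed

text \<open>Computing \<open>L (k * m)\<close> from \<open>L m\<close> and from \<open>L k\<close>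
  gives \<open>\<bar>L m / m - L k / k\<bar> \<le> c / m + c / k\<close>, hence a Cauchy sequence.
  Letting k tend to infinity in the same inequality yields the error bound with the original
  constant \<open>c\<close>, uniformly in \<open>m\<close>.\<close>

lemma almost_additive_limit:
  fixes L :: "nat \<Rightarrow> real"
  assumes "\<And>m k. \<bar>L (m + k) - L m - L k\<bar> \<le> c"
  shows "\<exists>P. (\<lambda>m. L m / real m) \<longlonglongrightarrow> P \<and> (\<forall>m. \<bar>L m - real m * P\<bar> \<le> c)"
proof -
  have mult: "\<bar>L (Suc k * m) - real (Suc k) * L m\<bar> \<le> real k * c" for k m
  proof (induction k)
    case (Suc k)
    have "\<bar>L (m + Suc k * m) - L m - L (Suc k * m)\<bar> \<le> c" by (rule assms)
    moreover have "real (Suc (Suc k)) * L m = L m + real (Suc k) * L m" "real (Suc k) * c = c + real k * c"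
      by (simp_all add: algebra_simps)
    moreover have "Suc (Suc k) * m = m + Suc k * m" by simp
    ultimately show ?case using Suc by (simp only: abs_le_iff) linarith
  qed simp
  have c: "0 \<le> c" using assms[of 0 0] by linarith
  have mult': "\<bar>L (k * m) - real k * L m\<bar> \<le> real k * c" if "1 \<le> k" for k m
  proof -
    have "real (k - 1) * c \<le> real k * c" using c by (intro mult_right_mono) auto
    then show ?thesis using mult[of "k - 1" m] that by simp
  qed
  have diff: "\<bar>L m / real m - L k / real k\<bar> \<le> c / real m + c / real k" if "1 \<le> m" "1 \<le> k" for m k
  proof -
    have "\<bar>L (k * m) - real k * L m\<bar> \<le> real k * c" "\<bar>L (k * m) - real m * L k\<bar> \<le> real m * c"
      using mult'[OF that(2), of m] mult'[OF that(1), of k] by (simp_all add: mult.commute)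
    then have "\<bar>real k * L m - real m * L k\<bar> \<le> (real k + real m) * c"
      unfolding distrib_right by linarith
    moreover have "\<bar>L m / real m - L k / real k\<bar> = \<bar>real k * L m - real m * L k\<bar> / (real m * real k)"
    proof -
      have "L m / real m - L k / real k = (real k * L m - real m * L k) / (real m * real k)"
        using that by (simp add: field_simps)
      then show ?thesis by simp
    qed
    moreover have "c / real m + c / real k = (real k + real m) * c / (real m * real k)"
      using that by (simp add: field_simps)
    ultimately show ?thesis by (simp add: divide_right_mono)
  qed
  have c0: "(\<lambda>m. c / real m) \<longlonglongrightarrow> 0"
    by (rule lim_const_over_n)
  have "Cauchy (\<lambda>m. L m / real m)"
  proof (rule CauchyI')
    fix e :: real assume "0 < e"
    then have "\<forall>\<^sub>F m in sequentially. c / real m < e / 2"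
      using order_tendstoD(2)[OF c0, of "e / 2"] by simp
    then obtain M where M: "\<And>m. M \<le> m \<Longrightarrow> c / real m < e / 2"
      unfolding eventually_sequentially by blast
    have "dist (L m / real m) (L k / real k) < e" if mk: "max M 1 \<le> m" "m < k" for m k
    proof -
      have "1 \<le> m" "1 \<le> k" "M \<le> m" "M \<le> k" using mk by auto
      then show ?thesis using diff[of m k] M[of m] M[of k] unfolding dist_real_def by linarith
    qed
    then show "\<exists>M. \<forall>m\<ge>M. \<forall>n>m. dist (L m / real m) (L n / real n) < e" by blast
  qed
  then obtain P where P: "(\<lambda>m. L m / real m) \<longlonglongrightarrow> P"
    using Cauchy_convergent convergent_def by blast
  have "\<bar>L m - real m * P\<bar> \<le> c" for m
  proof (cases "m = 0")
    case True
    then show ?thesis using assms[of 0 0] by simp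
  next
    case False
    have "(\<lambda>k. \<bar>L m / real m - L k / real k\<bar>) \<longlonglongrightarrow> \<bar>L m / real m - P\<bar>"
      by (intro tendsto_intros P)
    moreover have "(\<lambda>k. c / real m + c / real k) \<longlonglongrightarrow> c / real m + 0"
      by (intro tendsto_add tendsto_const c0)
    ultimately have "\<bar>L m / real m - P\<bar> \<le> c / real m + 0"
      by (rule LIMSEQ_le) (use diff[of m] False in \<open>auto intro!: exI[of _ 1]\<close>)
    then have "\<bar>(L m - real m * P) / real m\<bar> \<le> c / real m"
      using False by (simp add: field_simps)
    then show ?thesis using False by (simp add: divide_le_cancel)
  qed
  then show ?thesis using P by blast
qed

text \<open>Faithful for \<open>1 / 2 < r\<close>, where \<open>zsum\<close> is finite;
  \<open>enn2real\<close> would send an infinite sum to 0.\<close>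

definition Zsum :: "real \<Rightarrow> nat \<Rightarrow> real" where
  "Zsum r m = enn2real (zsum {1..} r m)"

lemma ennreal_Zsum: "1 / 2 < r \<Longrightarrow> ennreal (Zsum r m) = zsum {1..} r m"
  using zsum_finite[of r m] by (simp add: Zsum_def)

lemma Zsum_pos: "1 / 2 < r \<Longrightarrow> 0 < Zsum r m"
  using zsum_finite[of r m] zsum_pos[of "{1..}" r m] by (simp add: Zsum_def enn2real_positive_iff)

lemma Zsum_eq_infsum:
  assumes "1 / 2 < r"
  shows "(\<lambda>w. cf_den w 0 powr (- 2 * r)) summable_on words (\<lambda>_. {1..}) m"
    and "Zsum r m = (\<Sum>\<^sub>\<infinity>w\<in>words (\<lambda>_. {1..}) m. cf_den w 0 powr (- 2 * r))"
proof -
  note * = infsum_eq_nn_integral[of "words (\<lambda>_. {1..}) m" "\<lambda>w. cf_den w 0 powr (- 2 * r)"]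
  show "(\<lambda>w. cf_den w 0 powr (- 2 * r)) summable_on words (\<lambda>_. {1..}) m"
    using * zsum_finite[OF assms, of m] by (simp add: zsum_def)
  have "ennreal (\<Sum>\<^sub>\<infinity>w\<in>words (\<lambda>_. {1..}) m. cf_den w 0 powr (- 2 * r)) = zsum {1..} r m"
    using * zsum_finite[OF assms, of m] by (simp add: zsum_def)
  then show "Zsum r m = (\<Sum>\<^sub>\<infinity>w\<in>words (\<lambda>_. {1..}) m. cf_den w 0 powr (- 2 * r))"
    unfolding Zsum_def by (metis enn2real_ennreal infsum_nonneg powr_ge_zero)
qed

lemma Zsum_eq_infsum_denom:
  assumes "1 / 2 < r"
  shows "(\<Sum>\<^sub>\<infinity>as\<in>{as. length as = m \<and> (\<forall>a\<in>set as. a \<ge> 1)}. real_of_int (cfrac_denom as) powr (- 2 * r))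
    = Zsum r m"
proof -
  have W: "{as. length as = m \<and> (\<forall>a\<in>set as. (a::nat) \<ge> 1)} = words (\<lambda>_. {1..}) m"
    by (auto simp: words_const)
  show ?thesis
    unfolding W Zsum_eq_infsum(2)[OF assms]
    using words_pos[of _ "\<lambda>_. {1..}" m] by (intro infsum_cong) (simp add: cfrac_denom_eq)
qed

lemma Zsum_almost_additive:
  assumes "1 / 2 < r"
  shows "\<bar>ln (Zsum r (m + k)) - ln (Zsum r m) - ln (Zsum r k)\<bar> \<le> r * ln 4"
proof -
  note pos = Zsum_pos[OF assms]
  have "ennreal (Zsum r (m + k)) \<le> ennreal (Zsum r m * Zsum r k)"
    using zsum_add_le[of "{1..}" r m k] assms pos by (simp add: ennreal_Zsum ennreal_mult less_imp_le)
  then have 1: "Zsum r (m + k) \<le> Zsum r m * Zsum r k"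
    using pos by (subst (asm) ennreal_le_iff) (simp_all add: less_imp_le)
  have "ennreal (Zsum r m * Zsum r k) \<le> ennreal (4 powr r * Zsum r (m + k))"
    using zsum_add_ge[of "{1..}" r m k] assms pos by (simp add: ennreal_Zsum ennreal_mult less_imp_le)
  then have 2: "Zsum r m * Zsum r k \<le> 4 powr r * Zsum r (m + k)"
    using pos by (subst (asm) ennreal_le_iff) (simp_all add: less_imp_le)
  have "ln (Zsum r (m + k)) \<le> ln (Zsum r m) + ln (Zsum r k)"
    using 1 pos by (subst ln_mult_pos[symmetric]) auto
  moreover have "ln (Zsum r m) + ln (Zsum r k) \<le> ln (4 powr r * Zsum r (m + k))"
    using 2 pos by (subst ln_mult_pos[symmetric]) auto
  moreover have "ln (4 powr r * Zsum r (m + k)) = r * ln 4 + ln (Zsum r (m + k))"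
    using pos[of "m + k"] by (simp add: ln_mult)
  moreover have "0 \<le> r * ln 4" using assms by simp
  ultimately show ?thesis by linarith
qed

text \<open>Almost additivity makes the limit in the definition of \<open>pressure\<close> exist, so
  \<open>lim\<close> denotes it. The second claim is the one used in coverings:
  \<open>Zsum r m\<close> equals \<open>exp (m * pressure r)\<close> up to the factor
  \<open>4 powr r\<close>, uniformly in \<open>m\<close>.\<close>

lemma
  assumes "1 / 2 < r"
  shows pressure_tendsto: "(\<lambda>m. ln (Zsum r m) / real m) \<longlonglongrightarrow> pressure r"
    and ln_Zsum_pressure: "\<bar>ln (Zsum r m) - real m * pressure r\<bar> \<le> r * ln 4"
proof -
  obtain P where P: "(\<lambda>m. ln (Zsum r m) / real m) \<longlonglongrightarrow> P"
    "\<And>m. \<bar>ln (Zsum r m) - real m * P\<bar> \<le> r * ln 4"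
    using almost_additive_limit[OF Zsum_almost_additive[OF assms]] by blast
  have "pressure r = P"
    unfolding pressure_def Zsum_eq_infsum_denom[OF assms] using P(1) by (rule limI)
  then show "(\<lambda>m. ln (Zsum r m) / real m) \<longlonglongrightarrow> pressure r"
    "\<bar>ln (Zsum r m) - real m * pressure r\<bar> \<le> r * ln 4" using P by auto
qed

lemma zsum_le_pressure:
  assumes "1 / 2 < r"
  shows "zsum {1..} r m \<le> ennreal (4 powr r * exp (pressure r * real m))"
proof -
  have "ln (Zsum r m) \<le> r * ln 4 + pressure r * real m"
    using ln_Zsum_pressure[OF assms, of m] by (simp add: mult.commute abs_le_iff)
  then have "Zsum r m \<le> exp (r * ln 4 + pressure r * real m)"
    using Zsum_pos[OF assms, of m] by (simp flip: ln_le_cancel_iff)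
  also have "\<dots> = 4 powr r * exp (pressure r * real m)"
    by (simp add: powr_def exp_add)
  finally show ?thesis
    unfolding ennreal_Zsum[OF assms, symmetric] by (rule ennreal_leI)
qed

text \<open>Passing from \<open>r\<close> to \<open>r'\<close> multiplies each term by q^(-2(r' -
  r)), and q is at least \<open>2 ^ (m div 2)\<close> for all words of length
  \<open>m\<close>.\<close>

lemma Zsum_antimono:
  assumes "1 / 2 < r" "r \<le> r'"
  shows "Zsum r' m * (2 ^ (m div 2)) powr (2 * (r' - r)) \<le> Zsum r m"
proof -
  have "(\<Sum>\<^sub>\<infinity>w\<in>words (\<lambda>_. {1..}) m. cf_den w 0 powr (- 2 * r') * (2 ^ (m div 2)) powr (2 * (r' - r)))
      \<le> (\<Sum>\<^sub>\<infinity>w\<in>words (\<lambda>_. {1..}) m. cf_den w 0 powr (- 2 * r))"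
  proof (rule infsum_mono)
    show "(\<lambda>w. cf_den w 0 powr (- 2 * r') * (2 ^ (m div 2)) powr (2 * (r' - r))) summable_on words (\<lambda>_. {1..}) m"
      using assms by (intro summable_on_cmult_left Zsum_eq_infsum(1)) auto
    show "(\<lambda>w. cf_den w 0 powr (- 2 * r)) summable_on words (\<lambda>_. {1..}) m"
      using assms by (intro Zsum_eq_infsum(1)) auto
    fix w :: "nat list" assume w: "w \<in> words (\<lambda>_. {1..}) m"
    then have p: "pos_word w" "length w = m" using words_pos[of w "\<lambda>_. {1..}"] by (auto simp: words_def)
    have "cf_den w 0 powr (- 2 * r') * (2 ^ (m div 2)) powr (2 * (r' - r))
        \<le> cf_den w 0 powr (- 2 * r') * cf_den w 0 powr (2 * (r' - r))"
      using p cf_den_ge_power2[of w] assms by (intro mult_left_mono powr_mono2) auto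
    also have "\<dots> = cf_den w 0 powr (- 2 * r)"
      by (simp add: powr_add[symmetric] algebra_simps)
    finally show "cf_den w 0 powr (- 2 * r') * (2 ^ (m div 2)) powr (2 * (r' - r)) \<le> cf_den w 0 powr (- 2 * r)" .
  qed
  then show ?thesis
    using assms by (simp add: Zsum_eq_infsum(2) infsum_cmult_left')
qed

text \<open>The denominator doubles every two letters and enters with exponent 2, which makes ln 2
  per letter. The rounding in \<open>m div 2\<close> loses at most one letter and vanishes after
  division by \<open>m\<close>.\<close>

lemma pressure_decreasing:
  assumes "1 / 2 < r" "r \<le> r'"
  shows "pressure r' + (r' - r) * ln 2 \<le> pressure r"
proof -
  have "ln (Zsum r' m) / real m + ((real m - 1) / real m) * ((r' - r) * ln 2) \<le> ln (Zsum r m) / real m"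
    if "1 \<le> m" for m
  proof -
    have "ln (Zsum r' m) + ln ((2 ^ (m div 2)) powr (2 * (r' - r))) \<le> ln (Zsum r m)"
      using Zsum_antimono[OF assms, of m] Zsum_pos[of r' m] Zsum_pos[of r m] assms
      by (subst ln_mult_pos[symmetric]) auto
    also have "ln ((2 ^ (m div 2) :: real) powr (2 * (r' - r))) = real (2 * (m div 2)) * ((r' - r) * ln 2)"
      by (simp add: ln_powr ln_realpow)
    finally have *: "ln (Zsum r' m) + real (2 * (m div 2)) * ((r' - r) * ln 2) \<le> ln (Zsum r m)" .
    have "m \<le> 2 * (m div 2) + 1" by presburger
    then have "real m - 1 \<le> real (2 * (m div 2))" by linarith
    then have "(real m - 1) * ((r' - r) * ln 2) \<le> real (2 * (m div 2)) * ((r' - r) * ln 2)"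
      using assms by (intro mult_right_mono) auto
    then have "ln (Zsum r' m) + (real m - 1) * ((r' - r) * ln 2) \<le> ln (Zsum r m)" using * by linarith
    then have "(ln (Zsum r' m) + (real m - 1) * ((r' - r) * ln 2)) / real m \<le> ln (Zsum r m) / real m"
      by (intro divide_right_mono) auto
    then show ?thesis by (simp add: add_divide_distrib)
  qed
  moreover have "(\<lambda>m. (real m - 1) / real m) \<longlonglongrightarrow> 1"
  proof -
    have "(\<lambda>m. 1 - 1 / real m) \<longlonglongrightarrow> 1 - 0"
      by (intro tendsto_diff tendsto_const lim_const_over_n)
    moreover have "\<forall>\<^sub>F m in sequentially. 1 - 1 / real m = (real m - 1) / real m"
      by (rule eventually_sequentiallyI[of 1]) (simp add: field_simps)
    ultimately show ?thesis using Lim_transform_eventually by fastforce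
  qed
  then have "(\<lambda>m. ln (Zsum r' m) / real m + ((real m - 1) / real m) * ((r' - r) * ln 2))
      \<longlonglongrightarrow> pressure r' + 1 * ((r' - r) * ln 2)"
    using assms by (intro tendsto_add tendsto_mult tendsto_const pressure_tendsto) auto
  ultimately show ?thesis
    using pressure_tendsto[OF assms(1)] by (metis (no_types, lifting) LIMSEQ_le mult_1)
qed

text \<open>The summand 1/(q_m (q_m + q_(m-1))) is the length of the cylinder of \<open>w\<close>,
  and the cylinders of order \<open>m\<close> fill the unit interval up to a countable set. The
  proof is algebraic: the lengths of the children of a cylinder telescope over the last
  digit.\<close>

lemma zsum_interval_lengths:
  "(\<integral>\<^sup>+w. ennreal (1 / (cf_den w 0 * cf_den w 1)) \<partial>count_space (words (\<lambda>_. {1..}) m)) = 1"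
proof (induction m)
  case 0
  show ?case by (simp add: nn_integral_count_space_finite)
next
  case (Suc m)
  have "(\<integral>\<^sup>+a. ennreal (1 / (cf_den (w @ [a]) 0 * cf_den (w @ [a]) 1)) \<partial>count_space {1..})
      = ennreal (1 / (cf_den w 0 * cf_den w 1))" if w: "w \<in> words (\<lambda>_. {1..}) m" for w
  proof -
    have p: "pos_word w" using w words_pos[of w "\<lambda>_. {1..}"] by auto
    obtain q' where q': "\<And>y. 0 \<le> y \<Longrightarrow> cf_den w y = cf_den w 0 + q' * y"
      using cf_den_affine[OF p] by blast
    define q where "q = cf_den w 0"
    have q: "0 < q" using p by (simp add: q_def cf_den_pos)
    have "0 \<le> q'" using q'[of 1] cf_den_mono[OF p, of 0 1] by simp
    have den: "cf_den (w @ [a]) y = q * (real a + y) + q'" if "1 \<le> a" "0 \<le> y" for a y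
    proof -
      have "cf_den (w @ [a]) y = (q + q' * (1 / (real a + y))) * (real a + y)"
        using q'[of "1 / (real a + y)"] that by (simp add: cf_den_append q_def)
      also have "(q + q' * (1 / d)) * d = q * d + q'" if "d \<noteq> 0" for d
        using that by (simp add: distrib_right)
      finally show ?thesis using that by simp
    qed
    \<comment> \<open>\<open>g i\<close> is the distance between \<open>cf_val w 0\<close> and
      \<open>cf_val w (1 / real (Suc i))\<close>, an endpoint of the child with last digit
      \<open>Suc i\<close>; consecutive differences are the lengths of the children.\<close>
    define g where "g i = 1 / (q * (q * real (Suc i) + q'))" for i
    have g: "1 / (cf_den (w @ [Suc i]) 0 * cf_den (w @ [Suc i]) 1) = g i - g (Suc i)" for i
    proof -
      have "0 < q * real (Suc i) + q'" "0 < q * real (Suc (Suc i)) + q'"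
        using q \<open>0 \<le> q'\<close> by (auto intro!: add_pos_nonneg mult_pos_pos simp del: of_nat_Suc)
      then have "g i - g (Suc i) = 1 / ((q * real (Suc i) + q') * (q * real (Suc (Suc i)) + q'))"
        using q unfolding g_def by (simp add: divide_simps del: of_nat_Suc) (simp add: algebra_simps)
      then show ?thesis by (simp add: den add.commute)
    qed
    have "g \<longlonglongrightarrow> 0"
    proof (rule tendsto_sandwich[of "\<lambda>_. 0"])
      show "(\<lambda>i. (1 / q\<^sup>2) / real (Suc i)) \<longlonglongrightarrow> 0"
        using LIMSEQ_Suc[OF lim_const_over_n[of "1 / q\<^sup>2"]] by simp
      show "\<forall>\<^sub>F i in sequentially. g i \<le> (1 / q\<^sup>2) / real (Suc i)"
        unfolding g_def divide_divide_eq_left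
        using q \<open>0 \<le> q'\<close> by (intro always_eventually allI frac_le)
          (auto simp: power2_eq_square algebra_simps simp del: of_nat_Suc intro!: mult_pos_pos)
      show "\<forall>\<^sub>F i in sequentially. 0 \<le> g i"
        unfolding g_def using q \<open>0 \<le> q'\<close> by (intro always_eventually allI) auto
    qed auto
    then have "(\<lambda>i. g i - g (Suc i)) sums (g 0 - 0)" by (rule telescope_sums')
    moreover have "0 \<le> g i - g (Suc i)" for i
      unfolding g[symmetric] using cf_den_pos[of "w @ [Suc i]" 0] cf_den_pos[of "w @ [Suc i]" 1] p by simp
    ultimately have "(\<Sum>i. ennreal (g i - g (Suc i))) = ennreal (g 0 - 0)"
      by (intro suminf_ennreal_eq) auto
    moreover have "g 0 - 0 = 1 / (cf_den w 0 * cf_den w 1)"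
      using q'[of 1] by (simp add: g_def q_def)
    ultimately show ?thesis
      unfolding nn_integral_count_space_ge1 g by simp
  qed
  then have "(\<integral>\<^sup>+w. ennreal (1 / (cf_den w 0 * cf_den w 1)) \<partial>count_space (words (\<lambda>_. {1..}) (Suc m)))
      = (\<integral>\<^sup>+w. ennreal (1 / (cf_den w 0 * cf_den w 1)) \<partial>count_space (words (\<lambda>_. {1..}) m))"
    unfolding nn_integral_words_Suc by (intro nn_integral_cong) simp
  then show ?case using Suc by simp
qed

text \<open>q^(-2) lies between the length of the cylinder and twice that length, and the lengths
  add up to 1. Hence all partition sums at exponent 1 lie in [1,2].\<close>

lemma pressure_1: "pressure 1 = 0"
proof -
  have p: "pos_word w" if "w \<in> words (\<lambda>_. {1..}) m" for w m
    using that words_pos[of w "\<lambda>_. {1..}"] by auto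
  have Z: "1 \<le> Zsum 1 m" "Zsum 1 m \<le> 2" for m
  proof -
    have "1 \<le> zsum {1..} 1 m"
      unfolding zsum_def zsum_interval_lengths[of m, symmetric]
    proof (intro nn_integral_mono ennreal_leI)
      fix w assume "w \<in> space (count_space (words (\<lambda>_. {1..}) m))"
      then have w: "pos_word w" using p by auto
      have "1 / (cf_den w 0 * cf_den w 1) \<le> 1 / (cf_den w 0 * cf_den w 0)"
        using w cf_den_mono[OF w, of 0 1] cf_den_pos[OF w, of 0] cf_den_pos[OF w, of 1]
        by (intro divide_left_mono mult_left_mono) auto
      also have "\<dots> = cf_den w 0 powr (- 2 * 1)"
        using cf_den_pos[OF w, of 0] by (simp add: powr_minus powr_numeral power2_eq_square inverse_eq_divide)
      finally show "1 / (cf_den w 0 * cf_den w 1) \<le> cf_den w 0 powr (- 2 * 1)" .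
    qed
    then show "1 \<le> Zsum 1 m"
      using ennreal_Zsum[of 1 m] ennreal_le_iff2[of 1 "Zsum 1 m"] by simp
    have "zsum {1..} 1 m \<le> (\<integral>\<^sup>+w. ennreal (2 * (1 / (cf_den w 0 * cf_den w 1))) \<partial>count_space (words (\<lambda>_. {1..}) m))"
      unfolding zsum_def
    proof (intro nn_integral_mono ennreal_leI)
      fix w assume "w \<in> space (count_space (words (\<lambda>_. {1..}) m))"
      then have w: "pos_word w" using p by auto
      have "cf_den w 0 powr (- 2 * 1) = 2 / (cf_den w 0 * (2 * cf_den w 0))"
        using cf_den_pos[OF w, of 0] by (simp add: powr_minus powr_numeral power2_eq_square inverse_eq_divide)
      also have "\<dots> \<le> 2 / (cf_den w 0 * cf_den w 1)"
        using w cf_den_le_double[OF w, of 1] cf_den_pos[OF w, of 0] cf_den_pos[OF w, of 1]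
        by (intro divide_left_mono mult_left_mono) auto
      finally show "cf_den w 0 powr (- 2 * 1) \<le> 2 * (1 / (cf_den w 0 * cf_den w 1))" by simp
    qed
    also have "\<dots> = ennreal 2 * 1"
      unfolding zsum_interval_lengths[of m, symmetric] by (simp only: ennreal_mult' nn_integral_cmult) (simp add: nn_integral_cmult)
    finally show "Zsum 1 m \<le> 2"
      using ennreal_Zsum[of 1 m] ennreal_le_iff[of 2 "Zsum 1 m"] by simp
  qed
  have "(\<lambda>m. ln (Zsum 1 m) / real m) \<longlonglongrightarrow> 0"
  proof (rule tendsto_sandwich[of "\<lambda>_. 0"])
    show "(\<lambda>m. ln 2 / real m) \<longlonglongrightarrow> 0" by (rule lim_const_over_n)
    have "ln (Zsum 1 m) \<le> ln 2" for m using Z[of m] by simp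
    then show "\<forall>\<^sub>F m in sequentially. ln (Zsum 1 m) / real m \<le> ln 2 / real m"
      by (intro always_eventually allI divide_right_mono) auto
    show "\<forall>\<^sub>F m in sequentially. 0 \<le> ln (Zsum 1 m) / real m"
      using Z by (intro always_eventually allI divide_nonneg_nonneg) auto
  qed auto
  then show ?thesis using pressure_tendsto[of 1] LIMSEQ_unique by fastforce
qed

text \<open>Serves to obtain continuity. Log-convexity of the partition sums is Hoelder's
  inequality, derived termwise from Young's inequality; convexity survives the limit.\<close>

lemma pressure_convex: "convex_on {1/2<..} pressure"
proof (rule convex_onI)
  show "convex ({1/2<..} :: real set)" by (rule convex_real_interval)
  fix t x y :: real
  assume t: "0 < t" "t < 1" and xy: "x \<in> {1/2<..}" "y \<in> {1/2<..}"
  define z where "z = (1 - t) * x + t * y"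
  have "(1 - t) * (1/2) + t * (1/2) < z"
    using t xy unfolding z_def by (intro add_strict_mono mult_strict_left_mono) auto
  moreover have "(1 - t) * (1/2) + t * (1/2) = 1 / 2" by (simp add: field_simps)
  ultimately have z: "1 / 2 < z" by linarith
  have log_convex: "ln (Zsum z m) \<le> (1 - t) * ln (Zsum x m) + t * ln (Zsum y m)" for m
  proof -
    have pos: "0 < Zsum x m" "0 < Zsum y m" using xy by (auto intro: Zsum_pos)
    \<comment> \<open>The Hoelder bound itself. After dividing by \<open>Zsum x m\<close> and
      \<open>Zsum y m\<close>, the two Young terms sum to \<open>1 - t\<close> and \<open>t\<close>,
      so the total is exactly \<open>K\<close>.\<close>
    define K where "K = Zsum x m powr (1 - t) * Zsum y m powr t"
    let ?W = "words (\<lambda>_. {1..}) m"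
    let ?h = "\<lambda>w. K * ((1 - t) / Zsum x m) * cf_den w 0 powr (- 2 * x) + K * (t / Zsum y m) * cf_den w 0 powr (- 2 * y)"
    have sx: "(\<lambda>w. K * ((1 - t) / Zsum x m) * cf_den w 0 powr (- 2 * x)) summable_on ?W"
      and sy: "(\<lambda>w. K * (t / Zsum y m) * cf_den w 0 powr (- 2 * y)) summable_on ?W"
      using xy by (intro summable_on_cmult_right Zsum_eq_infsum(1); simp)+
    have "Zsum z m \<le> infsum ?h ?W"
      unfolding Zsum_eq_infsum(2)[OF z]
    proof (rule infsum_mono)
      show "(\<lambda>w. cf_den w 0 powr (- 2 * z)) summable_on ?W" by (rule Zsum_eq_infsum(1)[OF z])
      show "?h summable_on ?W" using sx sy by (rule summable_on_add)
      fix w :: "nat list" assume "w \<in> ?W"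
      then have q: "0 < cf_den w 0" using words_pos[of w "\<lambda>_. {1..}"] by (auto intro: cf_den_pos)
      let ?a = "cf_den w 0 powr (- 2 * x)" and ?b = "cf_den w 0 powr (- 2 * y)"
      have "cf_den w 0 powr (- 2 * z) = ?a powr (1 - t) * ?b powr t"
        unfolding powr_powr powr_add[symmetric] by (simp add: z_def algebra_simps)
      also have "\<dots> = K * ((?a / Zsum x m) powr (1 - t) * (?b / Zsum y m) powr t)"
        using pos by (simp add: K_def powr_divide)
      also have "\<dots> \<le> K * ((1 - t) * (?a / Zsum x m) + t * (?b / Zsum y m))"
        using t pos q by (intro mult_left_mono Youngs_inequality_0) (auto simp: K_def)
      finally show "cf_den w 0 powr (- 2 * z) \<le> ?h w" by (simp add: algebra_simps)
    qed
    also have "\<dots> = K * ((1 - t) / Zsum x m) * Zsum x m + K * (t / Zsum y m) * Zsum y m"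
      unfolding infsum_add[OF sx sy] infsum_cmult_right'
      using xy by (simp only: Zsum_eq_infsum(2)[symmetric] greaterThan_iff)
    also have "\<dots> = K * (1 - t) + K * t" using pos by simp
    also have "\<dots> = K" by (simp add: algebra_simps)
    finally have "ln (Zsum z m) \<le> ln K" using Zsum_pos[OF z, of m] by simp
    also have "ln K = (1 - t) * ln (Zsum x m) + t * ln (Zsum y m)"
      using pos by (simp add: K_def ln_mult ln_powr)
    finally show ?thesis .
  qed
  have "(\<lambda>m. ln (Zsum z m) / real m) \<longlonglongrightarrow> pressure z" using z by (rule pressure_tendsto)
  moreover have "(\<lambda>m. (1 - t) * (ln (Zsum x m) / real m) + t * (ln (Zsum y m) / real m))
      \<longlonglongrightarrow> (1 - t) * pressure x + t * pressure y"
    using xy by (intro tendsto_intros pressure_tendsto) auto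
  moreover have "ln (Zsum z m) / real m \<le> (1 - t) * (ln (Zsum x m) / real m) + t * (ln (Zsum y m) / real m)" for m
    using divide_right_mono[OF log_convex[of m], of "real m"] by (simp add: add_divide_distrib)
  ultimately have "pressure z \<le> (1 - t) * pressure x + t * pressure y"
    by (intro LIMSEQ_le) auto
  then show "pressure ((1 - t) *\<^sub>R x + t *\<^sub>R y) \<le> (1 - t) * pressure x + t * pressure y"
    by (simp add: z_def)
qed

lemma pressure_continuous: "continuous_on {1/2<..} pressure"
  by (rule convex_on_continuous[OF _ pressure_convex]) simp

text \<open>As the exponent tends to 1/2, the sum over one letter approaches the divergent harmonic
  series. One letter already controls the pressure up to the error \<open>r * ln 4\<close>, which is
  at most the \<open>ln 4\<close> built into \<open>K\<close> because r < 1.\<close>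

lemma pressure_unbounded: "\<exists>r. 1 / 2 < r \<and> r < 1 \<and> B < pressure r"
proof -
  define K where "K = exp (B + ln 4)"
  have "\<exists>N. K < (\<Sum>a=1..N. 1 / real a)"
  proof (rule ccontr)
    assume "\<not> ?thesis"
    then have "(\<Sum>a<N. 1 / real (Suc a)) \<le> K" for N
      unfolding sum.atLeast1_atMost_eq[symmetric, of "\<lambda>a. 1 / real a"] by (auto simp: not_less)
    then have "summable (\<lambda>a. 1 / real (Suc a))"
      by (intro summableI_nonneg_bounded) auto
    then show False
      using not_summable_harmonic[where 'a = real] summable_Suc_iff[of "\<lambda>n. 1 / real n"] by (simp add: inverse_eq_divide)
  qed
  then obtain N where N: "K < (\<Sum>a=1..N. 1 / real a)" by blast
  have "((\<lambda>r. \<Sum>a=1..N. real a powr (- 2 * r)) \<longlongrightarrow> (\<Sum>a=1..N. real a powr (- 2 * (1/2)))) (at_right (1/2))"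
    by (intro tendsto_sum tendsto_intros) auto
  moreover have "(\<Sum>a=1..N. real a powr (- 2 * (1/2))) = (\<Sum>a=1..N. 1 / real a)"
    by (intro sum.cong) (auto simp: powr_minus_divide)
  ultimately have "\<forall>\<^sub>F r in at_right (1/2). K < (\<Sum>a=1..N. real a powr (- 2 * r))"
    using N by (intro order_tendstoD) auto
  moreover have "\<forall>\<^sub>F r in at_right (1/2::real). r \<in> {1/2<..<1}"
    by (rule eventually_at_right_real) simp
  ultimately have "\<forall>\<^sub>F r in at_right (1/2). K < (\<Sum>a=1..N. real a powr (- 2 * r)) \<and> r \<in> {1/2<..<1}"
    by (rule eventually_conj)
  then obtain r where r: "K < (\<Sum>a=1..N. real a powr (- 2 * r))" "1 / 2 < r" "r < 1"
    using eventually_happens[of _ "at_right (1/2::real)"] by auto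
  have "ennreal (\<Sum>a=1..N. real a powr (- 2 * r)) \<le> zsum {1..} r 1"
  proof -
    have "(\<integral>\<^sup>+a. ennreal (real a powr (- 2 * r)) \<partial>count_space {1..N})
        \<le> (\<integral>\<^sup>+a. ennreal (real a powr (- 2 * r)) \<partial>count_space {1..})"
      by (intro nn_integral_count_space_subset) auto
    then show ?thesis
      by (simp add: zsum_def nn_integral_words_1 nn_integral_count_space_finite)
  qed
  then have "(\<Sum>a=1..N. real a powr (- 2 * r)) \<le> Zsum r 1"
    using Zsum_pos[OF r(2), of 1] unfolding ennreal_Zsum[OF r(2), symmetric] by (subst (asm) ennreal_le_iff) auto
  then have "K < Zsum r 1" using r(1) by linarith
  then have "ln K < ln (Zsum r 1)" unfolding K_def by (intro ln_less_cancel_iff[THEN iffD2]) (auto intro: less_trans[OF exp_gt_zero])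
  then have "B + ln 4 < ln (Zsum r 1)" by (simp add: K_def)
  moreover have "ln (Zsum r 1) \<le> pressure r + r * ln 4"
    using ln_Zsum_pressure[OF r(2), of 1] by simp
  moreover have "r * ln 4 \<le> 1 * ln 4" using r by (intro mult_right_mono) auto
  ultimately have "B < pressure r" by linarith
  then show ?thesis using r by blast
qed

text \<open>The difference \<open>f\<close> of the two sides is strictly decreasing, since the
  pressure decreases and \<open>2 * a - b\<close> is positive; it equals -a at 1 and is positive
  near 1/2. So the root exists, is unique and lies below 1.\<close>

lemma pressure_equation:
  assumes "0 < a" "0 \<le> b" "b \<le> a"
  shows "\<exists>!\<theta>. 1 / 2 < \<theta> \<and> pressure \<theta> = (2 * a - b) * \<theta> - (a - b)"
    and "1 / 2 < \<theta> \<Longrightarrow> pressure \<theta> = (2 * a - b) * \<theta> - (a - b) \<Longrightarrow> \<theta> < 1"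
proof -
  define f where "f r = pressure r - ((2 * a - b) * r - (a - b))" for r
  have dec: "f r' < f r" if "1 / 2 < r" "r < r'" for r r'
  proof -
    have "pressure r' + (r' - r) * ln 2 \<le> pressure r" using that by (intro pressure_decreasing) auto
    moreover have "0 < (r' - r) * ln 2" using that by simp
    moreover have "(2 * a - b) * r < (2 * a - b) * r'" using that assms by (intro mult_strict_left_mono) auto
    ultimately show ?thesis unfolding f_def by linarith
  qed
  have f1: "f 1 < 0" using assms by (simp add: f_def pressure_1 algebra_simps)
  have lt1: "\<theta> < 1" if "1 / 2 < \<theta>" "f \<theta> = 0" for \<theta>
    using that dec[of 1 \<theta>] f1 by (cases \<theta> "1::real" rule: linorder_cases) auto
  \<comment> \<open>For r < 1 the linear side is at most \<open>a\<close>, so a pressure above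
    \<open>2 * a\<close> is enough for \<open>0 < f r\<close>.\<close>
  obtain r where r: "1 / 2 < r" "r < 1" "2 * a < pressure r" using pressure_unbounded by blast
  have "(2 * a - b) * r \<le> (2 * a - b) * 1" using r assms by (intro mult_left_mono) auto
  then have "(2 * a - b) * r - (a - b) \<le> a" unfolding mult_1_right by linarith
  then have fr: "0 < f r" using r assms unfolding f_def by linarith
  have "continuous_on {r..1} f"
    unfolding f_def by (intro continuous_intros continuous_on_subset[OF pressure_continuous]) (use r in auto)
  then obtain \<theta> where \<theta>: "r \<le> \<theta>" "\<theta> \<le> 1" "f \<theta> = 0"
    using IVT2'[of f 1 0 r] f1 fr r by auto
  have f_iff: "f \<theta> = 0 \<longleftrightarrow> pressure \<theta> = (2 * a - b) * \<theta> - (a - b)" for \<theta>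
    by (auto simp: f_def)
  have "\<exists>!\<theta>. 1 / 2 < \<theta> \<and> f \<theta> = 0"
  proof (rule ex1I[of _ \<theta>])
    fix x assume "1 / 2 < x \<and> f x = 0"
    then show "x = \<theta>" using dec[of x \<theta>] dec[of \<theta> x] \<theta> r by (cases x \<theta> rule: linorder_cases) auto
  qed (use \<theta> r in auto)
  then show "\<exists>!\<theta>. 1 / 2 < \<theta> \<and> pressure \<theta> = (2 * a - b) * \<theta> - (a - b)" by (simp only: f_iff)
  show "1 / 2 < \<theta> \<Longrightarrow> pressure \<theta> = (2 * a - b) * \<theta> - (a - b) \<Longrightarrow> \<theta> < 1" for \<theta>
    using lt1 f_iff by simp
qed

section \<open>Coverings by cylinders\<close>

text \<open>Letters are processed from the right end. A letter at a position of \<open>F\<close> is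
  cut out by \<open>cf_den_insert_ge\<close> and leaves the factor
  \<open>(c i / 2) powr (- 2 * r)\<close> for each of its choices; a free letter moves into the
  suffix \<open>v\<close>. In the end the free letters form one word over \<open>D\<close>. The
  general suffix is needed because processed free letters stand to the right of the next letter to
  be cut.\<close>

lemma nn_integral_words_forced:
  fixes c :: "nat \<Rightarrow> real"
  assumes D: "D \<subseteq> {1..}" and r: "0 \<le> r"
    and A: "\<And>i. 1 \<le> i \<Longrightarrow> A i \<subseteq> {1..}" "\<And>i. 1 \<le> i \<Longrightarrow> i \<notin> F \<Longrightarrow> A i \<subseteq> D"
    and F: "\<And>i. i \<in> F \<Longrightarrow> finite (A i)" "\<And>i a. i \<in> F \<Longrightarrow> a \<in> A i \<Longrightarrow> c i \<le> real a" "\<And>i. i \<in> F \<Longrightarrow> 0 < c i"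
    and v: "pos_word v"
  shows "(\<integral>\<^sup>+w. ennreal (cf_den (w @ v) 0 powr (- 2 * r)) \<partial>count_space (words A N))
    \<le> ennreal (\<Prod>i\<in>F \<inter> {1..N}. real (card (A i)) * (c i / 2) powr (- 2 * r)) *
      (\<integral>\<^sup>+u. ennreal (cf_den (u @ v) 0 powr (- 2 * r)) \<partial>count_space (words (\<lambda>_. D) (card ({1..N} - F))))"
  using v
proof (induction N arbitrary: v)
  case 0
  then show ?case by simp
next
  case (Suc N)
  let ?P = "\<lambda>N. \<Prod>i\<in>F \<inter> {1..N}. real (card (A i)) * (c i / 2) powr (- 2 * r)"
  let ?f = "\<lambda>w. ennreal (cf_den w 0 powr (- 2 * r))"
  let ?A = "A (Suc N)"
  \<comment> \<open>Tonelli makes the last letter the outer variable, so that the induction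
    hypothesis applies to the inner integral with the suffix \<open>a # v\<close>.\<close>
  have swap: "(\<integral>\<^sup>+w. ?f (w @ v) \<partial>count_space (words A (Suc N)))
      = (\<integral>\<^sup>+a. \<integral>\<^sup>+w. ?f (w @ a # v) \<partial>count_space (words A N) \<partial>count_space ?A)"
    unfolding nn_integral_words_Suc by (subst nn_integral_count_space_nn_integral) simp_all
  show ?case
  proof (cases "Suc N \<in> F")
    case True
    have sets: "F \<inter> {1..Suc N} = insert (Suc N) (F \<inter> {1..N})" "{1..Suc N} - F = {1..N} - F"
      using True by (auto simp: le_Suc_eq)
    let ?c = "(c (Suc N) / 2) powr (- 2 * r)"
    let ?I = "\<integral>\<^sup>+w. ?f (w @ v) \<partial>count_space (words A N)"
    have "(\<integral>\<^sup>+w. ?f (w @ a # v) \<partial>count_space (words A N)) \<le> ennreal ?c * ?I" if a: "a \<in> ?A" for a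
    proof -
      have "(\<integral>\<^sup>+w. ?f (w @ a # v) \<partial>count_space (words A N)) \<le> (\<integral>\<^sup>+w. ennreal ?c * ?f (w @ v) \<partial>count_space (words A N))"
      proof (intro nn_integral_mono)
        fix w assume "w \<in> space (count_space (words A N))"
        then have w: "pos_word w" using words_pos A(1) by auto
        have a1: "1 \<le> a" using a A(1)[of "Suc N"] by auto
        have q: "0 < cf_den (w @ v) 0" using w Suc.prems by (intro cf_den_pos) auto
        have "c (Suc N) / 2 * cf_den (w @ v) 0 \<le> real a / 2 * cf_den (w @ v) 0"
          using F(2)[OF True a] q by (intro mult_right_mono) auto
        also have "\<dots> \<le> cf_den (w @ a # v) 0" using w Suc.prems a1 by (intro cf_den_insert_ge)
        finally have "cf_den (w @ a # v) 0 powr (- 2 * r) \<le> (c (Suc N) / 2 * cf_den (w @ v) 0) powr (- 2 * r)"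
          using F(3)[OF True] q r by (intro powr_mono2') auto
        also have "\<dots> = ?c * cf_den (w @ v) 0 powr (- 2 * r)"
          by (rule powr_mult)
        finally show "?f (w @ a # v) \<le> ennreal ?c * ?f (w @ v)"
          by (simp add: ennreal_mult'[symmetric] ennreal_leI)
      qed
      then show ?thesis by (simp add: nn_integral_cmult)
    qed
    then have "(\<integral>\<^sup>+w. ?f (w @ v) \<partial>count_space (words A (Suc N))) \<le> (\<integral>\<^sup>+a. ennreal ?c * ?I \<partial>count_space ?A)"
      unfolding swap by (intro nn_integral_mono) auto
    also have "\<dots> = ennreal (real (card ?A) * ?c) * ?I"
      using F(1)[OF True] by (simp add: ennreal_mult' ennreal_of_nat_eq_real_of_nat mult_ac)
    also have "\<dots> \<le> ennreal (real (card ?A) * ?c) * (ennreal (?P N) *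
        (\<integral>\<^sup>+u. ?f (u @ v) \<partial>count_space (words (\<lambda>_. D) (card ({1..N} - F)))))"
      by (intro mult_left_mono Suc) auto
    also have "\<dots> = ennreal (?P (Suc N)) *
        (\<integral>\<^sup>+u. ?f (u @ v) \<partial>count_space (words (\<lambda>_. D) (card ({1..Suc N} - F))))"
      unfolding sets by (subst prod.insert) (simp_all add: ennreal_mult' prod_nonneg mult_ac)
    finally show ?thesis .
  next
    case False
    have sets: "F \<inter> {1..Suc N} = F \<inter> {1..N}" "{1..Suc N} - F = insert (Suc N) ({1..N} - F)"
      using False by (auto simp: le_Suc_eq)
    have card: "card ({1..Suc N} - F) = Suc (card ({1..N} - F))"
      unfolding sets by (subst card_insert_disjoint) auto
    let ?m = "card ({1..N} - F)"
    have "(\<integral>\<^sup>+w. ?f (w @ v) \<partial>count_space (words A (Suc N)))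
        \<le> (\<integral>\<^sup>+a. \<integral>\<^sup>+w. ?f (w @ a # v) \<partial>count_space (words A N) \<partial>count_space D)"
      unfolding swap using A(2)[OF _ False] by (intro nn_integral_count_space_subset) auto
    also have "\<dots> \<le> (\<integral>\<^sup>+a. ennreal (?P N) * (\<integral>\<^sup>+u. ?f (u @ a # v) \<partial>count_space (words (\<lambda>_. D) ?m)) \<partial>count_space D)"
      using D Suc.prems by (intro nn_integral_mono Suc.IH) auto
    also have "\<dots> = ennreal (?P N) * (\<integral>\<^sup>+a. \<integral>\<^sup>+u. ?f (u @ a # v) \<partial>count_space (words (\<lambda>_. D) ?m) \<partial>count_space D)"
      by (simp add: nn_integral_cmult)
    also have "(\<integral>\<^sup>+a. \<integral>\<^sup>+u. ?f (u @ a # v) \<partial>count_space (words (\<lambda>_. D) ?m) \<partial>count_space D)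
        = (\<integral>\<^sup>+u. ?f (u @ v) \<partial>count_space (words (\<lambda>_. D) (Suc ?m)))"
      unfolding nn_integral_words_Suc by (subst nn_integral_count_space_nn_integral) simp_all
    finally show ?thesis unfolding card sets(1) .
  qed
qed

lemma irr_unit_cf_val:
  assumes "x \<in> irr_unit"
  obtains z where "0 < z" "z < 1"
    "x = cf_val (prefix (digits x) N) (1 / (real (digits x (Suc N)) + z))"
proof
  let ?b = "\<lambda>j. digits x (Suc N + j)"
  have p: "pos_seq (digits x)" using assms by (rule digits_pos_seq)
  show "0 < cf_lim ?b" "cf_lim ?b < 1"
    by (rule cf_lim_pos[OF pos_seq_shift[OF p]], rule cf_lim_less_1[OF pos_seq_shift[OF p]])
  have "x = cf_val (prefix (digits x) (Suc N)) (cf_lim ?b)"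
    using cf_lim_eq_cf_val[OF p, of "Suc N"] cf_lim_digits[OF assms] by simp
  then show "x = cf_val (prefix (digits x) N) (1 / (real (digits x (Suc N)) + cf_lim ?b))"
    by (simp add: prefix_Suc cf_val_append)
qed

lemma
  assumes "pos_word w" "0 \<le> e"
  shows bounded_cf_val_image: "bounded (cf_val w ` {0..e})"
    and diameter_cf_val_image: "diameter (cf_val w ` {0..e}) \<le> e / (cf_den w 0)\<^sup>2"
proof -
  have *: "\<bar>cf_val w y - cf_val w z\<bar> \<le> e / (cf_den w 0)\<^sup>2" if "y \<in> {0..e}" "z \<in> {0..e}" for y z
  proof -
    have "\<bar>y - z\<bar> / (cf_den w 0)\<^sup>2 \<le> e / (cf_den w 0)\<^sup>2"
      using that by (intro divide_right_mono) auto
    then show ?thesis using cf_val_dist_le[OF assms(1), of y z] that by auto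
  qed
  have "cf_val w ` {0..e} \<subseteq> cball (cf_val w 0) (e / (cf_den w 0)\<^sup>2)"
    using *[of 0] assms by (auto simp: dist_real_def)
  then show "bounded (cf_val w ` {0..e})" using bounded_subset bounded_cball by blast
  show "diameter (cf_val w ` {0..e}) \<le> e / (cf_den w 0)\<^sup>2"
    using * assms by (intro diameter_le) auto
qed

text \<open>Since digit N + 1 exceeds \<open>s\<close>, the tail after \<open>N\<close> digits lies
  in \<open>{0..1 / s}\<close>, whose image under \<open>cf_val w\<close> has diameter at most 1/(s
  q^2). That digit is confined and not enumerated, so it enters with the power -r and without a
  count; this is where \<beta> separates from \<alpha> in the pressure equation.\<close>

lemma hausdorff_premeasure_cylinders:
  assumes A: "\<And>i. 1 \<le> i \<Longrightarrow> A i \<subseteq> {1..}" and s: "0 < s" "1 / s \<le> \<delta>" and r: "0 < r"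
    and S: "S \<subseteq> {x \<in> irr_unit. (\<forall>j. 1 \<le> j \<and> j \<le> N \<longrightarrow> digits x j \<in> A j) \<and> s < real (digits x (Suc N))}"
  shows "hausdorff_premeasure r \<delta> S
    \<le> ennreal (s powr (- r)) * (\<integral>\<^sup>+w. ennreal (cf_den w 0 powr (- 2 * r)) \<partial>count_space (words A N))"
proof -
  have p: "pos_word w" if "w \<in> words A N" for w using words_pos[OF that A] .
  have "hausdorff_premeasure r \<delta> S \<le> (\<integral>\<^sup>+w. ennreal (((1 / s) / (cf_den w 0)\<^sup>2) powr r) \<partial>count_space (words A N))"
  proof (rule hausdorff_premeasure_le_nn_integral)
    show "S \<subseteq> (\<Union>w\<in>words A N. cf_val w ` {0..1 / s})"
    proof
      fix x assume "x \<in> S"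
      then have x: "x \<in> irr_unit" "\<And>j. 1 \<le> j \<Longrightarrow> j \<le> N \<Longrightarrow> digits x j \<in> A j" "s < real (digits x (Suc N))"
        using S by auto
      obtain z where z: "0 < z" "x = cf_val (prefix (digits x) N) (1 / (real (digits x (Suc N)) + z))"
        using irr_unit_cf_val[OF x(1), of N] by metis
      have "1 / (real (digits x (Suc N)) + z) \<in> {0..1 / s}"
        using x(3) z(1) s by (auto intro!: divide_left_mono mult_pos_pos)
      then have "x \<in> cf_val (prefix (digits x) N) ` {0..1 / s}"
        using z(2) by (metis imageI)
      then show "x \<in> (\<Union>w\<in>words A N. cf_val w ` {0..1 / s})"
        using prefix_in_words[of N "digits x" A] x(2) by blast
    qed
    fix w assume w: "w \<in> words A N"
    show "bounded (cf_val w ` {0..1 / s})" "diameter (cf_val w ` {0..1 / s}) \<le> 1 / s / (cf_den w 0)\<^sup>2"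
      using p[OF w] s by (intro bounded_cf_val_image diameter_cf_val_image; simp)+
    have "1 / s / (cf_den w 0)\<^sup>2 \<le> 1 / s / 1"
      using cf_den_ge_1[OF p[OF w]] s by (intro divide_left_mono) auto
    then show "1 / s / (cf_den w 0)\<^sup>2 \<le> \<delta>" using s by simp
  next
    have "0 < 1 / s" using s by simp
    then show "0 \<le> \<delta>" using s(2) by linarith
  qed (rule r)
  also have "\<dots> = (\<integral>\<^sup>+w. ennreal (s powr (- r)) * ennreal (cf_den w 0 powr (- 2 * r)) \<partial>count_space (words A N))"
  proof (intro nn_integral_cong)
    fix w assume "w \<in> space (count_space (words A N))"
    then have q: "0 < cf_den w 0" using p by (auto intro: cf_den_pos)
    have "((1 / s) / (cf_den w 0)\<^sup>2) powr r = (s powr (-1) * cf_den w 0 powr (- 2)) powr r"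
      using q s by (simp add: powr_minus powr_numeral divide_inverse)
    also have "\<dots> = s powr (- r) * cf_den w 0 powr (- 2 * r)"
      unfolding powr_mult powr_powr by simp
    finally show "ennreal (((1 / s) / (cf_den w 0)\<^sup>2) powr r) = ennreal (s powr (- r)) * ennreal (cf_den w 0 powr (- 2 * r))"
      by (simp add: ennreal_mult')
  qed
  also have "\<dots> = ennreal (s powr (- r)) * (\<integral>\<^sup>+w. ennreal (cf_den w 0 powr (- 2 * r)) \<partial>count_space (words A N))"
    by (simp add: nn_integral_cmult)
  finally show ?thesis .
qed

lemma
  fixes s t :: real
  assumes "0 \<le> s" "0 \<le> t"
  shows finite_nat_interval: "finite {a::nat. s < real a \<and> real a \<le> s + t}"
    and card_nat_interval_le: "real (card {a::nat. s < real a \<and> real a \<le> s + t}) \<le> t + 1"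
    and card_nat_interval_ge: "t - 1 \<le> real (card {a::nat. s < real a \<and> real a \<le> s + t})"
proof -
  have eq: "{a::nat. s < real a \<and> real a \<le> s + t} = {nat \<lfloor>s\<rfloor> <..nat \<lfloor>s + t\<rfloor>}"
  proof (intro set_eqI)
    fix a :: nat
    have "s < real a \<longleftrightarrow> \<lfloor>s\<rfloor> < int a" by linarith
    moreover have "real a \<le> s + t \<longleftrightarrow> int a \<le> \<lfloor>s + t\<rfloor>" by linarith
    ultimately show "a \<in> {a. s < real a \<and> real a \<le> s + t} \<longleftrightarrow> a \<in> {nat \<lfloor>s\<rfloor> <..nat \<lfloor>s + t\<rfloor>}"
      using assms by (auto simp: nat_less_iff le_nat_iff)
  qed
  have fl: "0 \<le> \<lfloor>s\<rfloor>" "\<lfloor>s\<rfloor> \<le> \<lfloor>s + t\<rfloor>" using assms by (auto intro: floor_mono)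
  then have c: "real (card {a::nat. s < real a \<and> real a \<le> s + t}) = of_int (\<lfloor>s + t\<rfloor> - \<lfloor>s\<rfloor>)"
    using order_trans[OF fl] unfolding eq card_greaterThanAtMost
    by (simp only: of_nat_diff[OF nat_mono[OF fl(2)]] of_nat_nat of_int_diff)
  show "finite {a::nat. s < real a \<and> real a \<le> s + t}" unfolding eq by simp
  show "real (card {a::nat. s < real a \<and> real a \<le> s + t}) \<le> t + 1" unfolding c by linarith
  show "t - 1 \<le> real (card {a::nat. s < real a \<and> real a \<le> s + t})" unfolding c by linarith
qed

lemma ennreal_le_exp_imp_0:
  fixes x :: ennreal
  assumes "\<And>B. \<exists>y\<le>B. x \<le> ennreal (C * exp y)" "0 \<le> C"
  shows "x = 0"
proof (rule ccontr)
  assume "x \<noteq> 0"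
  have "x < top" using assms(1)[of 0] by (auto intro: le_less_trans)
  then obtain e where e: "x = ennreal e" "0 < e"
    using \<open>x \<noteq> 0\<close> by (cases x) (auto simp: less_le)
  have "\<exists>y\<le>ln (e / (2 * (C + 1))). e \<le> C * exp y"
    using assms(1)[of "ln (e / (2 * (C + 1)))"] e assms(2) by (auto simp: ennreal_le_iff)
  then obtain y where y: "y \<le> ln (e / (2 * (C + 1)))" "e \<le> C * exp y" by blast
  have "exp y \<le> e / (2 * (C + 1))"
    using y(1) e assms(2) by (subst (asm) ln_ge_iff) (auto intro: divide_pos_pos)
  then have "C * exp y \<le> C * (e / (2 * (C + 1)))" using assms(2) by (intro mult_left_mono) auto
  also have "\<dots> < e"
  proof -
    have "C * e < (2 * (C + 1)) * e" using e assms(2) by (intro mult_strict_right_mono) auto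
    then show ?thesis using assms(2) by (simp add: field_simps)
  qed
  finally show False using y(2) by simp
qed

text \<open>The set is a countable union of pieces \<open>S (K, u)\<close>, in which the constraints
  hold from index \<open>K\<close> on and the first \<open>n K\<close> digits are fixed. On a piece,
  covering at order \<open>n k - 1\<close> costs the displayed exponent up to a term depending on
  \<open>K\<close> only. Each \<open>k\<close> provides one cover, so it suffices that the exponent
  is very negative for infinitely many \<open>k\<close>. \<open>D\<close> is \<open>{1..}\<close>
  for \<open>E_L\<close> and \<open>{1..M}\<close> for bounded free digits.\<close>

lemma hausdorff_null_forced_digits:
  fixes n :: "nat \<Rightarrow> nat" and s t :: "nat \<Rightarrow> real"
  assumes mono: "strict_mono_on {1..} n" and n1: "\<And>k. 1 \<le> k \<Longrightarrow> 1 \<le> n k"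
    and spos: "\<And>k. 1 \<le> k \<Longrightarrow> 0 < s k" and tpos: "\<And>k. 1 \<le> k \<Longrightarrow> 0 < t k"
    and s: "filterlim s at_top sequentially"
    and r: "0 < r" and D: "D \<subseteq> {1..}"
    and C: "0 \<le> C" "\<And>m. zsum D r m \<le> ennreal (C * exp (\<kappa> * real m))"
    and small: "\<And>B. \<exists>\<^sub>F k in sequentially.
      \<kappa> * (real (n k) - real k) + (\<Sum>j\<in>{1..<k}. ln (t j + 1) - 2 * r * ln (s j / 2)) - r * ln (s k) \<le> B"
  shows "hausdorff_measure r {x \<in> irr_unit. (\<forall>j\<ge>1. j \<notin> n ` {1..} \<longrightarrow> digits x j \<in> D) \<and>
    (\<forall>\<^sub>F k in sequentially. s k < real (digits x (n k)) \<and> real (digits x (n k)) \<le> s k + t k)} = 0"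
    (is "hausdorff_measure r ?E = 0")
proof -
  define g where "g j = ln (t j + 1) - 2 * r * ln (s j / 2)" for j
  define \<Phi> where "\<Phi> k = \<kappa> * (real (n k) - real k) + sum g {1..<k} - r * ln (s k)" for k
  have small': "\<exists>\<^sub>F k in sequentially. \<Phi> k \<le> B" for B
    using small[of B] unfolding \<Phi>_def g_def[abs_def] .
  define S where "S = (\<lambda>(K, u). {x \<in> irr_unit. (\<forall>j\<ge>1. j \<notin> n ` {1..} \<longrightarrow> digits x j \<in> D) \<and>
    (\<forall>k\<ge>K. s k < real (digits x (n k)) \<and> real (digits x (n k)) \<le> s k + t k) \<and>
    prefix (digits x) (n K) = u})"
  have less: "n i < n j \<longleftrightarrow> i < j" if "1 \<le> i" "1 \<le> j" for i j
    using strict_mono_on_less[OF mono, of i j] that by simp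
  have inj: "inj_on n {1..}" using mono by (rule strict_mono_on_imp_inj_on)
  have null: "hausdorff_measure r (S (K, u)) = 0" if K: "1 \<le> K" for K u
  proof (cases "\<exists>x0. x0 \<in> S (K, u)")
    case False
    then have "S (K, u) = {}" by auto
    then show ?thesis using hausdorff_measure_null_UN[of "{} :: nat set" r "\<lambda>_. {}"] by simp
  next
    case True
    then obtain x0 where x0: "x0 \<in> S (K, u)" by blast
    then have u: "u = prefix (digits x0) (n K)" "pos_seq (digits x0)"
      using digits_pos_seq by (auto simp: S_def)
    define idx where "idx = inv_into {1..} n"
    have idx: "idx (n j) = j" if "1 \<le> j" for j
      using inv_into_f_f[OF inj, of j] that by (simp add: idx_def)
    \<comment> \<open>The fixed initial digits count as prescribed positions with one-letter
      alphabets and lower bound 1. Each contributes 2^(2r), altogether a constant for given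
      \<open>K\<close>.\<close>
    define Fk where "Fk = {1..n K} \<union> n ` {K<..}"
    define A where "A i = (if i \<le> n K then {digits x0 i}
        else if i \<in> n ` {K<..} then {a. s (idx i) < real a \<and> real a \<le> s (idx i) + t (idx i)} else D)" for i
    define c where "c i = (if i \<le> n K then 1 else s (idx i))" for i
    have gtK: "n K < n j" if "K < j" for j using less[of K j] that K by simp
    have A_forced: "A (n j) = {a. s j < real a \<and> real a \<le> s j + t j}" if "K < j" for j
      using gtK[OF that] idx[of j] that K by (auto simp: A_def)
    have A_pos: "A i \<subseteq> {1..}" if "1 \<le> i" for i
    proof (cases "i \<in> Fk")
      case True
      then consider "i \<le> n K" | j where "K < j" "i = n j" by (auto simp: Fk_def)
      then show ?thesis
      proof cases
        case 1
        then show ?thesis using that u(2) by (auto simp: A_def pos_seq_def)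
      next
        case 2
        then show ?thesis using A_forced[of j] spos[of j] K by (auto simp: Suc_le_eq intro: Nat.gr0I)
      qed
    qed (use that D in \<open>auto simp: A_def Fk_def\<close>)
    have bound: "hausdorff_premeasure r \<delta> (S (K, u)) \<le> ennreal (C * exp (\<Phi> k + real (n K) * (2 * r * ln 2) -
        sum g {1..K} - \<kappa> * (real (n K) - real K)))"
      if k: "K < k" "1 / s k \<le> \<delta>" for k \<delta>
    proof -
      have k1: "1 \<le> k" "0 < s k" using k K spos[of k] by auto
      \<comment> \<open>The order stops one short of the prescribed position, so that digit
        \<open>n k\<close> is the one handled by the factor \<open>s k powr (- r)\<close>.\<close>
      define N where "N = n k - 1"
      have N: "Suc N = n k" using n1[of k] k1 by (simp add: N_def)
      let ?I = "\<integral>\<^sup>+w. ennreal (cf_den w 0 powr (- 2 * r)) \<partial>count_space (words A N)"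
      have "hausdorff_premeasure r \<delta> (S (K, u)) \<le> ennreal (s k powr (- r)) * ?I"
      proof (rule hausdorff_premeasure_cylinders[OF A_pos k1(2) k(2) r], assumption)
        show "S (K, u) \<subseteq> {x \<in> irr_unit. (\<forall>j. 1 \<le> j \<and> j \<le> N \<longrightarrow> digits x j \<in> A j) \<and> s k < real (digits x (Suc N))}"
        proof
          fix x assume x: "x \<in> S (K, u)"
          have "digits x i \<in> A i" if i: "1 \<le> i" for i
          proof -
            consider "i \<le> n K" | j where "K < j" "i = n j" | "\<not> i \<le> n K" "i \<notin> n ` {K<..}" by blast
            then show ?thesis
            proof cases
              case 1
              have "prefix (digits x) (n K) ! (i - 1) = prefix (digits x0) (n K) ! (i - 1)"
                using x u by (auto simp: S_def)
              then show ?thesis using 1 i by (simp add: nth_prefix A_def)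
            next
              case 2
              then show ?thesis using x A_forced[of j] by (auto simp: S_def)
            next
              case 3
              have "i \<notin> n ` {1..}"
              proof
                assume "i \<in> n ` {1..}"
                then obtain j where j: "1 \<le> j" "i = n j" by auto
                then have "K < j" using 3(1) less[of j K] K by (cases "j = K") auto
                then show False using 3(2) j by auto
              qed
              then show ?thesis using x i 3 by (auto simp: S_def A_def)
            qed
          qed
          then show "x \<in> {x \<in> irr_unit. (\<forall>j. 1 \<le> j \<and> j \<le> N \<longrightarrow> digits x j \<in> A j) \<and> s k < real (digits x (Suc N))}"
            using x k(1) by (auto simp: S_def N)
        qed
      qed
      also have "?I \<le> ennreal (\<Prod>i\<in>Fk \<inter> {1..N}. real (card (A i)) * (c i / 2) powr (- 2 * r)) *
          zsum D r (card ({1..N} - Fk))"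
      proof -
        have fin: "finite (A i)" and cA: "\<And>a. a \<in> A i \<Longrightarrow> c i \<le> real a" and cpos: "0 < c i" if iF: "i \<in> Fk" for i
        proof -
          have "finite (A i) \<and> (\<forall>a\<in>A i. c i \<le> real a) \<and> 0 < c i"
          proof -
            consider "1 \<le> i" "i \<le> n K" | j where "K < j" "i = n j" using iF by (auto simp: Fk_def)
            then show ?thesis
            proof cases
              case 1
              then show ?thesis using u(2) by (auto simp: A_def c_def pos_seq_def Suc_le_eq)
            next
              case 2
              then have "c i = s j" using gtK[of j] idx[of j] K by (simp add: c_def)
              then show ?thesis
                using 2 A_forced[of j] spos[of j] tpos[of j] K finite_nat_interval[of "s j" "t j"] by auto
            qed
          qed
          then show "finite (A i)" "\<And>a. a \<in> A i \<Longrightarrow> c i \<le> real a" "0 < c i" by auto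
        qed
        have "?I = (\<integral>\<^sup>+w. ennreal (cf_den (w @ []) 0 powr (- 2 * r)) \<partial>count_space (words A N))" by simp
        also have "\<dots> \<le> ennreal (\<Prod>i\<in>Fk \<inter> {1..N}. real (card (A i)) * (c i / 2) powr (- 2 * r)) *
            (\<integral>\<^sup>+u. ennreal (cf_den (u @ []) 0 powr (- 2 * r)) \<partial>count_space (words (\<lambda>_. D) (card ({1..N} - Fk))))"
        proof (rule nn_integral_words_forced[OF D _ A_pos])
          show "A i \<subseteq> D" if "1 \<le> i" "i \<notin> Fk" for i
            using that by (auto simp: A_def Fk_def)
        qed (use r fin cA cpos in auto)
        finally show ?thesis by (simp add: zsum_def)
      qed
      also have "(\<Prod>i\<in>Fk \<inter> {1..N}. real (card (A i)) * (c i / 2) powr (- 2 * r))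
          \<le> exp (real (n K) * (2 * r * ln 2) + sum g {K<..<k})"
      proof -
        have FN: "Fk \<inter> {1..N} = {1..n K} \<union> n ` {K<..<k}"
        proof -
          have "n K \<le> N" using gtK[OF k(1)] N by simp
          moreover have "n j \<le> N \<longleftrightarrow> j < k" if "K < j" for j
            using less[of j k] that K k1 N by auto
          moreover have "1 \<le> n j" if "K < j" for j using that K n1 by auto
          ultimately show ?thesis by (auto simp: Fk_def)
        qed
        have disj: "{1..n K} \<inter> n ` {K<..<k} = {}" using gtK by force
        have "(\<Prod>i\<in>Fk \<inter> {1..N}. real (card (A i)) * (c i / 2) powr (- 2 * r))
            = (\<Prod>i\<in>{1..n K}. real (card (A i)) * (c i / 2) powr (- 2 * r)) *
              (\<Prod>j\<in>{K<..<k}. real (card (A (n j))) * (c (n j) / 2) powr (- 2 * r))"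
          unfolding FN by (subst prod.union_disjoint[OF _ _ disj])
            (auto intro!: prod.reindex_cong[where l = n] inj_on_subset[OF inj] simp: K)
        also have "(\<Prod>i\<in>{1..n K}. real (card (A i)) * (c i / 2) powr (- 2 * r)) = exp (real (n K) * (2 * r * ln 2))"
        proof -
          have "(\<Prod>i\<in>{1..n K}. real (card (A i)) * (c i / 2) powr (- 2 * r)) = (\<Prod>i\<in>{1..n K}. exp (2 * r * ln 2))"
            by (intro prod.cong) (auto simp: A_def c_def powr_def ln_div)
          then show ?thesis by (simp add: exp_of_nat_mult)
        qed
        also have "(\<Prod>j\<in>{K<..<k}. real (card (A (n j))) * (c (n j) / 2) powr (- 2 * r)) \<le> (\<Prod>j\<in>{K<..<k}. exp (g j))"
        proof (intro prod_mono conjI)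
          fix j assume j: "j \<in> {K<..<k}"
          then have pos: "0 < s j" "0 < t j" using K spos tpos by auto
          have "c (n j) = s j" using j gtK[of j] idx[of j] K by (simp add: c_def)
          then have "real (card (A (n j))) * (c (n j) / 2) powr (- 2 * r) \<le> (t j + 1) * (s j / 2) powr (- 2 * r)"
            using j pos A_forced[of j] card_nat_interval_le[of "s j" "t j"] by (intro mult_mono) auto
          also have "\<dots> = exp (g j)"
          proof -
            have "g j = ln (t j + 1) + (- 2 * r) * ln (s j / 2)" by (simp add: g_def)
            then show ?thesis using pos by (simp only: exp_add) (simp add: powr_def)
          qed
          finally show "real (card (A (n j))) * (c (n j) / 2) powr (- 2 * r) \<le> exp (g j)" .
        qed auto
        also have "(\<Prod>j\<in>{K<..<k}. exp (g j)) = exp (sum g {K<..<k})" by (simp add: exp_sum)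
        finally show ?thesis by (simp add: exp_add mult_left_mono)
      qed
      \<comment> \<open>Between \<open>n K\<close> and \<open>n k\<close> there are
        \<open>n k - n K - 1\<close> positions, of which \<open>k - K - 1\<close> are prescribed;
        the two 1s cancel.\<close>
      also have "zsum D r (card ({1..N} - Fk)) \<le> ennreal (C * exp (\<kappa> * (real (n k) - real k - (real (n K) - real K))))"
      proof -
        have "{1..N} - Fk = {n K<..<n k} - n ` {K<..<k}"
        proof -
          have "n ` {K<..} \<inter> {n K<..<n k} \<subseteq> n ` {K<..<k}"
          proof
            fix i assume "i \<in> n ` {K<..} \<inter> {n K<..<n k}"
            then obtain j where j: "K < j" "i = n j" "n j < n k" by auto
            then have "j < k" using less[of j k] K k1 by auto
            then show "i \<in> n ` {K<..<k}" using j by auto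
          qed
          moreover have "n ` {K<..<k} \<subseteq> n ` {K<..}" by auto
          moreover have "{1..N} - {1..n K} = {n K<..<n k}" using N by auto
          then have "{1..N} - Fk = {n K<..<n k} - n ` {K<..}" unfolding Fk_def by blast
          ultimately show ?thesis by blast
        qed
        moreover have "n ` {K<..<k} \<subseteq> {n K<..<n k}"
          using gtK less K by auto
        moreover have "card (n ` {K<..<k}) = card {K<..<k}"
          using K by (intro card_image inj_on_subset[OF inj]) auto
        ultimately have "card ({1..N} - Fk) + card {K<..<k} = card {n K<..<n k}"
          using card_Diff_subset[of "n ` {K<..<k}" "{n K<..<n k}"] card_mono[of "{n K<..<n k}" "n ` {K<..<k}"]
          by (auto intro: finite_subset)
        then have "real (card ({1..N} - Fk)) = real (n k) - real k - (real (n K) - real K)"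
          using gtK[OF k(1)] k(1) by simp
        then show ?thesis using C(2)[of "card ({1..N} - Fk)"] by simp
      qed
      finally have "hausdorff_premeasure r \<delta> (S (K, u)) \<le> ennreal (s k powr (- r)) *
          (ennreal (exp (real (n K) * (2 * r * ln 2) + sum g {K<..<k})) *
           ennreal (C * exp (\<kappa> * (real (n k) - real k - (real (n K) - real K)))))"
        by (simp add: mult_left_mono mult_right_mono ennreal_leI)
      also have "\<dots> = ennreal (C * (s k powr (- r) * exp (real (n K) * (2 * r * ln 2) + sum g {K<..<k}) *
          exp (\<kappa> * (real (n k) - real k - (real (n K) - real K)))))"
        using C(1) by (simp add: ennreal_mult'[symmetric] mult_ac)
      also have "s k powr (- r) * exp (real (n K) * (2 * r * ln 2) + sum g {K<..<k}) *
          exp (\<kappa> * (real (n k) - real k - (real (n K) - real K)))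
        = exp (\<Phi> k + real (n K) * (2 * r * ln 2) - sum g {1..K} - \<kappa> * (real (n K) - real K))"
      proof -
        have un: "{1..<k} = {1..K} \<union> {K<..<k}" using k(1) K by auto
        have "sum g {1..<k} = sum g {1..K} + sum g {K<..<k}"
          unfolding un by (rule sum.union_disjoint) auto
        then have "- r * ln (s k) + (real (n K) * (2 * r * ln 2) + sum g {K<..<k}) +
            \<kappa> * (real (n k) - real k - (real (n K) - real K))
          = \<Phi> k + real (n K) * (2 * r * ln 2) - sum g {1..K} - \<kappa> * (real (n K) - real K)"
          by (simp add: \<Phi>_def algebra_simps)
        moreover have "s k powr (- r) = exp (- r * ln (s k))" using k1(2) by (simp add: powr_def)
        ultimately show ?thesis by (simp only: exp_add[symmetric])
      qed
      finally show ?thesis .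
    qed
    show ?thesis
    proof (rule hausdorff_measure_0I, rule ennreal_le_exp_imp_0[OF _ C(1)])
      fix \<delta> B :: real assume \<delta>: "0 < \<delta>"
      let ?c = "real (n K) * (2 * r * ln 2) - sum g {1..K} - \<kappa> * (real (n K) - real K)"
      have "\<exists>\<^sub>F k in sequentially. \<Phi> k \<le> B - ?c" by (rule small')
      moreover have "\<forall>\<^sub>F k in sequentially. K < k \<and> 1 / \<delta> \<le> s k"
        using s by (intro eventually_conj eventually_gt_at_top) (auto simp: filterlim_at_top)
      ultimately have "\<exists>\<^sub>F k in sequentially. \<Phi> k \<le> B - ?c \<and> (K < k \<and> 1 / \<delta> \<le> s k)"
        by (rule frequently_eventually_frequently)
      then obtain k where k: "\<Phi> k \<le> B - ?c" "K < k" "1 / \<delta> \<le> s k"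
        using frequently_ex by (metis (mono_tags, lifting))
      have "1 / s k \<le> \<delta>" using k(3) \<delta> spos[of k] k(2) by (simp add: field_simps)
      from bound[OF k(2) this] show "\<exists>y\<le>B. hausdorff_premeasure r \<delta> (S (K, u)) \<le> ennreal (C * exp y)"
        using k(1) by (intro exI[of _ "\<Phi> k + ?c"]) (simp add: algebra_simps)
    qed
  qed
  have "?E \<subseteq> (\<Union>p\<in>{1..} \<times> UNIV. S p)"
  proof
    fix x assume x: "x \<in> ?E"
    then obtain K where K: "\<forall>k\<ge>K. s k < real (digits x (n k)) \<and> real (digits x (n k)) \<le> s k + t k"
      unfolding eventually_sequentially by blast
    have "x \<in> S (max K 1, prefix (digits x) (n (max K 1)))"
      unfolding S_def using x K by auto
    then show "x \<in> (\<Union>p\<in>{1..} \<times> UNIV. S p)" by (intro UN_I) auto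
  qed
  then have "hausdorff_measure r ?E \<le> hausdorff_measure r (\<Union>p\<in>{1..} \<times> UNIV. S p)"
    by (rule hausdorff_measure_subset)
  also have "\<dots> = 0"
    using null by (intro hausdorff_measure_null_UN countableI_type) auto
  finally show ?thesis by simp
qed

section \<open>Points with infinitely many doubly exponentially large digits\<close>

lemma filterlim_power_at_top:
  assumes "1 < (x::real)" shows "filterlim (\<lambda>m. x ^ m) at_top sequentially"
  using assms filterlim_realpow_sequentially_gt1[of x]
  by (intro filterlim_at_infinity_imp_filterlim_at_top) auto

lemma superexponential_growth_step:
  fixes g :: "nat \<Rightarrow> real"
  assumes "1 < b1" "b1 < b" and freq: "\<exists>\<^sub>F m in sequentially. b ^ m \<le> g m"
  shows "\<exists>k\<ge>N. b1 * g k \<le> g (Suc k) \<and> b1 ^ Suc k \<le> g (Suc k)"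
proof -
  \<comment> \<open>The threshold dominates all ratios \<open>g i / b1 ^ i\<close> up to
    \<open>N\<close>, so the predecessor of the first later index exceeding it has ratio at most
    \<open>X\<close>, even if that predecessor is \<open>N\<close> itself. Inserting 1 adds the
    absolute growth \<open>b1 ^ Suc k \<le> g (Suc k)\<close>.\<close>
  define X where "X = Max (insert 1 ((\<lambda>i. g i / b1 ^ i) ` {..N}))"
  have X: "1 \<le> X" "\<And>i. i \<le> N \<Longrightarrow> g i / b1 ^ i \<le> X" unfolding X_def by (rule Max_ge; simp)+
  have "filterlim (\<lambda>m. (b / b1) ^ m) at_top sequentially"
    using assms by (intro filterlim_power_at_top) simp
  then have "\<forall>\<^sub>F m in sequentially. X < (b / b1) ^ m \<and> N < m"
    by (intro eventually_conj eventually_gt_at_top) (simp add: filterlim_at_top_dense)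
  with freq have "\<exists>\<^sub>F m in sequentially. b ^ m \<le> g m \<and> (X < (b / b1) ^ m \<and> N < m)"
    by (rule frequently_eventually_frequently)
  then obtain m where m: "b ^ m \<le> g m" "X < (b / b1) ^ m" "N < m"
    using frequently_ex by (metis (mono_tags, lifting))
  have "(b / b1) ^ m \<le> g m / b1 ^ m"
    using m(1) assms by (simp add: power_divide divide_right_mono)
  then have ex: "N < m \<and> X < g m / b1 ^ m" using m by simp
  define l where "l = (LEAST m. N < m \<and> X < g m / b1 ^ m)"
  have l: "N < l" "X < g l / b1 ^ l" using LeastI[of "\<lambda>m. N < m \<and> X < g m / b1 ^ m", OF ex] by (auto simp: l_def)
  obtain k where k: "l = Suc k" using l(1) by (cases l) auto
  have "g k / b1 ^ k \<le> X"
  proof (cases "k \<le> N")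
    case False
    then have "\<not> (N < k \<and> X < g k / b1 ^ k)"
      using not_less_Least[of k "\<lambda>m. N < m \<and> X < g m / b1 ^ m"] k by (auto simp: l_def)
    then show ?thesis using False by simp
  qed (rule X(2))
  then have "g k / b1 ^ k \<le> g (Suc k) / b1 ^ Suc k" using l(2) k by simp
  then have "g k \<le> g (Suc k) / b1 ^ Suc k * b1 ^ k" using assms by (simp add: pos_divide_le_eq)
  then have 1: "b1 * g k \<le> g (Suc k)" using assms by (simp add: field_simps)
  have "1 < g (Suc k) / b1 ^ Suc k" using l(2) X(1) k by simp
  then have "b1 ^ Suc k \<le> g (Suc k)" using assms by (simp add: pos_less_divide_eq)
  with 1 show ?thesis using l(1) k by (intro exI[of _ k]) auto
qed

text \<open>Records of \<open>ln q\<^sub>m / b1\<^sup>m\<close> give infinitely many \<open>m\<close> at which \<open>ln q\<^sub>m\<^sub>+\<^sub>1\<close> exceeds both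
  \<open>b1 ln q\<^sub>m\<close> and \<open>b1\<^sup>m\<^sup>+\<^sup>1\<close>. The interpolation parameter \<open>\<eta>\<close> leaves a convergent sum of powers
  \<open>q\<^sub>m\<^sup>-\<^sup>2\<^sup>\<theta>\<close> with \<open>\<theta> > 1/2\<close>, times a doubly exponentially small factor.\<close>

lemma hausdorff_null_doubly_exponential:
  fixes b r :: real
  assumes b: "1 < b" and r: "0 < r" "1 < r * (b + 1)"
  shows "hausdorff_measure r {x \<in> irr_unit. \<exists>\<^sub>F m in sequentially. exp (b ^ m) \<le> real (digits x m)} = 0"
    (is "hausdorff_measure r ?E = 0")
proof -
  \<comment> \<open>Room is created twice: \<open>b1\<close> below \<open>b\<close> still satisfies
    1 < r (1 + b1), and a small \<eta> still satisfies 1 < r (1 + b1 (1 - \<eta>)), which says that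
    the \<open>\<theta>\<close> below exceeds 1/2.\<close>
  have "max 1 (1 / r - 1) < b" using r b by (simp add: field_simps)
  then obtain b1 where b1: "max 1 (1 / r - 1) < b1" "b1 < b" using dense by blast
  then have b1': "1 < b1" "1 < r * (1 + b1)" using r by (auto simp: field_simps)
  have "((\<lambda>\<eta>. r * (1 + b1 * (1 - \<eta>))) \<longlongrightarrow> r * (1 + b1 * (1 - 0))) (at_right 0)"
    by (intro tendsto_intros)
  then have "\<forall>\<^sub>F \<eta> in at_right 0. 1 < r * (1 + b1 * (1 - \<eta>))"
    using b1'(2) by (intro order_tendstoD) auto
  moreover have "\<forall>\<^sub>F \<eta> in at_right (0::real). \<eta> \<in> {0<..<1}"
    by (rule eventually_at_right_real) simp
  ultimately have "\<forall>\<^sub>F \<eta> in at_right 0. 1 < r * (1 + b1 * (1 - \<eta>)) \<and> \<eta> \<in> {0<..<1}"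
    by (rule eventually_conj)
  then obtain \<eta> where \<eta>: "1 < r * (1 + b1 * (1 - \<eta>))" "0 < \<eta>" "\<eta> < 1"
    using eventually_happens[of _ "at_right (0::real)"] by auto
  define \<theta> where "\<theta> = r * (1 + b1 * (1 - \<eta>)) / 2"
  have \<theta>: "1 / 2 < \<theta>" using \<eta> by (simp add: \<theta>_def)
  define q where "q x m = cf_den (prefix (digits x) m) 0" for x m
  \<comment> \<open>A convex combination of the two lower bounds for ln q_(m+1). Its first part
    turns the r-th power of a diameter into q^(-2\<theta>), its second part supplies the decay in
    the length alone.\<close>
  define lw where "lw w = b1 * (1 - \<eta>) * ln (cf_den w 0) + \<eta> * b1 ^ Suc (length w)" for w
  define S where "S m = {x \<in> irr_unit. lw (prefix (digits x) m) \<le> ln (q x (Suc m))}" for m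
  define G where "G m = 2 powr r * 4 powr \<theta> * exp (pressure \<theta> * real m - r * \<eta> * b1 ^ Suc m)" for m
  have pos: "pos_word (prefix (digits x) m)" if "x \<in> irr_unit" for x m
    using that by (intro pos_word_prefix digits_pos_seq)
  have cover: "hausdorff_premeasure r \<delta> (S m) \<le> ennreal (G m)" if \<delta>: "2 * exp (- (\<eta> * b1 ^ Suc m)) \<le> \<delta>" for m \<delta>
  proof -
    let ?W = "words (\<lambda>_. {1..}) m"
    have p: "pos_word w" if "w \<in> ?W" for w using words_pos[OF that] by auto
    define d where "d w = 2 * exp (- (ln (cf_den w 0) + lw w))" for w
    have "hausdorff_premeasure r \<delta> (S m) \<le> (\<integral>\<^sup>+w. ennreal (d w powr r) \<partial>count_space ?W)"
    proof (rule hausdorff_premeasure_le_nn_integral)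
      \<comment> \<open>Since q_(m+1) is at most 2 q_m a, a lower bound exp (lw w) for q_(m+1)
        bounds 1/a, and hence the tail, by this radius.\<close>
      show "S m \<subseteq> (\<Union>w\<in>?W. cf_val w ` {0..2 * cf_den w 0 * exp (- lw w)})"
      proof
        fix x assume "x \<in> S m"
        then have x: "x \<in> irr_unit" "lw (prefix (digits x) m) \<le> ln (q x (Suc m))" by (auto simp: S_def)
        define w where "w = prefix (digits x) m"
        define a where "a = digits x (Suc m)"
        have w: "pos_word w" using x pos by (simp add: w_def)
        have a: "1 \<le> a" using digits_pos_seq[OF x(1)] by (simp add: a_def pos_seq_def)
        have wW: "w \<in> ?W" unfolding w_def using digits_pos_seq[OF x(1)] by (intro prefix_in_words) (auto simp: pos_seq_def)
        obtain z where z: "0 < z" "x = cf_val w (1 / (real a + z))"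
          using irr_unit_cf_val[OF x(1), of m] unfolding w_def a_def by metis
        have qS: "0 < q x (Suc m)" using cf_den_pos[OF pos[OF x(1)]] by (simp add: q_def)
        have "q x (Suc m) = cf_den w (1 / real a) * real a"
          by (simp add: q_def prefix_Suc cf_den_append w_def a_def)
        also have "\<dots> \<le> 2 * cf_den w 0 * real a"
          using w a by (intro mult_right_mono cf_den_le_double) auto
        finally have q: "q x (Suc m) \<le> 2 * cf_den w 0 * real a" .
        have "exp (lw w) \<le> q x (Suc m)" using x(2) qS by (simp add: w_def ln_ge_iff)
        then have e: "exp (lw w) \<le> 2 * cf_den w 0 * real a" using q by linarith
        have "1 / (real a + z) \<le> 1 / real a" using a z by (intro divide_left_mono) auto
        also have "\<dots> \<le> 2 * cf_den w 0 * exp (- lw w)"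
          using e a by (simp add: exp_minus field_simps)
        finally have "1 / (real a + z) \<in> {0..2 * cf_den w 0 * exp (- lw w)}" using z by simp
        then have "x \<in> cf_val w ` {0..2 * cf_den w 0 * exp (- lw w)}" using z(2) by (metis imageI)
        then show "x \<in> (\<Union>w\<in>?W. cf_val w ` {0..2 * cf_den w 0 * exp (- lw w)})" using wW by blast
      qed
      fix w assume w: "w \<in> ?W"
      then have q: "1 \<le> cf_den w 0" "length w = m" using p cf_den_ge_1 by (auto simp: words_def)
      then have e: "0 \<le> 2 * cf_den w 0 * exp (- lw w)" by simp
      show "bounded (cf_val w ` {0..2 * cf_den w 0 * exp (- lw w)})"
        using p[OF w] e by (rule bounded_cf_val_image)
      have "2 * cf_den w 0 * exp (- lw w) / (cf_den w 0)\<^sup>2 = d w"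
      proof -
        have "exp (- (ln (cf_den w 0) + lw w)) = exp (- lw w) / cf_den w 0"
          using q by (subst exp_minus, subst exp_add) (simp add: exp_minus field_simps)
        then show ?thesis using q by (simp add: d_def power2_eq_square)
      qed
      then show "diameter (cf_val w ` {0..2 * cf_den w 0 * exp (- lw w)}) \<le> d w"
        using diameter_cf_val_image[OF p[OF w] e] by simp
      have "\<eta> * b1 ^ Suc m \<le> ln (cf_den w 0) + lw w"
        using q b1' \<eta> by (simp add: lw_def)
      then have "d w \<le> 2 * exp (- (\<eta> * b1 ^ Suc m))" by (simp add: d_def)
      then show "d w \<le> \<delta>" using \<delta> by linarith
    next
      show "0 \<le> \<delta>" using \<delta> by (rule order_trans[rotated]) simp
    qed (rule r)
    also have "\<dots> = (\<integral>\<^sup>+w. ennreal (2 powr r * exp (- r * \<eta> * b1 ^ Suc m)) * ennreal (cf_den w 0 powr (- 2 * \<theta>)) \<partial>count_space ?W)"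
    proof (intro nn_integral_cong)
      fix w assume "w \<in> space (count_space ?W)"
      then have w: "length w = m" "0 < cf_den w 0" using p cf_den_pos by (auto simp: words_def)
      have "d w powr r = 2 powr r * exp (- (ln (cf_den w 0) + lw w) * r)"
        unfolding d_def powr_mult by (simp add: powr_def)
      also have "- (ln (cf_den w 0) + lw w) * r = - r * \<eta> * b1 ^ Suc m + (- 2 * \<theta>) * ln (cf_den w 0)"
        by (simp add: lw_def w \<theta>_def algebra_simps)
      finally have "d w powr r = (2 powr r * exp (- r * \<eta> * b1 ^ Suc m)) * cf_den w 0 powr (- 2 * \<theta>)"
        using w(2) by (simp add: powr_def[of "cf_den w 0"] exp_add[symmetric])
      then show "ennreal (d w powr r) = ennreal (2 powr r * exp (- r * \<eta> * b1 ^ Suc m)) * ennreal (cf_den w 0 powr (- 2 * \<theta>))"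
        by (simp only:) (rule ennreal_mult', simp)
    qed
    also have "\<dots> = ennreal (2 powr r * exp (- r * \<eta> * b1 ^ Suc m)) * zsum {1..} \<theta> m"
      unfolding zsum_def by (rule nn_integral_cmult) simp
    also have "\<dots> \<le> ennreal (2 powr r * exp (- r * \<eta> * b1 ^ Suc m)) * ennreal (4 powr \<theta> * exp (pressure \<theta> * real m))"
      by (intro mult_left_mono zsum_le_pressure \<theta>) simp
    also have "\<dots> = ennreal (G m)"
      by (subst ennreal_mult[symmetric]) (simp_all add: G_def exp_diff exp_minus field_simps)
    finally show ?thesis .
  qed
  have b1m: "(\<lambda>m. real m / b1 ^ m) \<longlonglongrightarrow> 0"
    using b1'(1) powser_times_n_limit_0[of "1 / b1"] by (simp add: power_one_over)
  \<comment> \<open>\<open>\<eta> * b1 ^ Suc m\<close> outgrows every multiple of \<open>m\<close>,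
    so it absorbs the pressure term and still leaves a geometric series.\<close>
  have Gle: "\<forall>\<^sub>F m in sequentially. G m \<le> 2 powr r * 4 powr \<theta> * exp (-1) ^ m"
  proof -
    have "(\<lambda>m. (pressure \<theta> + 1) * (real m / b1 ^ m)) \<longlonglongrightarrow> (pressure \<theta> + 1) * 0"
      by (intro tendsto_intros b1m)
    moreover have "0 < r * \<eta> * b1" using r \<eta> b1' by simp
    ultimately have "\<forall>\<^sub>F m in sequentially. (pressure \<theta> + 1) * (real m / b1 ^ m) < r * \<eta> * b1"
      by (intro order_tendstoD) auto
    then show ?thesis
    proof eventually_elim
      case (elim m)
      then have "(pressure \<theta> + 1) * real m < r * \<eta> * b1 * b1 ^ m"
        using b1' by (simp add: pos_divide_less_eq)
      then have "pressure \<theta> * real m - r * \<eta> * b1 ^ Suc m \<le> real m * (-1)"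
        by (simp add: algebra_simps)
      then have "exp (pressure \<theta> * real m - r * \<eta> * b1 ^ Suc m) \<le> exp (-1) ^ m"
        by (simp only: exp_of_nat_mult[symmetric] exp_le_cancel_iff)
      then show ?case unfolding G_def by (intro mult_left_mono) auto
    qed
  qed
  have sub: "?E \<subseteq> (\<Union>i. S (N + i))" for N
  proof
    fix x assume x: "x \<in> ?E"
    define g where "g m = ln (q x m)" for m
    have q1: "1 \<le> q x m" for m unfolding q_def using x pos by (intro cf_den_ge_1) auto
    have "\<exists>\<^sub>F m in sequentially. exp (b ^ m) \<le> real (digits x m) \<and> 1 \<le> m"
      using x by (intro frequently_eventually_frequently eventually_ge_at_top) auto
    then have "\<exists>\<^sub>F m in sequentially. b ^ m \<le> g m"
    proof (rule frequently_elim1)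
      fix m assume m: "exp (b ^ m) \<le> real (digits x m) \<and> 1 \<le> m"
      then obtain k where k: "m = Suc k" by (cases m) auto
      have "real (digits x m) \<le> q x m"
        unfolding q_def k prefix_Suc using x pos digits_pos_seq[of x]
        by (intro cf_den_ge_last) (auto simp: pos_seq_def)
      then have "exp (b ^ m) \<le> q x m" using m by linarith
      then show "b ^ m \<le> g m" using q1[of m] by (simp add: g_def ln_ge_iff)
    qed
    from superexponential_growth_step[OF b1'(1) b1(2) this, of N]
    obtain k where k: "N \<le> k" "b1 * g k \<le> g (Suc k)" "b1 ^ Suc k \<le> g (Suc k)" by blast
    have "lw (prefix (digits x) k) = (1 - \<eta>) * (b1 * g k) + \<eta> * b1 ^ Suc k"
      by (simp add: lw_def g_def q_def algebra_simps)
    also have "\<dots> \<le> (1 - \<eta>) * g (Suc k) + \<eta> * g (Suc k)"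
      using k \<eta> by (intro add_mono mult_left_mono) auto
    also have "\<dots> = g (Suc k)" by (simp add: algebra_simps)
    finally have "x \<in> S (N + (k - N))" using x k(1) by (auto simp: S_def g_def)
    then show "x \<in> (\<Union>i. S (N + i))" by blast
  qed
  show ?thesis
  proof (rule hausdorff_measure_0I)
    fix \<delta> :: real assume \<delta>: "0 < \<delta>"
    let ?C = "2 powr r * 4 powr \<theta> / (1 - exp (-1))"
    have "(\<lambda>m. 2 * exp (- (\<eta> * b1 ^ Suc m))) \<longlonglongrightarrow> 2 * 0"
    proof (intro tendsto_mult tendsto_const)
      have "filterlim (\<lambda>m. \<eta> * b1 ^ Suc m) at_top sequentially"
        using b1' \<eta> filterlim_compose[OF filterlim_power_at_top[of b1] filterlim_Suc]
        by (intro filterlim_tendsto_pos_mult_at_top[OF tendsto_const]) auto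
      then show "(\<lambda>m. exp (- (\<eta> * b1 ^ Suc m))) \<longlonglongrightarrow> 0"
        by (intro filterlim_compose[OF exp_at_bot]) (simp add: filterlim_uminus_at_top)
    qed
    then have "\<forall>\<^sub>F m in sequentially. 2 * exp (- (\<eta> * b1 ^ Suc m)) < \<delta>"
      using \<delta> by (intro order_tendstoD(2)) auto
    with Gle have "\<forall>\<^sub>F m in sequentially. G m \<le> 2 powr r * 4 powr \<theta> * exp (-1) ^ m \<and> 2 * exp (- (\<eta> * b1 ^ Suc m)) < \<delta>"
      by (rule eventually_conj)
    then obtain N0 where N0: "\<And>m. N0 \<le> m \<Longrightarrow> G m \<le> 2 powr r * 4 powr \<theta> * exp (-1) ^ m"
      "\<And>m. N0 \<le> m \<Longrightarrow> 2 * exp (- (\<eta> * b1 ^ Suc m)) \<le> \<delta>"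
      unfolding eventually_sequentially by (auto intro: less_imp_le)
    have bound: "hausdorff_premeasure r \<delta> ?E \<le> ennreal (?C * exp (- real N))" if N: "N0 \<le> N" for N
    proof -
      have "hausdorff_premeasure r \<delta> ?E \<le> hausdorff_premeasure r \<delta> (\<Union>i. S (N + i))"
        by (rule hausdorff_premeasure_subset[OF sub])
      also have "\<dots> \<le> (\<Sum>i. hausdorff_premeasure r \<delta> (S (N + i)))"
        by (rule hausdorff_premeasure_UN_le)
      also have "\<dots> \<le> (\<Sum>i. ennreal (2 powr r * 4 powr \<theta> * exp (- real N) * exp (-1) ^ i))"
      proof (intro suminf_le allI)
        fix i
        have "G (N + i) \<le> 2 powr r * 4 powr \<theta> * exp (-1) ^ (N + i)" using N by (intro N0) simp
        also have "exp (-1 :: real) ^ (N + i) = exp (- real N) * exp (-1) ^ i"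
          by (simp add: power_add exp_of_nat_mult[symmetric])
        finally have "ennreal (G (N + i)) \<le> ennreal (2 powr r * 4 powr \<theta> * exp (- real N) * exp (-1) ^ i)"
          by (intro ennreal_leI) (simp add: mult_ac)
        moreover have "hausdorff_premeasure r \<delta> (S (N + i)) \<le> ennreal (G (N + i))"
          using N by (intro cover N0) simp
        ultimately show "hausdorff_premeasure r \<delta> (S (N + i)) \<le> ennreal (2 powr r * 4 powr \<theta> * exp (- real N) * exp (-1) ^ i)"
          by (rule order_trans[rotated])
      qed auto
      also have "\<dots> = ennreal (2 powr r * 4 powr \<theta> * exp (- real N) * (1 / (1 - exp (-1))))"
        by (intro suminf_ennreal_eq sums_mult geometric_sums) auto
      also have "2 powr r * 4 powr \<theta> * exp (- real N) * (1 / (1 - exp (-1))) = ?C * exp (- real N)"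
        by simp
      finally show ?thesis .
    qed
    show "hausdorff_premeasure r \<delta> ?E = 0"
    proof (rule ennreal_le_exp_imp_0)
      fix B :: real
      have "- real (max N0 (nat \<lceil>- B\<rceil>)) \<le> B" by linarith
      then show "\<exists>y\<le>B. hausdorff_premeasure r \<delta> ?E \<le> ennreal (?C * exp y)"
        using bound[of "max N0 (nat \<lceil>- B\<rceil>)"] by (intro exI[of _ "- real (max N0 (nat \<lceil>- B\<rceil>))"]) auto
    qed simp
  qed
qed

section \<open>Mass distributions on product sets\<close>

text \<open>The mass distribution principle pulled back to the sample space: a measurable
  \<open>B\<close> catches the sample points over \<open>U\<close>, whatever \<open>U\<close> and
  \<open>\<phi>\<close> are. A cover with a small r-sum for some r < \<theta> would then carry mass
  less than 1.\<close>

lemma hausdorff_dim_geI: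
  fixes M :: "'w measure" and \<phi> :: "'w \<Rightarrow> 'a::metric_space" and \<theta> C :: real
  assumes M: "prob_space M" and supp: "AE \<omega> in M. \<omega> \<in> \<Omega>" and E: "\<phi> ` \<Omega> \<subseteq> E"
    and \<theta>: "0 < \<theta>" and C: "0 < C"
    and ball: "\<And>U \<rho>. 0 < \<rho> \<Longrightarrow> (\<And>x y. x \<in> U \<Longrightarrow> y \<in> U \<Longrightarrow> dist x y \<le> \<rho>) \<Longrightarrow>
      \<exists>B\<in>sets M. (\<forall>\<omega>\<in>\<Omega>. \<phi> \<omega> \<in> U \<longrightarrow> \<omega> \<in> B) \<and> emeasure M B \<le> ennreal (C * \<rho> powr \<theta>)"
  shows "ereal \<theta> \<le> hausdorff_dim E"
  unfolding hausdorff_dim_def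
proof (rule INF_greatest)
  fix r assume "r \<in> {r. 0 < r \<and> hausdorff_measure r E = 0}"
  then have r: "0 < r" "hausdorff_measure r E = 0" by auto
  show "ereal \<theta> \<le> ereal r"
  proof (rule ccontr)
    assume "\<not> ?thesis"
    then have "r < \<theta>" by simp
    \<comment> \<open>The covering sets and their enlargements below contribute mass at most C e =
      1/4 each, so the total stays at 1/2.\<close>
    define e where "e = 1 / (4 * C)"
    have e: "0 < e" using C by (simp add: e_def)
    have "hausdorff_premeasure r 1 E \<le> hausdorff_measure r E"
      unfolding hausdorff_measure_def by (rule SUP_upper) simp
    then have "hausdorff_premeasure r 1 E < ennreal e" using r e by simp
    then obtain U :: "nat \<Rightarrow> 'a set" where U: "E \<subseteq> (\<Union>i. U i)" "\<And>i. bounded (U i)" "\<And>i. diameter (U i) \<le> 1"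
      and sum: "(\<Sum>i. ennreal (diameter (U i) powr r)) < ennreal e"
      unfolding hausdorff_premeasure_def INF_less_iff by auto
    \<comment> \<open>A covering set of diameter 0 has no scale, and the ball condition needs a
      positive one. Radii are therefore at least \<open>h i\<close>, where the \<theta>-th powers of
      the \<open>h i\<close> add up to \<open>e\<close>.\<close>
    define h where "h i = (e * (1/2) ^ Suc i) powr (1 / \<theta>)" for i
    define \<rho> where "\<rho> i = max (diameter (U i)) (h i)" for i
    have h: "0 < h i" "h i powr \<theta> = e * (1/2) ^ Suc i" for i
      using e \<theta> by (auto simp: h_def powr_powr)
    have \<rho>: "0 < \<rho> i" for i using h(1)[of i] by (simp add: \<rho>_def)
    have "\<exists>B\<in>sets M. (\<forall>\<omega>\<in>\<Omega>. \<phi> \<omega> \<in> U i \<longrightarrow> \<omega> \<in> B) \<and> emeasure M B \<le> ennreal (C * \<rho> i powr \<theta>)" for i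
    proof (rule ball[OF \<rho>])
      fix x y assume "x \<in> U i" "y \<in> U i"
      then have "dist x y \<le> diameter (U i)" by (rule diameter_bounded_bound[OF U(2)])
      then show "dist x y \<le> \<rho> i" by (simp add: \<rho>_def)
    qed
    then obtain B where B: "\<And>i. B i \<in> sets M" "\<And>i \<omega>. \<omega> \<in> \<Omega> \<Longrightarrow> \<phi> \<omega> \<in> U i \<Longrightarrow> \<omega> \<in> B i"
      "\<And>i. emeasure M (B i) \<le> ennreal (C * \<rho> i powr \<theta>)" by metis
    have le: "C * \<rho> i powr \<theta> \<le> C * (diameter (U i) powr r) + C * (e * (1/2) ^ Suc i)" for i
    proof -
      have d: "0 \<le> diameter (U i)" by (rule diameter_ge_0[OF U(2)])
      have "diameter (U i) powr \<theta> \<le> diameter (U i) powr r"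
      proof (cases "diameter (U i) = 0")
        case False
        then show ?thesis using d U(3)[of i] \<open>r < \<theta>\<close> by (intro powr_mono') auto
      qed simp
      moreover have "0 \<le> e * (1/2) ^ Suc i" using e by simp
      ultimately have "\<rho> i powr \<theta> \<le> diameter (U i) powr r + e * (1/2) ^ Suc i"
        using h(2)[of i] by (simp add: \<rho>_def max_def del: power_Suc)
      then have "C * \<rho> i powr \<theta> \<le> C * (diameter (U i) powr r + e * (1/2) ^ Suc i)"
        using C by (intro mult_left_mono) auto
      then show ?thesis by (simp add: distrib_left)
    qed
    have "AE \<omega> in M. \<omega> \<in> (\<Union>i. B i)"
      using supp
    proof eventually_elim
      case (elim \<omega>)
      then have "\<phi> \<omega> \<in> (\<Union>i. U i)" using E U(1) by blast
      then show ?case using B(2) elim by blast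
    qed
    then have "emeasure M (\<Union>i. B i) = 1"
      using B(1) by (intro prob_space.emeasure_eq_1_AE[OF M]) auto
    then have "1 \<le> (\<Sum>i. emeasure M (B i))"
      using emeasure_subadditive_countably[of B M] B(1) by auto
    also have "\<dots> \<le> (\<Sum>i. ennreal C * ennreal (diameter (U i) powr r) + ennreal (C * (e * (1/2) ^ Suc i)))"
    proof (intro suminf_le)
      fix i
      have "emeasure M (B i) \<le> ennreal (C * (diameter (U i) powr r) + C * (e * (1/2) ^ Suc i))"
        using B(3)[of i] ennreal_leI[OF le[of i]] by (rule order_trans)
      also have "\<dots> = ennreal C * ennreal (diameter (U i) powr r) + ennreal (C * (e * (1/2) ^ Suc i))"
        using C e by (simp add: ennreal_mult' del: power_Suc)
      finally show "emeasure M (B i) \<le> ennreal C * ennreal (diameter (U i) powr r) + ennreal (C * (e * (1/2) ^ Suc i))" .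
    qed auto
    also have "\<dots> = (\<Sum>i. ennreal C * ennreal (diameter (U i) powr r)) + (\<Sum>i. ennreal (C * (e * (1/2) ^ Suc i)))"
      by (intro suminf_add[symmetric]) auto
    also have "(\<Sum>i. ennreal (C * (e * (1/2) ^ Suc i))) = ennreal (C * (e * 1))"
      using C e by (intro suminf_ennreal_eq sums_mult power_half_series) auto
    also have "(\<Sum>i. ennreal C * ennreal (diameter (U i) powr r)) = ennreal C * (\<Sum>i. ennreal (diameter (U i) powr r))"
      by simp
    also have "\<dots> \<le> ennreal C * ennreal e" using sum by (intro mult_left_mono) auto
    finally have "1 \<le> ennreal C * ennreal e + ennreal (C * (e * 1))" by (simp add: add_right_mono)
    also have "\<dots> = ennreal (1 / 2)" using C e by (simp add: ennreal_mult'[symmetric] ennreal_plus[symmetric] e_def del: ennreal_plus)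
    finally have "ennreal 1 \<le> ennreal (1 / 2)" by (simp only: ennreal_1)
    then show False by (subst (asm) ennreal_le_iff) auto
  qed
qed

lemma abs_diff_eq_inverse:
  assumes "0 < x" "0 < (y::real)" shows "\<bar>x - y\<bar> = \<bar>1 / x - 1 / y\<bar> * (x * y)"
proof -
  have "1 / x - 1 / y = (y - x) / (x * y)" using assms by (simp add: field_simps)
  then show ?thesis using assms by (simp add: abs_mult abs_minus_commute)
qed

lemma abs_diff_of_nat_ge:
  assumes "a \<noteq> (b::nat)" shows "1 \<le> \<bar>real a - real b\<bar>"
proof -
  have "Suc a \<le> b \<or> Suc b \<le> a" using assms by auto
  then have "real (Suc a) \<le> real b \<or> real (Suc b) \<le> real a" by (simp only: of_nat_le_iff)
  then show ?thesis by auto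
qed

lemma finite_pmf_exists:
  fixes f :: "'a \<Rightarrow> real"
  assumes "finite S" "S \<noteq> {}" "\<And>w. w \<in> S \<Longrightarrow> 0 < f w"
  shows "\<exists>p. set_pmf p = S \<and> (\<forall>w\<in>S. pmf p w = f w / sum f S)"
proof -
  have Z: "0 < sum f S" using assms by (intro sum_pos) auto
  define g where "g w = (if w \<in> S then f w / sum f S else 0)" for w
  have nonneg: "0 \<le> g w" for w using assms(3) Z by (auto simp: g_def intro: less_imp_le)
  have "(\<integral>\<^sup>+w. ennreal (g w) \<partial>count_space UNIV) = (\<Sum>w\<in>S. ennreal (g w))"
    using assms(1) by (intro nn_integral_count_space') (auto simp: g_def)
  also have "\<dots> = ennreal (\<Sum>w\<in>S. g w)" using nonneg by (intro sum_ennreal) auto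
  also have "(\<Sum>w\<in>S. g w) = 1" using Z by (simp add: g_def sum_divide_distrib[symmetric])
  finally have int: "(\<integral>\<^sup>+w. ennreal (g w) \<partial>count_space UNIV) = 1" by simp
  have "set_pmf (embed_pmf g) = S"
    using assms(3) Z by (subst set_embed_pmf[OF nonneg int]) (force simp: g_def)
  moreover have "\<forall>w\<in>S. pmf (embed_pmf g) w = f w / sum f S"
    by (simp add: pmf_embed_pmf[OF nonneg int]) (simp add: g_def)
  ultimately show ?thesis by blast
qed

text \<open>All letters allowed at a position of \<open>F\<close> are comparable to
  \<open>u j\<close>, which stands in for them in estimates. \<open>2 \<le> u j\<close> turns 2(a +
  1) into at most 5 u j and keeps tails that start with a prescribed digit at most 1/2.\<close>

locale cantor_set =
  fixes F :: "nat set" and A :: "nat \<Rightarrow> nat set" and u :: "nat \<Rightarrow> real" and M l :: nat and \<theta> :: real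
  assumes A_finite: "\<And>j. j \<in> F \<Longrightarrow> finite (A j)" and A_nonempty: "\<And>j. j \<in> F \<Longrightarrow> A j \<noteq> {}"
    and u_ge: "\<And>j. j \<in> F \<Longrightarrow> 2 \<le> u j"
    and A_range: "\<And>j a. j \<in> F \<Longrightarrow> a \<in> A j \<Longrightarrow> u j \<le> real a \<and> real a \<le> 2 * u j"
    and M: "1 \<le> M" and l: "1 \<le> l" and \<theta>: "0 < \<theta>" "\<theta> \<le> 1"
begin

definition "blocks = words (\<lambda>_. {1..M}) l"

definition "Z = (\<Sum>w\<in>blocks. cf_den w 0 powr (- 2 * \<theta>))"

text \<open>The growth rate per free letter that remains after paying for concatenation: each block
  loses a factor 2 in the denominator, that is 2^(2\<theta>) = 4^\<theta>. For long blocks and large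
  \<open>M\<close> it comes close to \<open>pressure \<theta>\<close>.\<close>

definition "\<kappa> = ln (Z / 4 powr \<theta>) / real l"

definition block_pmf :: "nat list pmf" where
  "block_pmf = (SOME p. set_pmf p = blocks \<and> (\<forall>w\<in>blocks. pmf p w = cf_den w 0 powr (- 2 * \<theta>) / Z))"

definition digit_pmf :: "nat \<Rightarrow> nat pmf" where
  "digit_pmf j = (if j \<in> F then pmf_of_set (A j) else return_pmf 0)"

text \<open>Coordinate \<open>j\<close> of a sample point carries both the \<open>j\<close>-th block of free digits and the digit at
  position \<open>j\<close>; the latter is used only if \<open>j \<in> F\<close>.\<close>

definition space_pm :: "(nat \<Rightarrow> nat list \<times> nat) measure" where
  "space_pm = PiM UNIV (\<lambda>j. measure_pmf (pair_pmf block_pmf (digit_pmf j)))"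

definition "nfree n = card ({1..n} - F)"

definition free_digit :: "(nat \<Rightarrow> nat list \<times> nat) \<Rightarrow> nat \<Rightarrow> nat" where
  "free_digit \<omega> i = fst (\<omega> (i div l)) ! (i mod l)"

text \<open>\<open>nfree (j - 1)\<close> is the number of free positions before \<open>j\<close>,
  hence the index, counted from 0, of the free position \<open>j\<close>.\<close>

definition digit :: "(nat \<Rightarrow> nat list \<times> nat) \<Rightarrow> nat \<Rightarrow> nat" where
  "digit \<omega> j = (if j \<in> F then snd (\<omega> j) else free_digit \<omega> (nfree (j - 1)))"

definition \<Omega> :: "(nat \<Rightarrow> nat list \<times> nat) set" where
  "\<Omega> = {\<omega>. \<forall>i. fst (\<omega> i) \<in> blocks \<and> (i \<in> F \<longrightarrow> snd (\<omega> i) \<in> A i)}"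

lemma finite_blocks: "finite blocks" and blocks_nonempty: "blocks \<noteq> {}"
proof -
  show "finite blocks"
    using finite_lists_length_eq[of "{1..M}" l] by (simp add: blocks_def words_const conj_commute)
  have "replicate l 1 \<in> blocks" using M by (auto simp: blocks_def words_const)
  then show "blocks \<noteq> {}" by blast
qed

lemma blocksD:
  assumes "w \<in> blocks"
  shows "length w = l" "pos_word w" "\<And>i. i < l \<Longrightarrow> 1 \<le> w ! i \<and> w ! i \<le> M"
proof -
  show "length w = l" using assms by (simp add: blocks_def words_def)
  show "pos_word w" using assms words_pos[of w "\<lambda>_. {1..M}" l] by (auto simp: blocks_def)
  show "1 \<le> w ! i \<and> w ! i \<le> M" if "i < l" for i
    using assms that by (auto simp: blocks_def words_def)
qed

lemma block_pmf: "set_pmf block_pmf = blocks"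
    "w \<in> blocks \<Longrightarrow> pmf block_pmf w = cf_den w 0 powr (- 2 * \<theta>) / Z"
proof -
  have "0 < cf_den w 0 powr (- 2 * \<theta>)" if "w \<in> blocks" for w
    using cf_den_pos[OF blocksD(2)[OF that], of 0] by simp
  from finite_pmf_exists[OF finite_blocks blocks_nonempty this]
  have "\<exists>p. set_pmf p = blocks \<and> (\<forall>w\<in>blocks. pmf p w = cf_den w 0 powr (- 2 * \<theta>) / Z)"
    by (simp add: Z_def)
  from someI_ex[OF this, folded block_pmf_def]
  show "set_pmf block_pmf = blocks" "w \<in> blocks \<Longrightarrow> pmf block_pmf w = cf_den w 0 powr (- 2 * \<theta>) / Z"
    by auto
qed

lemma Z_pos: "0 < Z"
  unfolding Z_def using cf_den_pos[OF blocksD(2), of _ 0]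
  by (intro sum_pos finite_blocks blocks_nonempty) force

lemma exp_kappa: "exp (- \<kappa> * real (l * i)) = (4 powr \<theta> / Z) ^ i"
proof -
  have "\<kappa> * real l = ln Z - \<theta> * ln 4" using l Z_pos by (simp add: \<kappa>_def ln_div)
  then have "- \<kappa> * real (l * i) = real i * (\<theta> * ln 4 - ln Z)"
    by (simp add: mult.assoc[symmetric])
  also have "\<theta> * ln 4 - ln Z = ln (4 powr \<theta> / Z)" using Z_pos by (simp add: ln_div)
  finally show ?thesis using Z_pos by (simp only: exp_of_nat_mult) (simp add: divide_pos_pos)
qed

lemma digit_pmf: "j \<in> F \<Longrightarrow> set_pmf (digit_pmf j) = A j"
  using A_finite A_nonempty by (simp add: digit_pmf_def)

lemma measure_digit_pmf:
  "j \<in> F \<Longrightarrow> measure (digit_pmf j) X = real (card (A j \<inter> X)) / real (card (A j))"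
  using A_finite[of j] A_nonempty[of j] by (simp add: digit_pmf_def measure_pmf_of_set)

sublocale P: product_prob_space "\<lambda>j. measure_pmf (pair_pmf block_pmf (digit_pmf j))" UNIV
  by unfold_locales

lemma prob_space_pm: "prob_space space_pm"
  unfolding space_pm_def by (rule P.prob_space_axioms)

lemma AE_Omega: "AE \<omega> in space_pm. \<omega> \<in> \<Omega>"
proof -
  have "AE \<omega> in space_pm. \<omega> i \<in> blocks \<times> set_pmf (digit_pmf i)" for i
  proof -
    have "AE v in measure_pmf (pair_pmf block_pmf (digit_pmf i)). v \<in> blocks \<times> set_pmf (digit_pmf i)"
      by (simp add: AE_measure_pmf_iff block_pmf)
    then show ?thesis unfolding space_pm_def by (intro P.AE_component) auto
  qed
  then have "AE \<omega> in space_pm. \<forall>i. \<omega> i \<in> blocks \<times> set_pmf (digit_pmf i)"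
    by (simp add: AE_all_countable)
  then show ?thesis
  proof eventually_elim
    case (elim \<omega>)
    then show ?case
      unfolding \<Omega>_def using digit_pmf by (auto simp: mem_Times_iff)
  qed
qed

lemma emeasure_rectangle:
  fixes X :: "nat \<Rightarrow> nat list set" and Y :: "nat \<Rightarrow> nat set"
  shows "{\<omega>. \<forall>j<N. fst (\<omega> j) \<in> X j \<and> snd (\<omega> j) \<in> Y j} \<in> sets space_pm"
    "emeasure space_pm {\<omega>. \<forall>j<N. fst (\<omega> j) \<in> X j \<and> snd (\<omega> j) \<in> Y j}
      = ennreal ((\<Prod>j<N. measure block_pmf (X j)) * (\<Prod>j<N. measure (digit_pmf j) (Y j)))"
proof -
  have eq: "{\<omega>. \<forall>j<N. fst (\<omega> j) \<in> X j \<and> snd (\<omega> j) \<in> Y j}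
      = {\<omega> \<in> space space_pm. \<forall>j\<in>{..<N}. \<omega> j \<in> X j \<times> Y j}"
    by (auto simp: space_pm_def space_PiM mem_Times_iff)
  show "{\<omega>. \<forall>j<N. fst (\<omega> j) \<in> X j \<and> snd (\<omega> j) \<in> Y j} \<in> sets space_pm"
  proof -
    have "{\<omega> \<in> space space_pm. \<omega> j \<in> W} \<in> sets space_pm" for j W
    proof -
      have "(\<lambda>\<omega>. \<omega> j) \<in> measurable space_pm (measure_pmf (pair_pmf block_pmf (digit_pmf j)))"
        unfolding space_pm_def by (rule measurable_component_singleton) simp
      from measurable_sets[OF this, of W] show ?thesis
        by (simp add: vimage_def Int_def conj_commute)
    qed
    then show ?thesis unfolding eq by (intro sets.sets_Collect_finite_All) auto
  qed
  have "emeasure space_pm {\<omega> \<in> space space_pm. \<forall>j\<in>{..<N}. \<omega> j \<in> X j \<times> Y j}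
      = (\<Prod>j\<in>{..<N}. emeasure (measure_pmf (pair_pmf block_pmf (digit_pmf j))) (X j \<times> Y j))"
    unfolding space_pm_def by (rule P.emeasure_PiM_Collect) auto
  also have "\<dots> = (\<Prod>j<N. ennreal (measure block_pmf (X j) * measure (digit_pmf j) (Y j)))"
    by (simp add: measure_pmf.emeasure_eq_measure measure_pmf_prob_product)
  also have "\<dots> = ennreal ((\<Prod>j<N. measure block_pmf (X j)) * (\<Prod>j<N. measure (digit_pmf j) (Y j)))"
    by (subst prod_ennreal) (auto simp: prod.distrib)
  finally show "emeasure space_pm {\<omega>. \<forall>j<N. fst (\<omega> j) \<in> X j \<and> snd (\<omega> j) \<in> Y j}
      = ennreal ((\<Prod>j<N. measure block_pmf (X j)) * (\<Prod>j<N. measure (digit_pmf j) (Y j)))"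
    unfolding eq .
qed

lemma nfree_0 [simp]: "nfree 0 = 0"
  by (simp add: nfree_def)

lemma nfree_Suc: "nfree (Suc n) = (if Suc n \<in> F then nfree n else Suc (nfree n))"
proof -
  have "{1..Suc n} - F = (if Suc n \<in> F then {1..n} - F else insert (Suc n) ({1..n} - F))"
    by (auto simp: le_Suc_eq)
  then show ?thesis by (simp add: nfree_def)
qed

lemma nfree_le: "nfree n \<le> n"
  unfolding nfree_def using card_mono[of "{1..n}" "{1..n} - F"] by simp

lemma digit_Suc: "digit \<omega> (Suc n) = (if Suc n \<in> F then snd (\<omega> (Suc n)) else free_digit \<omega> (nfree n))"
  by (simp add: digit_def)

lemma Omega_block: "\<omega> \<in> \<Omega> \<Longrightarrow> fst (\<omega> i) \<in> blocks"
  by (simp add: \<Omega>_def)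

lemma free_digit_range: "\<omega> \<in> \<Omega> \<Longrightarrow> 1 \<le> free_digit \<omega> i \<and> free_digit \<omega> i \<le> M"
  unfolding free_digit_def using l by (intro blocksD(3) Omega_block) auto

lemma digit_forced: "\<omega> \<in> \<Omega> \<Longrightarrow> j \<in> F \<Longrightarrow> digit \<omega> j \<in> A j"
  by (auto simp: \<Omega>_def digit_def)

lemma digit_forced_range: "\<omega> \<in> \<Omega> \<Longrightarrow> j \<in> F \<Longrightarrow> u j \<le> real (digit \<omega> j) \<and> real (digit \<omega> j) \<le> 2 * u j"
  using A_range digit_forced by blast

lemma digit_free_range: "\<omega> \<in> \<Omega> \<Longrightarrow> j \<notin> F \<Longrightarrow> 1 \<le> digit \<omega> j \<and> digit \<omega> j \<le> M"
  using free_digit_range by (simp add: digit_def)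

lemma digit_pos_seq: "\<omega> \<in> \<Omega> \<Longrightarrow> pos_seq (digit \<omega>)"
  unfolding pos_seq_def
proof (intro allI impI)
  fix j :: nat assume "\<omega> \<in> \<Omega>" "1 \<le> j"
  then show "1 \<le> digit \<omega> j"
    using digit_free_range[of \<omega> j] digit_forced_range[of \<omega> j] u_ge[of j] by (cases "j \<in> F") auto
qed

definition free_word :: "(nat \<Rightarrow> nat list \<times> nat) \<Rightarrow> nat \<Rightarrow> nat list" where
  "free_word \<omega> f = map (free_digit \<omega>) [0..<f]"

lemma free_word_pos: "\<omega> \<in> \<Omega> \<Longrightarrow> pos_word (free_word \<omega> f)"
  using free_digit_range by (auto simp: free_word_def pos_word_def)

text \<open>The pointwise counterpart of \<open>nn_integral_words_forced\<close>, again with a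
  general suffix. The constant comes from 2(d + 1) \<le> 2(2u + 1) \<le> 5u, valid because u is at
  least 2.\<close>

lemma cf_den_remove_forced:
  assumes \<omega>: "\<omega> \<in> \<Omega>" and v: "pos_word v"
  shows "cf_den (prefix (digit \<omega>) n @ v) 0
    \<le> (\<Prod>j\<in>F \<inter> {1..n}. 5 * u j) * cf_den (free_word \<omega> (nfree n) @ v) 0"
  using v
proof (induction n arbitrary: v)
  case 0
  then show ?case by (simp add: free_word_def)
next
  case (Suc n)
  let ?d = "digit \<omega> (Suc n)"
  have p: "pos_word (prefix (digit \<omega>) n)" using pos_word_prefix[OF digit_pos_seq[OF \<omega>]] .
  show ?case
  proof (cases "Suc n \<in> F")
    case True
    have sets: "F \<inter> {1..Suc n} = insert (Suc n) (F \<inter> {1..n})" using True by (auto simp: le_Suc_eq)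
    have d: "u (Suc n) \<le> real ?d" "real ?d \<le> 2 * u (Suc n)" "2 \<le> u (Suc n)"
      using digit_forced_range[OF \<omega> True] u_ge[OF True] by auto
    have "cf_den (prefix (digit \<omega>) (Suc n) @ v) 0 = cf_den (prefix (digit \<omega>) n @ ?d # v) 0"
      by (simp add: prefix_Suc)
    also have "\<dots> \<le> 2 * (real ?d + 1) * cf_den (prefix (digit \<omega>) n @ v) 0"
      using p Suc.prems d by (intro cf_den_insert_le) auto
    also have "\<dots> \<le> 5 * u (Suc n) * cf_den (prefix (digit \<omega>) n @ v) 0"
      using d p Suc.prems by (intro mult_right_mono less_imp_le[OF cf_den_pos]) auto
    also have "\<dots> \<le> 5 * u (Suc n) * ((\<Prod>j\<in>F \<inter> {1..n}. 5 * u j) * cf_den (free_word \<omega> (nfree n) @ v) 0)"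
      using d by (intro mult_left_mono Suc) auto
    finally show ?thesis using True unfolding sets by (simp add: nfree_Suc mult_ac)
  next
    case False
    have sets: "F \<inter> {1..Suc n} = F \<inter> {1..n}" using False by (auto simp: le_Suc_eq)
    have "pos_word (free_digit \<omega> (nfree n) # v)" using free_digit_range[OF \<omega>] Suc.prems by simp
    from Suc.IH[OF this] show ?thesis
      using False unfolding sets by (simp add: prefix_Suc digit_Suc nfree_Suc free_word_def)
  qed
qed

lemma free_word_block: "\<omega> \<in> \<Omega> \<Longrightarrow> free_word \<omega> (l * Suc i) = free_word \<omega> (l * i) @ fst (\<omega> i)"
proof -
  assume "\<omega> \<in> \<Omega>"
  then have len: "length (fst (\<omega> i)) = l" by (rule blocksD(1)[OF Omega_block])
  have "free_word \<omega> (l * i + l) = free_word \<omega> (l * i) @ map (free_digit \<omega>) [l * i..<l * i + l]"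
    unfolding free_word_def map_append[symmetric] by (rule arg_cong[OF upt_add_eq_append]) simp
  also have "map (free_digit \<omega>) [l * i..<l * i + l] = fst (\<omega> i)"
  proof (rule nth_equalityI)
    fix e assume "e < length (map (free_digit \<omega>) [l * i..<l * i + l])"
    then have e: "e < l" by simp
    then have "(l * i + e) div l = i" "(l * i + e) mod l = e" by simp_all
    then show "map (free_digit \<omega>) [l * i..<l * i + l] ! e = fst (\<omega> i) ! e"
      using e by (simp add: free_digit_def)
  qed (simp add: len)
  finally show ?thesis by (simp add: add.commute)
qed

lemma cf_den_blocks:
  assumes \<omega>: "\<omega> \<in> \<Omega>"
  shows "cf_den (free_word \<omega> (l * i)) 0 \<le> 2 ^ i * (\<Prod>k<i. cf_den (fst (\<omega> k)) 0)"
proof (induction i)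
  case 0
  then show ?case by (simp add: free_word_def)
next
  case (Suc i)
  have b: "pos_word (fst (\<omega> k))" for k by (rule blocksD(2)[OF Omega_block[OF \<omega>]])
  have "cf_den (free_word \<omega> (l * Suc i)) 0 \<le> 2 * cf_den (free_word \<omega> (l * i)) 0 * cf_den (fst (\<omega> i)) 0"
    unfolding free_word_block[OF \<omega>] using free_word_pos[OF \<omega>] b by (rule cf_den_append_le)
  also have "\<dots> \<le> 2 * (2 ^ i * (\<Prod>k<i. cf_den (fst (\<omega> k)) 0)) * cf_den (fst (\<omega> i)) 0"
    using Suc cf_den_pos[OF b, of 0 i] by (intro mult_right_mono mult_left_mono) auto
  finally show ?case by (simp add: mult_ac)
qed

text \<open>Complete blocks cost a factor 2 each; the incomplete last block has fewer than
  \<open>l\<close> letters, all at most \<open>M\<close>, and costs only a constant.\<close>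

lemma cf_den_free_word:
  assumes \<omega>: "\<omega> \<in> \<Omega>"
  shows "cf_den (free_word \<omega> f) 0 \<le> 2 * (real M + 1) ^ l * (2 ^ (f div l) * (\<Prod>k<f div l. cf_den (fst (\<omega> k)) 0))"
proof -
  let ?i = "f div l"
  have split: "free_word \<omega> f = free_word \<omega> (l * ?i) @ map (free_digit \<omega>) [l * ?i..<f]"
  proof -
    have "[0..<f] = [0..<l * ?i] @ [l * ?i..<f]"
      using upt_add_eq_append[of 0 "l * ?i" "f mod l"] by simp
    then show ?thesis by (simp add: free_word_def)
  qed
  let ?rest = "map (free_digit \<omega>) [l * ?i..<f]"
  have rest: "pos_word ?rest" "\<forall>a\<in>set ?rest. 1 \<le> a \<and> a \<le> M"
    using free_digit_range[OF \<omega>] by (auto simp: pos_word_def)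
  have "length ?rest = f mod l" by (simp add: minus_mult_div_eq_mod)
  then have len: "length ?rest \<le> l" using l by (simp add: less_imp_le)
  have "cf_den ?rest 0 \<le> (real M + 1) ^ length ?rest" by (rule cf_den_le_power[OF rest(2)])
  also have "\<dots> \<le> (real M + 1) ^ l" using len by (intro power_increasing) auto
  finally have r: "cf_den ?rest 0 \<le> (real M + 1) ^ l" .
  have "cf_den (free_word \<omega> f) 0 \<le> 2 * cf_den (free_word \<omega> (l * ?i)) 0 * cf_den ?rest 0"
    unfolding split using free_word_pos[OF \<omega>] rest(1) by (rule cf_den_append_le)
  also have "\<dots> \<le> 2 * (2 ^ ?i * (\<Prod>k<?i. cf_den (fst (\<omega> k)) 0)) * (real M + 1) ^ l"
    using cf_den_blocks[OF \<omega>, of ?i] r cf_den_pos[OF rest(1), of 0] cf_den_pos[OF free_word_pos[OF \<omega>], of 0 "l * ?i"]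
    by (intro mult_mono) auto
  finally show ?thesis by (simp add: mult_ac)
qed

text \<open>Only complete blocks are fixed and the incomplete one is left open, so the set is a
  rectangle of somewhat larger mass than the true cylinder. The slot \<open>D\<close> at position n
  + 1 measures a part of a window; the rectangle restricts coordinates 0 to n + 1, hence
  \<open>n + 2\<close>.\<close>

definition cylinder :: "(nat \<Rightarrow> nat list \<times> nat) \<Rightarrow> nat \<Rightarrow> nat set \<Rightarrow> (nat \<Rightarrow> nat list \<times> nat) set" where
  "cylinder \<omega>0 n D = {\<omega>. \<forall>j<n + 2.
     fst (\<omega> j) \<in> (if j < nfree n div l then {fst (\<omega>0 j)} else UNIV) \<and>
     snd (\<omega> j) \<in> (if j \<in> F \<inter> {1..n} then {snd (\<omega>0 j)} else if j = Suc n \<and> j \<in> F then D else UNIV)}"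

text \<open>Up to a constant, \<open>exponent n\<close> bounds the logarithm of \<open>q\<^sub>n\<^sup>2\<^sup>\<theta>\<close> times the mass of a cylinder
  of order \<open>n\<close>.\<close>

definition "exponent n =
  (\<Sum>j\<in>F \<inter> {1..n}. 2 * \<theta> * ln (5 * u j) - ln (real (card (A j)))) - \<kappa> * real (nfree n)"

text \<open>The first factor is the loss from the incomplete block in
  \<open>cf_den_free_word\<close>, the second the error of counting all free letters in place of
  those in complete blocks.\<close>

definition "K0 = (2 * (real M + 1) ^ l) powr (2 * \<theta>) * exp (\<bar>\<kappa>\<bar> * real l)"

lemma cylinder_sets: "cylinder \<omega>0 n D \<in> sets space_pm"
  unfolding cylinder_def by (rule emeasure_rectangle)

lemma card_pos: "j \<in> F \<Longrightarrow> 0 < real (card (A j))"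
  using A_finite A_nonempty by (simp add: card_gt_0_iff)

lemma emeasure_cylinder:
  assumes \<omega>0: "\<omega>0 \<in> \<Omega>"
  shows "emeasure space_pm (cylinder \<omega>0 n D) = ennreal ((\<Prod>k<nfree n div l. pmf block_pmf (fst (\<omega>0 k))) *
    ((\<Prod>j\<in>F \<inter> {1..n}. 1 / real (card (A j))) *
     (if Suc n \<in> F then real (card (A (Suc n) \<inter> D)) / real (card (A (Suc n))) else 1)))"
proof -
  let ?i = "nfree n div l"
  let ?X = "\<lambda>j. if j < ?i then {fst (\<omega>0 j)} else UNIV"
  let ?Y = "\<lambda>j. if j \<in> F \<inter> {1..n} then {snd (\<omega>0 j)} else if j = Suc n \<and> j \<in> F then D else UNIV"
  \<comment> \<open>The block indices fixed by the cylinder stay below \<open>n + 2\<close>, so all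
    of them are among the restricted coordinates.\<close>
  have i: "?i \<le> n" using nfree_le[of n] by (metis div_le_dividend le_trans)
  have "(\<Prod>j<n + 2. measure block_pmf (?X j)) = (\<Prod>k<?i. pmf block_pmf (fst (\<omega>0 k)))"
    using i by (intro prod.mono_neutral_cong_right) (auto simp: measure_pmf_single)
  moreover have "(\<Prod>j<n + 2. measure (digit_pmf j) (?Y j))
      = (\<Prod>j<Suc n. measure (digit_pmf j) (?Y j)) * measure (digit_pmf (Suc n)) (?Y (Suc n))"
    by simp
  moreover have "(\<Prod>j<Suc n. measure (digit_pmf j) (?Y j)) = (\<Prod>j\<in>F \<inter> {1..n}. 1 / real (card (A j)))"
  proof (rule prod.mono_neutral_cong_right)
    fix j assume j: "j \<in> F \<inter> {1..n}"
    then have "A j \<inter> {snd (\<omega>0 j)} = {snd (\<omega>0 j)}" using \<omega>0 by (auto simp: \<Omega>_def)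
    then show "measure (digit_pmf j) (?Y j) = 1 / real (card (A j))"
      using j by (simp add: measure_digit_pmf)
  qed (auto)
  moreover have "measure (digit_pmf (Suc n)) (?Y (Suc n))
      = (if Suc n \<in> F then real (card (A (Suc n) \<inter> D)) / real (card (A (Suc n))) else 1)"
    by (simp add: measure_digit_pmf)
  ultimately show ?thesis
    unfolding cylinder_def emeasure_rectangle(2) by simp
qed

text \<open>Multiply the mass by q^(2\<theta>) and insert the product bound for q. The block
  weights, proportional to the power -2\<theta> of the block denominators, cancel against the same
  denominators in q^(2\<theta>). What remains is \<open>4 powr \<theta> / Z\<close> per block, which
  is \<open>exp (- \<kappa> * real l)\<close>, and (5u)^(2\<theta>) divided by the window size for
  each prescribed digit.\<close>

lemma cylinder_weight_le:
  assumes \<omega>0: "\<omega>0 \<in> \<Omega>"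
  shows "(\<Prod>k<nfree n div l. pmf block_pmf (fst (\<omega>0 k))) * (\<Prod>j\<in>F \<inter> {1..n}. 1 / real (card (A j)))
    \<le> K0 * exp (exponent n) * cf_den (prefix (digit \<omega>0) n) 0 powr (- 2 * \<theta>)"
proof -
  let ?i = "nfree n div l"
  let ?q = "cf_den (prefix (digit \<omega>0) n) 0"
  let ?R = "2 * (real M + 1) ^ l"
  define b where "b k = cf_den (fst (\<omega>0 k)) 0" for k
  have blk: "fst (\<omega>0 k) \<in> blocks" for k by (rule Omega_block[OF \<omega>0])
  have b: "0 < b k" for k unfolding b_def using blocksD(2)[OF blk] by (rule cf_den_pos) simp
  have bprod: "0 < (\<Prod>k<?i. b k)" using b by (simp add: prod_pos)
  have q: "0 < ?q" using pos_word_prefix[OF digit_pos_seq[OF \<omega>0]] by (rule cf_den_pos) simp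
  have upos: "0 < 5 * u j" if "j \<in> F \<inter> {1..n}" for j using u_ge[of j] that by auto
  have P: "0 < (\<Prod>j\<in>F \<inter> {1..n}. 5 * u j)" using upos by (rule prod_pos)
  have "?q \<le> (\<Prod>j\<in>F \<inter> {1..n}. 5 * u j) * cf_den (free_word \<omega>0 (nfree n)) 0"
    using cf_den_remove_forced[OF \<omega>0, of "[]" n] by simp
  also have "\<dots> \<le> (\<Prod>j\<in>F \<inter> {1..n}. 5 * u j) * (?R * (2 ^ ?i * (\<Prod>k<?i. b k)))"
    using P cf_den_free_word[OF \<omega>0, of "nfree n"] unfolding b_def by (intro mult_left_mono) auto
  finally have "?q powr (2 * \<theta>) \<le> ((\<Prod>j\<in>F \<inter> {1..n}. 5 * u j) * (?R * (2 ^ ?i * (\<Prod>k<?i. b k)))) powr (2 * \<theta>)"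
    using q \<theta> by (intro powr_mono2) auto
  also have "\<dots> = (\<Prod>j\<in>F \<inter> {1..n}. 5 * u j) powr (2 * \<theta>) * ?R powr (2 * \<theta>) *
      (2 ^ ?i) powr (2 * \<theta>) * (\<Prod>k<?i. b k) powr (2 * \<theta>)"
    by (simp only: powr_mult mult.assoc)
  also have "(2 ^ ?i :: real) powr (2 * \<theta>) = (4 powr \<theta>) ^ ?i"
  proof -
    have "(2 ^ ?i :: real) powr (2 * \<theta>) = (2 powr (2 * \<theta>)) ^ ?i"
      by (simp add: powr_realpow[symmetric] powr_powr mult_ac)
    then show ?thesis by (simp add: powr_powr[symmetric])
  qed
  finally have qle: "?q powr (2 * \<theta>) \<le> (\<Prod>j\<in>F \<inter> {1..n}. 5 * u j) powr (2 * \<theta>) * ?R powr (2 * \<theta>) *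
      (4 powr \<theta>) ^ ?i * (\<Prod>k<?i. b k) powr (2 * \<theta>)" .
  let ?W = "(\<Prod>k<?i. pmf block_pmf (fst (\<omega>0 k))) * (\<Prod>j\<in>F \<inter> {1..n}. 1 / real (card (A j)))"
  have W: "(\<Prod>k<?i. pmf block_pmf (fst (\<omega>0 k))) = (\<Prod>k<?i. b k) powr (- 2 * \<theta>) / Z ^ ?i"
  proof -
    have "(\<Prod>k<?i. pmf block_pmf (fst (\<omega>0 k))) = (\<Prod>k<?i. b k powr (- 2 * \<theta>) / Z)"
      using block_pmf(2)[OF blk] by (simp add: b_def)
    also have "\<dots> = (\<Prod>k<?i. b k) powr (- 2 * \<theta>) / Z ^ ?i"
      using b by (simp add: prod_dividef prod_powr_distrib less_imp_le)
    finally show ?thesis .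
  qed
  have "?W * ?q powr (2 * \<theta>) \<le> ?W * ((\<Prod>j\<in>F \<inter> {1..n}. 5 * u j) powr (2 * \<theta>) * ?R powr (2 * \<theta>) *
      (4 powr \<theta>) ^ ?i * (\<Prod>k<?i. b k) powr (2 * \<theta>))"
    by (intro mult_left_mono qle mult_nonneg_nonneg prod_nonneg) auto
  also have "\<dots> = ((\<Prod>k<?i. b k) powr (- 2 * \<theta>) * (\<Prod>k<?i. b k) powr (2 * \<theta>)) * ?R powr (2 * \<theta>) *
      (4 powr \<theta> / Z) ^ ?i * ((\<Prod>j\<in>F \<inter> {1..n}. 5 * u j) powr (2 * \<theta>) * (\<Prod>j\<in>F \<inter> {1..n}. 1 / real (card (A j))))"
    unfolding W power_divide by simp
  also have "(\<Prod>k<?i. b k) powr (- 2 * \<theta>) * (\<Prod>k<?i. b k) powr (2 * \<theta>) = 1"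
  proof -
    have "x powr (- 2 * \<theta>) * x powr (2 * \<theta>) = 1" if "0 < x" for x :: real
      using that by (simp add: powr_add[symmetric])
    then show ?thesis using bprod .
  qed
  also have "1 * ?R powr (2 * \<theta>) * (4 powr \<theta> / Z) ^ ?i *
        ((\<Prod>j\<in>F \<inter> {1..n}. 5 * u j) powr (2 * \<theta>) * (\<Prod>j\<in>F \<inter> {1..n}. 1 / real (card (A j))))
      \<le> 1 * ?R powr (2 * \<theta>) * (exp (- \<kappa> * real (nfree n)) * exp (\<bar>\<kappa>\<bar> * real l)) *
        ((\<Prod>j\<in>F \<inter> {1..n}. 5 * u j) powr (2 * \<theta>) * (\<Prod>j\<in>F \<inter> {1..n}. 1 / real (card (A j))))"
  proof (intro mult_right_mono mult_left_mono mult_nonneg_nonneg prod_nonneg)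
    show "(4 powr \<theta> / Z) ^ ?i \<le> exp (- \<kappa> * real (nfree n)) * exp (\<bar>\<kappa>\<bar> * real l)"
  proof -
    have "real (nfree n) = real (l * ?i) + real (nfree n mod l)"
      unfolding of_nat_add[symmetric] by simp
    moreover have "\<kappa> * real (nfree n mod l) \<le> \<bar>\<kappa>\<bar> * real l"
    proof -
      have "\<kappa> * real (nfree n mod l) \<le> \<bar>\<kappa>\<bar> * real (nfree n mod l)" by (intro mult_right_mono) auto
      also have "\<dots> \<le> \<bar>\<kappa>\<bar> * real l" using l by (intro mult_left_mono) (auto intro: less_imp_le)
      finally show ?thesis .
    qed
    ultimately have "- \<kappa> * real (l * ?i) \<le> - \<kappa> * real (nfree n) + \<bar>\<kappa>\<bar> * real l"
      by (simp add: distrib_left)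
    then show ?thesis by (simp only: exp_kappa[symmetric] exp_add[symmetric] exp_le_cancel_iff)
  qed
  qed (auto)
  also have "(\<Prod>j\<in>F \<inter> {1..n}. 5 * u j) powr (2 * \<theta>) * (\<Prod>j\<in>F \<inter> {1..n}. 1 / real (card (A j)))
      = exp (\<Sum>j\<in>F \<inter> {1..n}. 2 * \<theta> * ln (5 * u j) - ln (real (card (A j))))"
  proof -
    have "(\<Prod>j\<in>F \<inter> {1..n}. 5 * u j) powr (2 * \<theta>) * (\<Prod>j\<in>F \<inter> {1..n}. 1 / real (card (A j)))
        = (\<Prod>j\<in>F \<inter> {1..n}. (5 * u j) powr (2 * \<theta>) * (1 / real (card (A j))))"
      unfolding prod_powr_distrib by (rule prod.distrib[symmetric])
    also have "\<dots> = (\<Prod>j\<in>F \<inter> {1..n}. exp (2 * \<theta> * ln (5 * u j) - ln (real (card (A j)))))"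
    proof (rule prod.cong)
      fix j assume j: "j \<in> F \<inter> {1..n}"
      then show "(5 * u j) powr (2 * \<theta>) * (1 / real (card (A j))) = exp (2 * \<theta> * ln (5 * u j) - ln (real (card (A j))))"
        using upos[OF j] card_pos[of j] by (simp add: exp_diff powr_def)
    qed simp
    also have "\<dots> = exp (\<Sum>j\<in>F \<inter> {1..n}. 2 * \<theta> * ln (5 * u j) - ln (real (card (A j))))"
      by (rule exp_sum[symmetric]) simp
    finally show ?thesis .
  qed
  also have "1 * ?R powr (2 * \<theta>) * (exp (- \<kappa> * real (nfree n)) * exp (\<bar>\<kappa>\<bar> * real l)) *
      exp (\<Sum>j\<in>F \<inter> {1..n}. 2 * \<theta> * ln (5 * u j) - ln (real (card (A j)))) = K0 * exp (exponent n)"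
    by (simp add: K0_def exponent_def exp_diff exp_minus divide_inverse mult_ac)
  finally have "?W * ?q powr (2 * \<theta>) \<le> K0 * exp (exponent n)" .
  then have "?W \<le> K0 * exp (exponent n) / ?q powr (2 * \<theta>)" using q by (simp add: pos_le_divide_eq)
  then show ?thesis by (simp add: powr_minus divide_inverse)
qed

lemma free_digit_agree:
  assumes "\<And>j. 1 \<le> j \<Longrightarrow> j \<le> n \<Longrightarrow> digit \<omega> j = digit \<omega>' j"
  shows "i < nfree n \<Longrightarrow> free_digit \<omega> i = free_digit \<omega>' i"
  using assms
proof (induction n)
  case (Suc n)
  show ?case
  proof (cases "i < nfree n")
    case True
    then show ?thesis using Suc by simp
  next
    case False
    then have "Suc n \<notin> F" "i = nfree n" using Suc.prems(1) by (auto simp: nfree_Suc split: if_splits)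
    then show ?thesis using Suc.prems(2)[of "Suc n"] by (simp add: digit_Suc)
  qed
qed simp

lemma mem_cylinder:
  assumes \<omega>: "\<omega> \<in> \<Omega>" "\<omega>0 \<in> \<Omega>" and agree: "\<And>j. 1 \<le> j \<Longrightarrow> j \<le> n \<Longrightarrow> digit \<omega> j = digit \<omega>0 j"
    and D: "Suc n \<in> F \<Longrightarrow> digit \<omega> (Suc n) \<in> D"
  shows "\<omega> \<in> cylinder \<omega>0 n D"
proof -
  have "fst (\<omega> k) = fst (\<omega>0 k)" if k: "k < nfree n div l" for k
  proof (rule nth_equalityI)
    have len: "length (fst (\<omega> k)) = l" "length (fst (\<omega>0 k)) = l"
      by (rule blocksD(1)[OF Omega_block[OF \<omega>(1)]], rule blocksD(1)[OF Omega_block[OF \<omega>(2)]])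
    then show "length (fst (\<omega> k)) = length (fst (\<omega>0 k))" by simp
    fix e assume "e < length (fst (\<omega> k))"
    then have e: "e < l" using len by simp
    have "k * l + e < Suc k * l" using e by simp
    also have "\<dots> \<le> (nfree n div l) * l" using k by (intro mult_right_mono) auto
    also have "\<dots> \<le> nfree n" by (rule div_times_less_eq_dividend)
    finally have "free_digit \<omega> (k * l + e) = free_digit \<omega>0 (k * l + e)"
      using free_digit_agree[of n \<omega> \<omega>0, OF agree] by blast
    then show "fst (\<omega> k) ! e = fst (\<omega>0 k) ! e" using e by (simp add: free_digit_def)
  qed
  moreover have "snd (\<omega> j) = snd (\<omega>0 j)" if "j \<in> F \<inter> {1..n}" for j
    using agree[of j] that by (simp add: digit_def)
  moreover have "snd (\<omega> (Suc n)) \<in> D" if "Suc n \<in> F" using D[OF that] that by (simp add: digit_def)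
  ultimately show ?thesis unfolding cylinder_def by auto
qed

definition \<phi> :: "(nat \<Rightarrow> nat list \<times> nat) \<Rightarrow> real" where
  "\<phi> \<omega> = cf_lim (digit \<omega>)"

definition tail :: "(nat \<Rightarrow> nat list \<times> nat) \<Rightarrow> nat \<Rightarrow> real" where
  "tail \<omega> n = cf_lim (\<lambda>j. digit \<omega> (n + j))"

text \<open>A tail that starts with a prescribed digit stays away from 1, and one that starts with a
  free digit stays away from 0. Either alternative suffices to separate neighbouring
  cylinders.\<close>

lemma tail_bounds:
  assumes \<omega>: "\<omega> \<in> \<Omega>"
  shows "0 < tail \<omega> n" "tail \<omega> n < 1"
    and "Suc n \<in> F \<Longrightarrow> tail \<omega> n \<le> 1 / 2"
    and "Suc n \<notin> F \<Longrightarrow> 1 / (real M + 1) \<le> tail \<omega> n"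
proof -
  have p: "pos_seq (\<lambda>j. digit \<omega> (n + j))" by (rule pos_seq_shift[OF digit_pos_seq[OF \<omega>]])
  show "0 < tail \<omega> n" "tail \<omega> n < 1"
    unfolding tail_def by (rule cf_lim_pos[OF p], rule cf_lim_less_1[OF p])
  let ?z = "cf_lim (\<lambda>j. digit \<omega> (n + Suc j))"
  have p': "pos_seq (\<lambda>j. digit \<omega> (n + Suc j))" using pos_seq_shift[OF p, of 1] by simp
  have z: "0 < ?z" "?z < 1" by (rule cf_lim_pos[OF p'], rule cf_lim_less_1[OF p'])
  have t: "tail \<omega> n = 1 / (real (digit \<omega> (Suc n)) + ?z)"
    unfolding tail_def using cf_lim_Suc[OF p] by simp
  show "tail \<omega> n \<le> 1 / 2" if "Suc n \<in> F"
  proof -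
    have "2 \<le> real (digit \<omega> (Suc n)) + ?z"
      using digit_forced_range[OF \<omega> that] u_ge[OF that] z by linarith
    then show ?thesis unfolding t by (intro divide_left_mono) auto
  qed
  show "1 / (real M + 1) \<le> tail \<omega> n" if "Suc n \<notin> F"
  proof -
    have "1 \<le> digit \<omega> (Suc n)" "real (digit \<omega> (Suc n)) \<le> real M" using digit_free_range[OF \<omega> that] by auto
    then have "0 < real (digit \<omega> (Suc n)) + ?z" "real (digit \<omega> (Suc n)) + ?z \<le> real M + 1" using z by linarith+
    then show ?thesis unfolding t by (intro divide_left_mono mult_pos_pos) auto
  qed
qed

lemma phi_eq:
  assumes "\<omega> \<in> \<Omega>"
  shows "\<phi> \<omega> = cf_val (prefix (digit \<omega>) n) (1 / (real (digit \<omega> (Suc n)) + tail \<omega> (Suc n)))"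
  using cf_lim_eq_cf_val[OF digit_pos_seq[OF assms], of "Suc n"]
  by (simp add: \<phi>_def tail_def prefix_Suc cf_val_append)

text \<open>Cylinders of neighbouring digits come close only if one tail is near 1 and the other
  near 0. Both tails start at the same position, so both are at most 1/2 or both at least 1/(M + 1),
  and this cannot happen.\<close>

lemma tail_gap:
  assumes \<omega>: "\<omega> \<in> \<Omega>" "\<omega>' \<in> \<Omega>" and a: "1 \<le> a' - a"
  shows "(a' - a) / (real M + 1) \<le> (a' + tail \<omega>' n) - (a + tail \<omega> n)"
proof -
  define c where "c = 1 / (real M + 1)"
  have c: "0 < c" "c \<le> 1 / 2" using M by (auto simp: c_def intro!: divide_left_mono)
  note b = tail_bounds[OF \<omega>(1), of n] tail_bounds[OF \<omega>(2), of n]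
  have "c * (a' - a) \<le> (a' - a) + tail \<omega>' n - tail \<omega> n"
  proof (cases "Suc n \<in> F")
    case True
    have "c * (a' - a) \<le> 1 / 2 * (a' - a)" using c a by (intro mult_right_mono) auto
    moreover have "1 / 2 * (a' - a) \<le> (a' - a) - 1 / 2" using a by simp
    moreover have "- (1 / 2) \<le> tail \<omega>' n - tail \<omega> n" using b True by linarith
    ultimately show ?thesis by linarith
  next
    case False
    have "0 \<le> (a' - a - 1) * (1 - c)" using a c by (intro mult_nonneg_nonneg) auto
    then have "c * (a' - a) \<le> (a' - a) + c - 1" by (simp add: algebra_simps)
    moreover have "c - 1 \<le> tail \<omega>' n - tail \<omega> n" using b False unfolding c_def by linarith
    ultimately show ?thesis by linarith
  qed
  then show ?thesis by (simp add: c_def algebra_simps)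
qed

text \<open>With \<open>n\<close> common digits, \<open>cf_val\<close> contracts distances by at
  most 4 q^2, the inversion of digit plus tail contributes the factors \<open>a + 1\<close> and
  \<open>a' + 1\<close>, and \<open>tail_gap\<close> converts digit plus tail back into the
  digit.\<close>

lemma phi_separation:
  assumes \<omega>: "\<omega> \<in> \<Omega>" "\<omega>' \<in> \<Omega>" and agree: "\<And>j. 1 \<le> j \<Longrightarrow> j \<le> n \<Longrightarrow> digit \<omega> j = digit \<omega>' j"
    and q: "q = cf_den (prefix (digit \<omega>) n) 0"
  defines "a \<equiv> real (digit \<omega> (Suc n))" and "a' \<equiv> real (digit \<omega>' (Suc n))"
  shows "\<bar>a - a'\<bar> \<le> 4 * (real M + 1) * q\<^sup>2 * (a + 1) * (a' + 1) * dist (\<phi> \<omega>) (\<phi> \<omega>')"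
proof (cases "a = a'")
  case True
  have "0 \<le> a" by (simp add: a_def)
  then show ?thesis using True by simp
next
  case False
  have pre: "prefix (digit \<omega>') n = prefix (digit \<omega>) n"
    unfolding prefix_def using agree by (intro map_cong) auto
  have w: "pos_word (prefix (digit \<omega>) n)" by (rule pos_word_prefix[OF digit_pos_seq[OF \<omega>(1)]])
  have q0: "0 < q" unfolding q by (rule cf_den_pos[OF w]) simp
  have a1: "1 \<le> a" "1 \<le> a'"
    using digit_pos_seq[OF \<omega>(1)] digit_pos_seq[OF \<omega>(2)] by (auto simp: a_def a'_def pos_seq_def)
  let ?x = "a + tail \<omega> (Suc n)" and ?y = "a' + tail \<omega>' (Suc n)"
  have t: "0 < tail \<omega> (Suc n)" "tail \<omega> (Suc n) < 1" "0 < tail \<omega>' (Suc n)" "tail \<omega>' (Suc n) < 1"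
    using tail_bounds \<omega> by auto
  have xy: "1 \<le> ?x" "1 \<le> ?y" "?x \<le> a + 1" "?y \<le> a' + 1" using a1 t by linarith+
  have "\<bar>a - a'\<bar> / (real M + 1) \<le> \<bar>?x - ?y\<bar>"
  proof -
    have "1 \<le> \<bar>a - a'\<bar>" using False unfolding a_def a'_def by (intro abs_diff_of_nat_ge) simp
    then consider "1 \<le> a' - a" | "1 \<le> a - a'" by linarith
    then show ?thesis
    proof cases
      case 1
      then have e: "\<bar>a - a'\<bar> = a' - a" by linarith
      show ?thesis unfolding e using tail_gap[OF \<omega> 1, of "Suc n"] by linarith
    next
      case 2
      then have e: "\<bar>a - a'\<bar> = a - a'" by linarith
      show ?thesis unfolding e using tail_gap[OF \<omega>(2,1) 2, of "Suc n"] by linarith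
    qed
  qed
  then have 1: "\<bar>a - a'\<bar> \<le> (real M + 1) * \<bar>?x - ?y\<bar>" by (simp add: pos_divide_le_eq mult.commute)
  have "\<bar>?x - ?y\<bar> = \<bar>1 / ?x - 1 / ?y\<bar> * (?x * ?y)"
    using xy by (intro abs_diff_eq_inverse) auto
  also have "\<dots> \<le> (4 * q\<^sup>2 * dist (\<phi> \<omega>) (\<phi> \<omega>')) * ((a + 1) * (a' + 1))"
  proof (intro mult_mono)
    have "dist (\<phi> \<omega>) (\<phi> \<omega>') = \<bar>cf_val (prefix (digit \<omega>) n) (1 / ?x) - cf_val (prefix (digit \<omega>) n) (1 / ?y)\<bar>"
      unfolding phi_eq[OF \<omega>(1), of n] phi_eq[OF \<omega>(2), of n] pre dist_real_def a_def a'_def ..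
    moreover have "\<bar>1 / ?x - 1 / ?y\<bar> / (4 * q\<^sup>2) \<le> \<bar>cf_val (prefix (digit \<omega>) n) (1 / ?x) - cf_val (prefix (digit \<omega>) n) (1 / ?y)\<bar>"
      unfolding q using xy by (intro cf_val_dist_ge[OF w]) auto
    ultimately have "\<bar>1 / ?x - 1 / ?y\<bar> / (4 * q\<^sup>2) \<le> dist (\<phi> \<omega>) (\<phi> \<omega>')" by (simp only:)
    then show "\<bar>1 / ?x - 1 / ?y\<bar> \<le> 4 * q\<^sup>2 * dist (\<phi> \<omega>) (\<phi> \<omega>')"
      using q0 by (subst (asm) pos_divide_le_eq) (simp, simp only: mult.commute)
  qed (use xy in auto)
  finally have "(real M + 1) * \<bar>?x - ?y\<bar> \<le> (real M + 1) * ((4 * q\<^sup>2 * dist (\<phi> \<omega>) (\<phi> \<omega>')) * ((a + 1) * (a' + 1)))"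
    by (rule mult_left_mono) simp
  with 1 have "\<bar>a - a'\<bar> \<le> (real M + 1) * ((4 * q\<^sup>2 * dist (\<phi> \<omega>) (\<phi> \<omega>')) * ((a + 1) * (a' + 1)))"
    by (rule order_trans)
  also have "\<dots> = 4 * (real M + 1) * q\<^sup>2 * (a + 1) * (a' + 1) * dist (\<phi> \<omega>) (\<phi> \<omega>')"
    by (simp only: mult_ac)
  finally show ?thesis .
qed

lemma card_le_real_diameter:
  fixes D :: "nat set" and X :: real
  assumes "finite D" "D \<noteq> {}" "\<And>a b. a \<in> D \<Longrightarrow> b \<in> D \<Longrightarrow> \<bar>real a - real b\<bar> \<le> X"
  shows "real (card D) \<le> X + 1"
proof -
  have m: "Min D \<in> D" using assms by simp
  have X: "0 \<le> X" using assms(3)[OF m m] by simp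
  have "D \<subseteq> {Min D..Min D + nat \<lfloor>X\<rfloor>}"
  proof
    fix a assume a: "a \<in> D"
    have "Min D \<le> a" using a assms(1) by simp
    moreover have "real a - real (Min D) \<le> X" using assms(3)[OF a m] by linarith
    then have "int a - int (Min D) \<le> \<lfloor>X\<rfloor>" by (simp add: le_floor_iff)
    ultimately show "a \<in> {Min D..Min D + nat \<lfloor>X\<rfloor>}" by auto
  qed
  then have "card D \<le> card {Min D..Min D + nat \<lfloor>X\<rfloor>}" by (rule card_mono[rotated]) simp
  then have "card D \<le> nat \<lfloor>X\<rfloor> + 1" by simp
  then have "real (card D) \<le> real (nat \<lfloor>X\<rfloor>) + 1" by linarith
  also have "real (nat \<lfloor>X\<rfloor>) \<le> X" using X by linarith
  finally show ?thesis by simp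
qed

text \<open>Makes \<open>2 * ln (u j) - ln (real (card (A j)))\<close> nonnegative, so the
  hypothesis of the dimension bound also bounds \<open>exponent\<close> alone. It follows from u + 1
  \<le> 2u \<le> u^2.\<close>

lemma A_card_le: "j \<in> F \<Longrightarrow> real (card (A j)) \<le> (u j)\<^sup>2"
proof -
  assume j: "j \<in> F"
  have "real (card (A j)) \<le> u j + 1"
  proof (rule card_le_real_diameter[OF A_finite[OF j] A_nonempty[OF j]])
    fix a b assume "a \<in> A j" "b \<in> A j"
    then show "\<bar>real a - real b\<bar> \<le> u j" using A_range[OF j, of a] A_range[OF j, of b] by linarith
  qed
  moreover have "2 * u j \<le> u j * u j" using u_ge[OF j] by (intro mult_right_mono) auto
  ultimately show ?thesis using u_ge[OF j] unfolding power2_eq_square by linarith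
qed

text \<open>A set \<open>U\<close> of diameter at most \<rho> is studied at the order
  \<open>n\<close> where its points first disagree. If position n + 1 is free, separation bounds
  q_n^(-2) by a constant times \<rho>, and the whole cylinder is small enough. If it is prescribed,
  \<open>U\<close> meets at most about q_n^2 u^2 \<rho> digits of the window, and this proportion of
  the mass produces the extra term of the hypothesis.\<close>

lemma dimension_ge:
  assumes bound: "\<And>n. exponent n +
    (if Suc n \<in> F then \<theta> * (2 * ln (u (Suc n)) - ln (real (card (A (Suc n))))) else 0) \<le> B"
  shows "ereal \<theta> \<le> hausdorff_dim {x \<in> irr_unit. \<forall>j\<ge>1. if j \<in> F then digits x j \<in> A j else digits x j \<le> M}"
proof (rule hausdorff_dim_geI[OF prob_space_pm AE_Omega, of \<phi>])
  show "\<phi> ` \<Omega> \<subseteq> {x \<in> irr_unit. \<forall>j\<ge>1. if j \<in> F then digits x j \<in> A j else digits x j \<le> M}"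
    using digit_pos_seq digit_forced digit_free_range
    by (auto simp: \<phi>_def digits_cf_lim intro: cf_lim_in_irr_unit)
  \<comment> \<open>72 = 4 * 9 * 2: the 4 of \<open>phi_separation\<close>, two factors 3 from digit
    + 1 \<le> 3u, and 2 from X + 1 \<le> 2X. At a free position both factors digit + 1 are at most M
    + 1, which explains the cube.\<close>
  define c where "c = 72 * (real M + 1) ^ 3"
  have M1: "1 \<le> (real M + 1) ^ 3" by simp
  have c: "72 \<le> c" unfolding c_def using M1 by linarith
  define C where "C = K0 * exp B * c powr \<theta>"
  have K0: "0 < K0" unfolding K0_def by simp
  show "0 < C" using K0 c by (simp add: C_def)
  show "0 < \<theta>" by (rule \<theta>)
  have exponent_le: "exponent n \<le> B" for n
  proof -
    have "0 \<le> \<theta> * (2 * ln (u (Suc n)) - ln (real (card (A (Suc n)))))" if F: "Suc n \<in> F"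
    proof -
      have "ln (real (card (A (Suc n)))) \<le> ln ((u (Suc n))\<^sup>2)"
        using A_card_le[OF F] card_pos[OF F] u_ge[OF F] by (subst ln_le_cancel_iff) auto
      also have "\<dots> = 2 * ln (u (Suc n))" using u_ge[OF F] by (simp add: ln_realpow)
      finally show ?thesis using \<theta> by (intro mult_nonneg_nonneg) auto
    qed
    then show ?thesis using bound[of n] by (auto split: if_splits)
  qed
  fix U :: "real set" and \<rho> :: real
  assume \<rho>: "0 < \<rho>" and U: "\<And>x y. x \<in> U \<Longrightarrow> y \<in> U \<Longrightarrow> dist x y \<le> \<rho>"
  show "\<exists>S\<in>sets space_pm. (\<forall>\<omega>\<in>\<Omega>. \<phi> \<omega> \<in> U \<longrightarrow> \<omega> \<in> S) \<and> emeasure space_pm S \<le> ennreal (C * \<rho> powr \<theta>)"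
  proof (cases "\<exists>\<omega>0\<in>\<Omega>. \<phi> \<omega>0 \<in> U")
    case False
    then show ?thesis by (intro bexI[of _ "{}"]) auto
  next
    case True
    then obtain \<omega>0 where \<omega>0: "\<omega>0 \<in> \<Omega>" "\<phi> \<omega>0 \<in> U" by blast
    define q where "q n = cf_den (prefix (digit \<omega>0) n) 0" for n
    have q: "0 < q n" for n
      unfolding q_def by (rule cf_den_pos[OF pos_word_prefix[OF digit_pos_seq[OF \<omega>0(1)]]]) simp
    have meas: "emeasure space_pm (cylinder \<omega>0 n D) \<le> ennreal (K0 * exp (exponent n) * q n powr (- 2 * \<theta>) *
        (if Suc n \<in> F then real (card (A (Suc n) \<inter> D)) / real (card (A (Suc n))) else 1))" for n D
      unfolding emeasure_cylinder[OF \<omega>0(1)] mult.assoc[symmetric] q_def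
      using cylinder_weight_le[OF \<omega>0(1), of n] by (intro ennreal_leI mult_right_mono) auto
    have meas1: "emeasure space_pm (cylinder \<omega>0 n UNIV) \<le> ennreal (K0 * exp B * q n powr (- 2 * \<theta>))" for n
    proof -
      have "K0 * exp (exponent n) * q n powr (- 2 * \<theta>) \<le> K0 * exp B * q n powr (- 2 * \<theta>)"
        using exponent_le[of n] K0 by (intro mult_right_mono mult_left_mono) auto
      moreover have "(if Suc n \<in> F then real (card (A (Suc n) \<inter> UNIV)) / real (card (A (Suc n))) else 1) = 1"
        using card_pos[of "Suc n"] by auto
      ultimately show ?thesis using meas[of n UNIV] by (simp add: order_trans ennreal_leI)
    qed
    show ?thesis
    proof (cases "\<forall>\<omega>\<in>\<Omega>. \<phi> \<omega> \<in> U \<longrightarrow> (\<forall>j\<ge>1. digit \<omega> j = digit \<omega>0 j)")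
      \<comment> \<open>All sample points over \<open>U\<close> share every digit, so any cylinder
        of sufficiently high order contains them; one with q_n^(-2) at most \<rho> is
        chosen.\<close>
      case True
      have "(\<lambda>n. (1/2 :: real) ^ (n div 2)) \<longlonglongrightarrow> 0" by (rule power2_div2_tendsto)
      then have "\<forall>\<^sub>F n in sequentially. (1/2 :: real) ^ (n div 2) < min 1 \<rho>"
        using \<rho> by (intro order_tendstoD) auto
      then obtain n where n: "(1/2 :: real) ^ (n div 2) < min 1 \<rho>"
        unfolding eventually_sequentially by blast
      have "2 ^ (n div 2) \<le> q n"
        using cf_den_ge_power2[OF pos_word_prefix[OF digit_pos_seq[OF \<omega>0(1)]], of n] by (simp add: q_def)
      then have "1 / q n \<le> 1 / 2 ^ (n div 2)" using q by (intro divide_left_mono) auto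
      moreover have "1 / 2 ^ (n div 2) < min 1 \<rho>" using n by (simp only: power_one_over)
      ultimately have qn: "1 / q n \<le> min 1 \<rho>" by linarith
      have "q n powr (- 2 * \<theta>) = (1 / q n * (1 / q n)) powr \<theta>"
      proof -
        have "q n powr (- 2 * \<theta>) = (q n powr (- 2)) powr \<theta>" by (simp add: powr_powr)
        also have "q n powr (- 2) = 1 / q n * (1 / q n)"
          using q[of n] by (simp add: powr_minus powr_numeral power2_eq_square divide_inverse)
        finally show ?thesis .
      qed
      also have "\<dots> \<le> (\<rho> * 1) powr \<theta>"
        using qn q[of n] \<rho> \<theta> by (intro powr_mono2 mult_mono) (auto simp: less_imp_le)
      also have "\<dots> \<le> (c * \<rho>) powr \<theta>" using c \<rho> \<theta> by (intro powr_mono2) auto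
      finally have "K0 * exp B * q n powr (- 2 * \<theta>) \<le> K0 * exp B * (c * \<rho>) powr \<theta>"
        using K0 by (intro mult_left_mono) auto
      also have "\<dots> = C * \<rho> powr \<theta>" by (simp add: C_def powr_mult)
      finally have "emeasure space_pm (cylinder \<omega>0 n UNIV) \<le> ennreal (C * \<rho> powr \<theta>)"
        using meas1[of n] by (simp add: order_trans ennreal_leI)
      moreover have "\<forall>\<omega>\<in>\<Omega>. \<phi> \<omega> \<in> U \<longrightarrow> \<omega> \<in> cylinder \<omega>0 n UNIV"
        using True \<omega>0(1) by (auto intro!: mem_cylinder)
      ultimately show ?thesis using cylinder_sets by blast
    next
      case False
      \<comment> \<open>The least such \<open>n\<close> is the common order: all sample points over
        \<open>U\<close> agree up to digit \<open>n\<close>, and some two of them differ at digit n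
        + 1.\<close>
      define P where "P n \<longleftrightarrow> (\<exists>\<omega>\<in>\<Omega>. \<phi> \<omega> \<in> U \<and> digit \<omega> (Suc n) \<noteq> digit \<omega>0 (Suc n))" for n
      obtain \<omega>1 j where "\<omega>1 \<in> \<Omega>" "\<phi> \<omega>1 \<in> U" "1 \<le> j" "digit \<omega>1 j \<noteq> digit \<omega>0 j"
        using False by blast
      then have "P (j - 1)" by (auto simp: P_def)
      then have P: "P (LEAST n. P n)" by (rule LeastI)
      define n where "n = (LEAST n. P n)"
      obtain \<omega>1 where \<omega>1: "\<omega>1 \<in> \<Omega>" "\<phi> \<omega>1 \<in> U" "digit \<omega>1 (Suc n) \<noteq> digit \<omega>0 (Suc n)"
        using P unfolding n_def P_def by blast
      have agree: "digit \<omega> j = digit \<omega>0 j" if "\<omega> \<in> \<Omega>" "\<phi> \<omega> \<in> U" "1 \<le> j" "j \<le> n" for \<omega> j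
      proof (rule ccontr)
        assume "digit \<omega> j \<noteq> digit \<omega>0 j"
        then have "P (j - 1)" using that by (auto simp: P_def)
        moreover have "j - 1 < n" using that by simp
        ultimately show False using not_less_Least[of "j - 1" P] unfolding n_def by blast
      qed
      have sep: "\<bar>real (digit \<omega> (Suc n)) - real (digit \<omega>' (Suc n))\<bar>
          \<le> 4 * (real M + 1) * (q n)\<^sup>2 * (real (digit \<omega> (Suc n)) + 1) * (real (digit \<omega>' (Suc n)) + 1) * \<rho>"
        if \<omega>: "\<omega> \<in> \<Omega>" "\<phi> \<omega> \<in> U" "\<omega>' \<in> \<Omega>" "\<phi> \<omega>' \<in> U" for \<omega> \<omega>'
      proof -
        have "prefix (digit \<omega>) n = prefix (digit \<omega>0) n"
          unfolding prefix_def using agree[OF \<omega>(1,2)] by (intro map_cong) auto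
        then have "\<bar>real (digit \<omega> (Suc n)) - real (digit \<omega>' (Suc n))\<bar>
          \<le> 4 * (real M + 1) * (q n)\<^sup>2 * (real (digit \<omega> (Suc n)) + 1) * (real (digit \<omega>' (Suc n)) + 1) * dist (\<phi> \<omega>) (\<phi> \<omega>')"
          using agree[OF \<omega>(1,2)] agree[OF \<omega>(3,4)] by (intro phi_separation \<omega>) (auto simp: q_def)
        also have "\<dots> \<le> 4 * (real M + 1) * (q n)\<^sup>2 * (real (digit \<omega> (Suc n)) + 1) * (real (digit \<omega>' (Suc n)) + 1) * \<rho>"
          using U[OF \<omega>(2,4)] by (intro mult_left_mono) auto
        finally show ?thesis .
      qed
      define D where "D = {digit \<omega> (Suc n) |\<omega>. \<omega> \<in> \<Omega> \<and> \<phi> \<omega> \<in> U}"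
      have mem: "\<forall>\<omega>\<in>\<Omega>. \<phi> \<omega> \<in> U \<longrightarrow> \<omega> \<in> cylinder \<omega>0 n D"
        using agree \<omega>0(1) by (auto simp: D_def intro!: mem_cylinder)
      have one: "1 \<le> \<bar>real (digit \<omega>1 (Suc n)) - real (digit \<omega>0 (Suc n))\<bar>"
        using \<omega>1(3) by (rule abs_diff_of_nat_ge)
      have "emeasure space_pm (cylinder \<omega>0 n D) \<le> ennreal (C * \<rho> powr \<theta>)"
      proof (cases "Suc n \<in> F")
        case False
        have "real (digit \<omega> (Suc n)) + 1 \<le> real M + 1" if "\<omega> \<in> \<Omega>" for \<omega>
          using digit_free_range[OF that False] by simp
        then have "(real (digit \<omega>1 (Suc n)) + 1) * (real (digit \<omega>0 (Suc n)) + 1) \<le> (real M + 1) * (real M + 1)"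
          using \<omega>1(1) \<omega>0(1) by (intro mult_mono) auto
        then have "4 * (real M + 1) * (q n)\<^sup>2 * \<rho> * ((real (digit \<omega>1 (Suc n)) + 1) * (real (digit \<omega>0 (Suc n)) + 1))
            \<le> 4 * (real M + 1) * (q n)\<^sup>2 * \<rho> * ((real M + 1) * (real M + 1))"
          using \<rho> by (intro mult_left_mono) auto
        then have "1 \<le> 4 * (real M + 1) * (q n)\<^sup>2 * \<rho> * ((real M + 1) * (real M + 1))"
          using sep[OF \<omega>1(1,2) \<omega>0] one by (simp add: mult_ac)
        also have "\<dots> = 4 * (real M + 1) ^ 3 * ((q n)\<^sup>2 * \<rho>)" by (simp add: power3_eq_cube mult_ac)
        also have "\<dots> \<le> c * ((q n)\<^sup>2 * \<rho>)" unfolding c_def using \<rho> by (intro mult_right_mono) auto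
        finally have "1 \<le> c * ((q n)\<^sup>2 * \<rho>)" .
        then have "1 powr \<theta> \<le> (c * \<rho> * (q n)\<^sup>2) powr \<theta>" using \<theta> by (intro powr_mono2) (auto simp: mult_ac)
        also have "\<dots> = (c * \<rho>) powr \<theta> * q n powr (2 * \<theta>)"
          unfolding powr_mult[of "c * \<rho>"] using q[of n] by (simp add: powr_powr powr_numeral[symmetric] del: powr_numeral)
        finally have "1 * q n powr (- 2 * \<theta>) \<le> (c * \<rho>) powr \<theta> * q n powr (2 * \<theta>) * q n powr (- 2 * \<theta>)"
          by (intro mult_right_mono) auto
        also have "\<dots> = (c * \<rho>) powr \<theta>" using q[of n] by (simp add: powr_add[symmetric] mult.assoc)
        finally have "K0 * exp B * q n powr (- 2 * \<theta>) \<le> K0 * exp B * (c * \<rho>) powr \<theta>"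
          using K0 by (intro mult_left_mono) auto
        also have "\<dots> = C * \<rho> powr \<theta>" by (simp add: C_def powr_mult)
        finally have "K0 * exp B * q n powr (- 2 * \<theta>) \<le> C * \<rho> powr \<theta>" .
        moreover have "(j = Suc n \<and> j \<in> F) = False" for j using False by auto
        then have "cylinder \<omega>0 n D = cylinder \<omega>0 n UNIV" unfolding cylinder_def by (simp only: if_False)
        ultimately show ?thesis using meas1[of n] by (simp add: order_trans ennreal_leI)
      next
        case True
        let ?u = "u (Suc n)" and ?N = "real (card (A (Suc n)))"
        define X where "X = 36 * (real M + 1) * (q n)\<^sup>2 * ?u\<^sup>2 * \<rho>"
        have u2: "2 \<le> ?u" by (rule u_ge[OF True])
        have X: "\<bar>real (digit \<omega> (Suc n)) - real (digit \<omega>' (Suc n))\<bar> \<le> X"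
          if \<omega>: "\<omega> \<in> \<Omega>" "\<phi> \<omega> \<in> U" "\<omega>' \<in> \<Omega>" "\<phi> \<omega>' \<in> U" for \<omega> \<omega>'
        proof -
          have "real (digit \<omega> (Suc n)) + 1 \<le> 3 * ?u" if "\<omega> \<in> \<Omega>" for \<omega>
            using digit_forced_range[OF that True] u2 by linarith
          then have "(real (digit \<omega> (Suc n)) + 1) * (real (digit \<omega>' (Suc n)) + 1) \<le> (3 * ?u) * (3 * ?u)"
            using \<omega> u2 by (intro mult_mono) auto
          then have "4 * (real M + 1) * (q n)\<^sup>2 * \<rho> * ((real (digit \<omega> (Suc n)) + 1) * (real (digit \<omega>' (Suc n)) + 1))
              \<le> 4 * (real M + 1) * (q n)\<^sup>2 * \<rho> * ((3 * ?u) * (3 * ?u))"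
            using \<rho> by (intro mult_left_mono) auto
          then show ?thesis using sep[OF \<omega>] by (simp add: X_def power2_eq_square mult_ac)
        qed
        have X1: "1 \<le> X" using X[OF \<omega>1(1,2) \<omega>0] one by linarith
        have DA: "D \<subseteq> A (Suc n)" using digit_forced[OF _ True] by (auto simp: D_def)
        have "real (card D) \<le> X + 1"
        proof (rule card_le_real_diameter)
          show "finite D" using DA A_finite[OF True] by (rule finite_subset)
          show "D \<noteq> {}" using \<omega>0 by (auto simp: D_def)
          show "\<bar>real a - real b\<bar> \<le> X" if "a \<in> D" "b \<in> D" for a b
            using that X by (auto simp: D_def)
        qed
        then have cD: "real (card D) \<le> 2 * X" using X1 by linarith
        have N: "0 < ?N" by (rule card_pos[OF True])
        \<comment> \<open>The proportion is at most min 1 x for x = 2X/N, and min 1 x \<le>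
          x^\<theta> because \<theta> \<le> 1. This interpolation serves all scales between a single
          digit and the full window.\<close>
        have "real (card D) / ?N \<le> (2 * X / ?N) powr \<theta>"
        proof (cases "2 * X / ?N \<le> 1")
          case True
          have "real (card D) / ?N \<le> 2 * X / ?N" using cD N by (intro divide_right_mono) auto
          also have "\<dots> = (2 * X / ?N) powr 1" using X1 N by simp
          also have "\<dots> \<le> (2 * X / ?N) powr \<theta>" using True X1 N \<theta> by (intro powr_mono') auto
          finally show ?thesis .
        next
          case big: False
          have "real (card D) / ?N \<le> 1"
            using card_mono[OF A_finite[OF True] DA] N by simp
          also have "1 = 1 powr \<theta>" by simp
          also have "\<dots> \<le> (2 * X / ?N) powr \<theta>" using big \<theta> by (intro powr_mono2) auto
          finally show ?thesis .
        qed
        also have "2 * X / ?N = (72 * (real M + 1) * \<rho>) * (q n)\<^sup>2 * (?u\<^sup>2 / ?N)"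
          by (simp add: X_def mult_ac)
        also have "\<dots> powr \<theta> = (72 * (real M + 1) * \<rho>) powr \<theta> * q n powr (2 * \<theta>) * exp (\<theta> * (2 * ln ?u - ln ?N))"
        proof -
          have "((q n)\<^sup>2) powr \<theta> = q n powr (2 * \<theta>)"
            using q[of n] by (simp add: powr_powr powr_numeral[symmetric] del: powr_numeral)
          moreover have "(?u\<^sup>2 / ?N) powr \<theta> = exp (\<theta> * (2 * ln ?u - ln ?N))"
            using u2 N by (simp add: powr_def ln_div ln_realpow)
          ultimately show ?thesis by (simp only: powr_mult)
        qed
        finally have frac: "real (card D) / ?N \<le> (72 * (real M + 1) * \<rho>) powr \<theta> * q n powr (2 * \<theta>) * exp (\<theta> * (2 * ln ?u - ln ?N))" .
        have "K0 * exp (exponent n) * q n powr (- 2 * \<theta>) * (real (card D) / ?N)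
            \<le> K0 * exp (exponent n) * q n powr (- 2 * \<theta>) *
              ((72 * (real M + 1) * \<rho>) powr \<theta> * q n powr (2 * \<theta>) * exp (\<theta> * (2 * ln ?u - ln ?N)))"
          using K0 by (intro mult_left_mono frac) auto
        also have "\<dots> = K0 * (exp (exponent n) * exp (\<theta> * (2 * ln ?u - ln ?N))) * (72 * (real M + 1) * \<rho>) powr \<theta> *
            (q n powr (- 2 * \<theta>) * q n powr (2 * \<theta>))" by (simp only: mult_ac)
        also have "q n powr (- 2 * \<theta>) * q n powr (2 * \<theta>) = 1" using q[of n] by (simp add: powr_add[symmetric])
        also have "K0 * (exp (exponent n) * exp (\<theta> * (2 * ln ?u - ln ?N))) * (72 * (real M + 1) * \<rho>) powr \<theta> * 1
            \<le> K0 * exp B * (c * \<rho>) powr \<theta> * 1"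
        proof (intro mult_mono)
          show "exp (exponent n) * exp (\<theta> * (2 * ln ?u - ln ?N)) \<le> exp B"
            using bound[of n] True by (simp add: exp_add[symmetric])
          have "real M + 1 \<le> (real M + 1) ^ 3" using power_increasing[of 1 3 "real M + 1"] by simp
          then show "(72 * (real M + 1) * \<rho>) powr \<theta> \<le> (c * \<rho>) powr \<theta>"
            using \<rho> \<theta> unfolding c_def by (intro powr_mono2 mult_right_mono) auto
        qed (use K0 in auto)
        also have "\<dots> = C * \<rho> powr \<theta>" by (simp add: C_def powr_mult)
        finally have "K0 * exp (exponent n) * q n powr (- 2 * \<theta>) * (real (card D) / ?N) \<le> C * \<rho> powr \<theta>" .
        moreover have "A (Suc n) \<inter> D = D" using DA by auto
        ultimately show ?thesis using meas[of n D] True by (simp add: order_trans ennreal_leI)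
      qed
      then show ?thesis using mem cylinder_sets by blast
    qed
  qed
qed

end

section \<open>Prescribed digits along a sparse sequence\<close>

lemma sum_le_sum_plus_const:
  fixes g h :: "nat \<Rightarrow> real"
  assumes "\<forall>\<^sub>F j in sequentially. g j \<le> h j"
  shows "\<exists>c. \<forall>k. sum g {1..<k} \<le> sum h {1..<k} + c"
proof -
  obtain J where J: "\<And>j. J \<le> j \<Longrightarrow> g j \<le> h j" using assms unfolding eventually_sequentially by blast
  have "sum g {1..<k} \<le> sum h {1..<k} + (\<Sum>j<J. \<bar>g j - h j\<bar>)" for k
  proof -
    have "(\<Sum>j\<in>{1..<k}. g j - h j) \<le> (\<Sum>j\<in>{1..<k} \<inter> {..<J}. g j - h j) + (\<Sum>j\<in>{1..<k} - {..<J}. g j - h j)"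
      using sum.union_disjoint[of "{1..<k} \<inter> {..<J}" "{1..<k} - {..<J}" "\<lambda>j. g j - h j"]
      by (simp add: Int_Diff_Un Int_Diff_disjoint)
    also have "(\<Sum>j\<in>{1..<k} - {..<J}. g j - h j) \<le> 0" using J by (intro sum_nonpos) auto
    also have "(\<Sum>j\<in>{1..<k} \<inter> {..<J}. g j - h j) \<le> (\<Sum>j\<in>{1..<k} \<inter> {..<J}. \<bar>g j - h j\<bar>)"
      by (intro sum_mono) auto
    also have "\<dots> \<le> (\<Sum>j<J. \<bar>g j - h j\<bar>)" by (intro sum_mono2) auto
    finally show ?thesis by (simp add: sum_subtractf)
  qed
  then show ?thesis by blast
qed

lemma filterlim_add_const_at_bot:
  assumes "filterlim f at_bot F" shows "filterlim (\<lambda>x. (c::real) + f x) at_bot F"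
  unfolding filterlim_at_bot
proof
  fix Z
  have "\<forall>\<^sub>F x in F. f x \<le> Z - c" using assms by (simp add: filterlim_at_bot)
  then show "\<forall>\<^sub>F x in F. c + f x \<le> Z" by eventually_elim simp
qed

lemma eventually_bounded_above:
  fixes f :: "nat \<Rightarrow> real"
  assumes "\<forall>\<^sub>F m in sequentially. f m \<le> B"
  shows "\<exists>B. \<forall>m. f m \<le> B"
proof -
  obtain N where N: "\<And>m. N \<le> m \<Longrightarrow> f m \<le> B" using assms unfolding eventually_sequentially by blast
  have "f m \<le> max B (Max (f ` {..N}))" for m
    using N[of m] by (cases "N \<le> m") (auto simp: le_max_iff_disj)
  then show ?thesis by blast
qed

text \<open>First \<open>l\<close>, then \<open>M\<close>. The loss \<open>d\<close> consists of
  \<theta> ln 4 for comparing \<open>Zsum\<close> with the pressure, \<theta> ln 4 for the divisor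
  \<open>4 powr \<theta>\<close>, and ln 2 for truncating the alphabet at half the sum; dividing by
  a large \<open>l\<close> makes it smaller than \<open>e\<close>.\<close>

lemma exists_good_blocks:
  assumes "1 / 2 < \<theta>" "0 < e"
  shows "\<exists>M\<ge>1. \<exists>l\<ge>1. pressure \<theta> - e
    \<le> ln ((\<Sum>w\<in>words (\<lambda>_. {1..M}) l. cf_den w 0 powr (- 2 * \<theta>)) / 4 powr \<theta>) / real l"
proof -
  define d where "d = 2 * \<theta> * ln 4 + ln 2"
  have "\<forall>\<^sub>F l in sequentially. d / real l < e"
    using assms order_tendstoD(2)[OF lim_const_over_n[of d], of e] by simp
  then have "\<forall>\<^sub>F l in sequentially. d / real l < e \<and> 1 \<le> l"
    by (intro eventually_conj eventually_ge_at_top)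
  then obtain l where l: "d / real l < e" "1 \<le> l" unfolding eventually_sequentially by blast
  have pos: "0 < Zsum \<theta> l" using assms by (intro Zsum_pos)
  have "ennreal (Zsum \<theta> l / 2) < ennreal (Zsum \<theta> l)" using pos by (simp add: ennreal_less_iff)
  then have "ennreal (Zsum \<theta> l / 2) < zsum {1..} \<theta> l" by (simp only: ennreal_Zsum[OF assms(1)])
  from zsum_truncate[OF this] obtain M where M: "1 \<le> M" "ennreal (Zsum \<theta> l / 2) < zsum {1..M} \<theta> l" by blast
  define Z where "Z = (\<Sum>w\<in>words (\<lambda>_. {1..M}) l. cf_den w 0 powr (- 2 * \<theta>))"
  have "ennreal (Zsum \<theta> l / 2) < ennreal Z" using M(2) by (simp add: zsum_finite_alphabet Z_def)
  then have Z: "Zsum \<theta> l / 2 < Z" using pos by (simp add: ennreal_less_iff)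
  then have "ln (Zsum \<theta> l / 2) \<le> ln Z" using pos by (subst ln_le_cancel_iff) auto
  then have "ln (Zsum \<theta> l) - ln 2 \<le> ln Z" using pos by (simp add: ln_div)
  moreover have "real l * pressure \<theta> - \<theta> * ln 4 \<le> ln (Zsum \<theta> l)"
    using ln_Zsum_pressure[OF assms(1), of l] by (simp add: abs_le_iff)
  moreover have "ln (Z / 4 powr \<theta>) = ln Z - \<theta> * ln 4"
    using Z pos by (simp add: ln_div)
  ultimately have "real l * pressure \<theta> - d \<le> ln (Z / 4 powr \<theta>)" by (simp add: d_def)
  then have "(real l * pressure \<theta> - d) / real l \<le> ln (Z / 4 powr \<theta>) / real l"
    by (intro divide_right_mono) auto
  then have "pressure \<theta> - d / real l \<le> ln (Z / 4 powr \<theta>) / real l"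
    using l(2) by (simp add: diff_divide_distrib)
  then show ?thesis using l M(1) unfolding Z_def by (intro exI[of _ M] conjI exI[of _ l]) auto
qed

text \<open>A crude count of words that holds also for r \<le> 1/2. Its rate ln M is harmless when
  \<open>n k\<close> is negligible against the sum of the \<open>ln (s j)\<close>.\<close>

lemma zsum_bounded_alphabet:
  assumes "1 \<le> M" "0 \<le> r"
  shows "zsum {1..M} r m \<le> ennreal (1 * exp (ln (real M) * real m))"
proof -
  have "(\<Sum>w\<in>words (\<lambda>_. {1..M}) m. cf_den w 0 powr (- 2 * r)) \<le> (\<Sum>w\<in>words (\<lambda>_. {1..M}) m. 1)"
  proof (rule sum_mono)
    fix w assume "w \<in> words (\<lambda>_. {1..M}) m"
    then have "1 \<le> cf_den w 0" using words_pos[of w "\<lambda>_. {1..M}"] by (intro cf_den_ge_1) auto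
    then have "cf_den w 0 powr (- 2 * r) \<le> cf_den w 0 powr 0" using assms by (intro powr_mono) auto
    then show "cf_den w 0 powr (- 2 * r) \<le> 1" using \<open>1 \<le> cf_den w 0\<close> by simp
  qed
  also have "\<dots> = real M ^ m"
    using card_lists_length_eq[of "{1..M}" m] by (simp add: words_const conj_commute)
  also have "\<dots> = exp (ln (real M) * real m)"
    using assms by (simp add: mult.commute exp_of_nat_mult)
  finally show ?thesis by (simp add: zsum_finite_alphabet ennreal_leI)
qed

text \<open>The limits \<alpha> and \<beta> are left to the individual lemmas, because the three
  cases use them in different forms.\<close>

locale digit_constraints =
  fixes n :: "nat \<Rightarrow> nat" and s t :: "nat \<Rightarrow> real"
  assumes n_mono: "strict_mono_on {1..} n" and n_ge1: "\<And>k. 1 \<le> k \<Longrightarrow> 1 \<le> n k"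
    and s_pos: "\<And>k. 1 \<le> k \<Longrightarrow> 0 < s k" and t_pos: "\<And>k. 1 \<le> k \<Longrightarrow> 0 < t k"
    and s_top: "filterlim s at_top sequentially" and t_top: "filterlim t at_top sequentially"
    and n_sparse: "filterlim (\<lambda>k. real (n k) / real k) at_top sequentially"
    and ln_ratio: "(\<lambda>k. ln (s k) / ln (t k)) \<longlonglongrightarrow> 1"
begin

definition "S k = (\<Sum>j=1..k. ln (s j))"

lemma S_Suc: "S (Suc k) = S k + ln (s (Suc k))"
  by (simp add: S_def)

lemma n_less_iff: "1 \<le> i \<Longrightarrow> 1 \<le> j \<Longrightarrow> n i < n j \<longleftrightarrow> i < j"
  using strict_mono_on_less[OF n_mono, of i j] by simp

lemma n_inj: "inj_on n {1..}"
  using n_mono by (rule strict_mono_on_imp_inj_on)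

lemma n_ge: "1 \<le> k \<Longrightarrow> k \<le> n k"
proof (induction k rule: dec_induct)
  case base
  then show ?case using n_ge1[of 1] by simp
next
  case (step k)
  then show ?case using n_less_iff[of k "Suc k"] by simp
qed

lemma n_top: "filterlim (\<lambda>k. real (n k)) at_top sequentially"
proof (rule filterlim_at_top_mono[OF filterlim_real_sequentially])
  show "\<forall>\<^sub>F k in sequentially. real k \<le> real (n k)"
    using n_ge by (intro eventually_sequentiallyI[of 1]) simp
qed

lemma ln_s_top: "filterlim (\<lambda>k. ln (s k)) at_top sequentially"
  by (rule filterlim_compose[OF ln_at_top s_top])

lemma k_over_n: "(\<lambda>k. real k / real (n k)) \<longlonglongrightarrow> 0"
proof -
  have "(\<lambda>k. inverse (real (n k) / real k)) \<longlonglongrightarrow> 0"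
    by (rule filterlim_compose[OF tendsto_inverse_0_at_top[OF filterlim_ident] n_sparse])
  then show ?thesis by simp
qed

lemma const_over_n: "(\<lambda>k. c / real (n k)) \<longlonglongrightarrow> 0"
  by (rule real_tendsto_divide_at_top[OF tendsto_const n_top])

lemma S_top: "filterlim S at_top sequentially"
proof -
  have "\<forall>\<^sub>F j in sequentially. 1 \<le> ln (s j)" using ln_s_top by (simp add: filterlim_at_top)
  then obtain c where c: "\<And>k. (\<Sum>j\<in>{1..<k}. 1) \<le> (\<Sum>j\<in>{1..<k}. ln (s j)) + c"
    using sum_le_sum_plus_const[of "\<lambda>_. 1" "\<lambda>j. ln (s j)"] by blast
  have le: "- c + real k \<le> S k" for k
  proof -
    have "{1..<Suc k} = {1..k}" by auto
    then show ?thesis using c[of "Suc k"] by (simp add: S_def)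
  qed
  have "filterlim (\<lambda>k. - c + real k) at_top sequentially"
    by (rule filterlim_tendsto_add_at_top[OF tendsto_const filterlim_real_sequentially])
  then show ?thesis by (rule filterlim_at_top_mono) (rule always_eventually, rule allI, rule le)
qed

lemma sum_less_eq_S: "1 \<le> k \<Longrightarrow> (\<Sum>j\<in>{1..<k}. ln (s j)) = S k - ln (s k)"
proof -
  assume "1 \<le> k"
  then have "{1..k} = insert k {1..<k}" by auto
  then show ?thesis by (simp add: S_def)
qed

lemma ln_t_upper:
  assumes "0 < e"
  shows "\<forall>\<^sub>F k in sequentially. ln (t k + 1) \<le> (1 + e) * ln (s k)"
proof -
  have "1 / (1 + e / 2) < 1" using assms by simp
  then have "\<forall>\<^sub>F k in sequentially. 1 / (1 + e / 2) < ln (s k) / ln (t k)"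
    using ln_ratio by (intro order_tendstoD)
  moreover have "\<forall>\<^sub>F k in sequentially. 2 \<le> t k" using t_top by (simp add: filterlim_at_top)
  moreover have "\<forall>\<^sub>F k in sequentially. 2 * ln 2 / e \<le> ln (s k)" using ln_s_top by (simp add: filterlim_at_top)
  ultimately show ?thesis
  proof eventually_elim
    case (elim k)
    have t: "0 < ln (t k)" using elim(2) by simp
    have "ln (t k) \<le> (1 + e / 2) * ln (s k)" using elim(1) t assms by (simp add: field_simps)
    moreover have "ln 2 \<le> e / 2 * ln (s k)" using elim(3) assms by (simp add: field_simps)
    moreover have "ln (t k + 1) \<le> ln (2 * t k)" using elim(2) by simp
    moreover have "ln (2 * t k) = ln 2 + ln (t k)" using elim(2) by (simp add: ln_mult)
    ultimately show ?case by (simp add: algebra_simps)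
  qed
qed

text \<open>Cutting \<open>t k\<close> down to \<open>s k\<close> keeps the digits comparable to \<open>s k\<close> and does not affect
  \<open>ln (card (window k)) / ln (s k) \<longrightarrow> 1\<close>.\<close>

definition "window k = {a::nat. s k < real a \<and> real a \<le> s k + min (t k) (s k)}"

lemma window:
  assumes "1 \<le> k"
  shows "finite (window k)" and "a \<in> window k \<Longrightarrow> s k \<le> real a \<and> real a \<le> 2 * s k"
    and "a \<in> window k \<Longrightarrow> s k < real a \<and> real a \<le> s k + t k"
    and "min (t k) (s k) - 1 \<le> real (card (window k))"
proof -
  have p: "0 \<le> s k" "0 \<le> min (t k) (s k)" using s_pos[OF assms] t_pos[OF assms] by auto
  show "finite (window k)" unfolding window_def using p by (rule finite_nat_interval)
  show "min (t k) (s k) - 1 \<le> real (card (window k))"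
    unfolding window_def using p by (rule card_nat_interval_ge)
qed (auto simp: window_def)

lemma ln_card_window:
  assumes "0 < e"
  shows "\<forall>\<^sub>F k in sequentially. 2 \<le> s k \<and> 1 \<le> real (card (window k)) \<and> (1 - e) * ln (s k) \<le> ln (real (card (window k)))"
proof -
  \<comment> \<open>Half of \<open>e\<close> pays for the ratio of \<open>ln (s k)\<close> and
    \<open>ln (t k)\<close>, the other half for the factor 2 lost when
    \<open>min (t k) (s k) - 1\<close> is bounded below by half the minimum.\<close>
  define d where "d = min (e / 2) (1 / 2)"
  have d: "0 < d" "d \<le> e / 2" "d \<le> 1 / 2" using assms by (auto simp: d_def)
  have "1 < 1 / (1 - d)" using d by (simp add: field_simps)
  then have "\<forall>\<^sub>F k in sequentially. ln (s k) / ln (t k) < 1 / (1 - d)"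
    using ln_ratio by (intro order_tendstoD)
  moreover have "\<forall>\<^sub>F k in sequentially. 2 \<le> t k" using t_top by (simp add: filterlim_at_top)
  moreover have "\<forall>\<^sub>F k in sequentially. 2 \<le> s k" using s_top by (simp add: filterlim_at_top)
  moreover have "\<forall>\<^sub>F k in sequentially. 2 * ln 2 / e \<le> ln (s k)" using ln_s_top by (simp add: filterlim_at_top)
  moreover have "\<forall>\<^sub>F k in sequentially. 1 \<le> k" by (rule eventually_ge_at_top)
  ultimately show ?thesis
  proof eventually_elim
    case (elim k)
    have t: "0 < ln (t k)" and s: "0 < ln (s k)" using elim(2,3) by auto
    have "(1 - d) * ln (s k) \<le> ln (t k)" using elim(1) t d by (simp add: field_simps)
    moreover have "(1 - d) * ln (s k) \<le> ln (s k)" using s d by (simp add: mult_left_le_one_le)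
    ultimately have 1: "(1 - d) * ln (s k) \<le> ln (min (t k) (s k))" by (simp add: min_def)
    have c: "min (t k) (s k) / 2 \<le> real (card (window k))"
      using window(4)[OF elim(5)] elim(2,3) by linarith
    have m: "2 \<le> min (t k) (s k)" using elim(2,3) by simp
    then have "ln (min (t k) (s k) / 2) \<le> ln (real (card (window k)))" using c by (subst ln_le_cancel_iff) auto
    then have "ln (min (t k) (s k)) - ln 2 \<le> ln (real (card (window k)))" using m by (simp add: ln_div)
    moreover have "ln 2 \<le> e / 2 * ln (s k)" using elim(4) assms by (simp add: field_simps)
    moreover have "d * ln (s k) \<le> e / 2 * ln (s k)" using d s by (intro mult_right_mono) auto
    ultimately have "(1 - e) * ln (s k) \<le> ln (real (card (window k)))" using 1 by (simp add: algebra_simps)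
    then show ?case using c m elim(3) by auto
  qed
qed

subsection \<open>Upper bounds\<close>

text \<open>Replaces the covering exponent by a linear expression in \<open>S k\<close>,
  \<open>ln (s k)\<close>, \<open>n k\<close> and \<open>k\<close>: \<open>t j + 1\<close> becomes a
  power of \<open>s j\<close> with exponent 1 + e, the halving of \<open>s j\<close> adds up to a
  multiple of \<open>k\<close>, and finitely many early terms go into \<open>c\<close>.\<close>

lemma exponent_upper:
  assumes r: "0 < r" and e: "0 < e"
  shows "\<exists>c. \<forall>\<^sub>F k in sequentially.
    \<kappa> * (real (n k) - real k) + (\<Sum>j\<in>{1..<k}. ln (t j + 1) - 2 * r * ln (s j / 2)) - r * ln (s k)
    \<le> (1 + e - 2 * r) * (S k - ln (s k)) - r * ln (s k) + \<kappa> * real (n k) + (2 * r * ln 2 - \<kappa>) * real k + c"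
proof -
  have "\<forall>\<^sub>F j in sequentially. ln (t j + 1) - 2 * r * ln (s j / 2) \<le> (1 + e - 2 * r) * ln (s j) + 2 * r * ln 2"
    using ln_t_upper[OF e] eventually_ge_at_top[of 1]
  proof eventually_elim
    case (elim j)
    have "ln (s j / 2) = ln (s j) - ln 2" using s_pos[OF elim(2)] by (simp add: ln_div)
    then have "2 * r * ln (s j / 2) = 2 * r * ln (s j) - 2 * r * ln 2" by (simp add: right_diff_distrib)
    then show ?case using elim(1) by (simp add: distrib_right left_diff_distrib)
  qed
  from sum_le_sum_plus_const[OF this] obtain c where c: "\<And>k. (\<Sum>j\<in>{1..<k}. ln (t j + 1) - 2 * r * ln (s j / 2))
      \<le> (\<Sum>j\<in>{1..<k}. (1 + e - 2 * r) * ln (s j) + 2 * r * ln 2) + c" by blast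
  have "\<kappa> * (real (n k) - real k) + (\<Sum>j\<in>{1..<k}. ln (t j + 1) - 2 * r * ln (s j / 2)) - r * ln (s k)
    \<le> (1 + e - 2 * r) * (S k - ln (s k)) - r * ln (s k) + \<kappa> * real (n k) + (2 * r * ln 2 - \<kappa>) * real k + c"
    if k: "1 \<le> k" for k
  proof -
    have "(\<Sum>j\<in>{1..<k}. (1 + e - 2 * r) * ln (s j) + 2 * r * ln 2)
        = (1 + e - 2 * r) * (\<Sum>j\<in>{1..<k}. ln (s j)) + real (k - 1) * (2 * r * ln 2)"
      by (simp add: sum.distrib sum_distrib_left)
    moreover have "real (k - 1) * (2 * r * ln 2) \<le> real k * (2 * r * ln 2)" using r by (intro mult_right_mono) auto
    ultimately have "(\<Sum>j\<in>{1..<k}. ln (t j + 1) - 2 * r * ln (s j / 2))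
        \<le> (1 + e - 2 * r) * (S k - ln (s k)) + real k * (2 * r * ln 2) + c"
      using c[of k] sum_less_eq_S[OF k] by simp
    moreover have "\<kappa> * (real (n k) - real k) = \<kappa> * real (n k) - \<kappa> * real k" "(2 * r * ln 2 - \<kappa>) * real k = real k * (2 * r * ln 2) - \<kappa> * real k"
      by (simp_all add: algebra_simps)
    ultimately show ?thesis by linarith
  qed
  then show ?thesis by (intro exI[of _ c] eventually_sequentiallyI[of 1]) blast
qed

lemma E_L_digits: "E_L n s t = {x \<in> irr_unit. \<forall>\<^sub>F k in sequentially.
    s k < real (digits x (n k)) \<and> real (digits x (n k)) \<le> s k + t k}"
  by (simp add: E_L_def digits_def)

lemma E_S_digits: "E_S n = {x \<in> irr_unit. bdd_above (digits x ` ({1..} - n ` {1..}))}"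
  by (simp add: E_S_def digits_def)

lemma frequently_le_at_bot:
  assumes "\<forall>\<^sub>F k in sequentially. f k \<le> g k" "filterlim g at_bot sequentially"
  shows "\<exists>\<^sub>F k in sequentially. f k \<le> (B::real)"
proof -
  have "\<forall>\<^sub>F k in sequentially. g k \<le> B" using assms(2) by (simp add: filterlim_at_bot)
  with assms(1) have "\<forall>\<^sub>F k in sequentially. f k \<le> B" by eventually_elim simp
  then show ?thesis by (rule eventually_frequently[rotated]) simp
qed

lemma null_E_L:
  assumes r: "1 / 2 < r"
    and small: "\<And>B. \<exists>\<^sub>F k in sequentially. pressure r * (real (n k) - real k) +
      (\<Sum>j\<in>{1..<k}. ln (t j + 1) - 2 * r * ln (s j / 2)) - r * ln (s k) \<le> B"
  shows "hausdorff_measure r (E_L n s t) = 0"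
proof -
  have "E_L n s t = {x \<in> irr_unit. (\<forall>j\<ge>1. j \<notin> n ` {1..} \<longrightarrow> digits x j \<in> {1..}) \<and>
      (\<forall>\<^sub>F k in sequentially. s k < real (digits x (n k)) \<and> real (digits x (n k)) \<le> s k + t k)}"
    unfolding E_L_digits using digits_pos_seq by (auto simp: pos_seq_def)
  moreover have "hausdorff_measure r \<dots> = 0"
  proof (rule hausdorff_null_forced_digits[OF n_mono n_ge1 s_pos t_pos s_top _ _ _ _ small])
    show "zsum {1..} r m \<le> ennreal (4 powr r * exp (pressure r * real m))" for m
      by (rule zsum_le_pressure[OF r])
  qed (use r in auto)
  ultimately show ?thesis by simp
qed

text \<open>Divided by \<open>n k\<close>, the exponent tends to P(r) + (1 + e - 2r)(a - b) - r b,
  since k/n_k tends to 0. The assumption on \<open>r\<close> says that this is negative at e = 0,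
  hence for small e.\<close>

lemma null_E_L_finite:
  assumes a: "(\<lambda>k. S k / real (n k)) \<longlonglongrightarrow> a" and b: "(\<lambda>k. ln (s k) / real (n k)) \<longlonglongrightarrow> b"
    and r: "1 / 2 < r" "pressure r < (2 * a - b) * r - (a - b)"
  shows "hausdorff_measure r (E_L n s t) = 0"
proof (rule null_E_L[OF r(1)])
  have "((\<lambda>e. pressure r + (1 + e - 2 * r) * (a - b) - r * b) \<longlongrightarrow> pressure r + (1 + 0 - 2 * r) * (a - b) - r * b) (at_right 0)"
    by (intro tendsto_intros)
  moreover have "pressure r + (1 + 0 - 2 * r) * (a - b) - r * b < 0" using r(2) by (simp add: algebra_simps)
  ultimately have "\<forall>\<^sub>F e in at_right 0. pressure r + (1 + e - 2 * r) * (a - b) - r * b < 0"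
    by (rule order_tendstoD)
  moreover have "\<forall>\<^sub>F e in at_right (0::real). 0 < e" by (rule eventually_at_right_less)
  ultimately have "\<forall>\<^sub>F e in at_right 0. pressure r + (1 + e - 2 * r) * (a - b) - r * b < 0 \<and> 0 < e"
    by (rule eventually_conj)
  then obtain e where e: "pressure r + (1 + e - 2 * r) * (a - b) - r * b < 0" "0 < e"
    using eventually_happens[of _ "at_right (0::real)"] by auto
  define \<kappa> where "\<kappa> = pressure r"
  obtain c where c: "\<forall>\<^sub>F k in sequentially.
    \<kappa> * (real (n k) - real k) + (\<Sum>j\<in>{1..<k}. ln (t j + 1) - 2 * r * ln (s j / 2)) - r * ln (s k)
    \<le> (1 + e - 2 * r) * (S k - ln (s k)) - r * ln (s k) + \<kappa> * real (n k) + (2 * r * ln 2 - \<kappa>) * real k + c"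
    using exponent_upper[of r e \<kappa>] r e(2) by auto
  let ?f = "\<lambda>k. (1 + e - 2 * r) * (S k / real (n k) - ln (s k) / real (n k)) - r * (ln (s k) / real (n k)) + \<kappa>
      + (2 * r * ln 2 - \<kappa>) * (real k / real (n k)) + c / real (n k)"
  have "?f \<longlonglongrightarrow> (1 + e - 2 * r) * (a - b) - r * b + \<kappa> + (2 * r * ln 2 - \<kappa>) * 0 + 0"
    by (intro tendsto_intros a b k_over_n const_over_n)
  then have lim: "?f \<longlonglongrightarrow> pressure r + (1 + e - 2 * r) * (a - b) - r * b" by (simp add: \<kappa>_def algebra_simps)
  have "filterlim (\<lambda>k. ?f k * real (n k)) at_bot sequentially"
    by (rule filterlim_tendsto_neg_mult_at_bot[OF lim e(1) n_top])
  moreover have "\<forall>\<^sub>F k in sequentially. \<kappa> * (real (n k) - real k) + (\<Sum>j\<in>{1..<k}. ln (t j + 1) - 2 * r * ln (s j / 2)) - r * ln (s k)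
      \<le> ?f k * real (n k)"
    using c eventually_ge_at_top[of 1]
  proof eventually_elim
    case (elim k)
    have n0: "real (n k) \<noteq> 0" using n_ge1[OF elim(2)] by simp
    have "?f k * real (n k) = (1 + e - 2 * r) * (S k - ln (s k)) - r * ln (s k) + \<kappa> * real (n k) + (2 * r * ln 2 - \<kappa>) * real k + c"
      using n0 by (simp add: field_simps)
    then show ?case using elim(1) by simp
  qed
  ultimately show "\<exists>\<^sub>F k in sequentially. pressure r * (real (n k) - real k) +
      (\<Sum>j\<in>{1..<k}. ln (t j + 1) - 2 * r * ln (s j / 2)) - r * ln (s k) \<le> B" for B
    unfolding \<kappa>_def by (intro frequently_le_at_bot)
qed

lemma n_small_S:
  assumes inf: "filterlim (\<lambda>k. S k / real (n k)) at_top sequentially" and "0 < e"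
  shows "\<forall>\<^sub>F k in sequentially. real (n k) \<le> e * S k"
proof -
  have "\<forall>\<^sub>F k in sequentially. 1 / e \<le> S k / real (n k)" using inf by (simp add: filterlim_at_top)
  then show ?thesis
    using eventually_ge_at_top[of 1]
  proof eventually_elim
    case (elim k)
    have "0 < real (n k)" using n_ge1[OF elim(2)] by simp
    then show ?case using elim(1) assms(2) by (simp add: field_simps)
  qed
qed

text \<open>Now \<open>n k\<close> is negligible against \<open>S k\<close>, so for r > 1/2 any
  value of the pressure is absorbed. With e = (2r - 1)/2 the coefficient 1 + e - 2r equals -e, and
  the exponent is at most about - min e r times \<open>S k\<close>.\<close>

lemma null_E_L_infinite:
  assumes inf: "filterlim (\<lambda>k. S k / real (n k)) at_top sequentially" and r: "1 / 2 < r"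
  shows "hausdorff_measure r (E_L n s t) = 0"
proof (rule null_E_L[OF r])
  define e where "e = (2 * r - 1) / 2"
  define \<kappa> where "\<kappa> = pressure r"
  have e: "0 < e" using r by (simp add: e_def)
  define K where "K = \<bar>\<kappa>\<bar> + \<bar>2 * r * ln 2 - \<kappa>\<bar>"
  have K: "0 \<le> K" by (simp add: K_def)
  define c0 where "c0 = min e r"
  have c0: "0 < c0" using e r by (simp add: c0_def)
  obtain c where c: "\<forall>\<^sub>F k in sequentially.
    \<kappa> * (real (n k) - real k) + (\<Sum>j\<in>{1..<k}. ln (t j + 1) - 2 * r * ln (s j / 2)) - r * ln (s k)
    \<le> (1 + e - 2 * r) * (S k - ln (s k)) - r * ln (s k) + \<kappa> * real (n k) + (2 * r * ln 2 - \<kappa>) * real k + c"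
    using exponent_upper[of r e \<kappa>] r e by auto
  have small: "\<forall>\<^sub>F k in sequentially. real (n k) \<le> c0 / (2 * (K + 1)) * S k"
    using c0 K by (intro n_small_S[OF inf] divide_pos_pos) auto
  have Sp: "\<forall>\<^sub>F k in sequentially. 0 \<le> S (k - 1)"
  proof -
    have "\<forall>\<^sub>F k in sequentially. 0 \<le> S k" using S_top by (simp add: filterlim_at_top)
    then obtain N where "\<And>k. N \<le> k \<Longrightarrow> 0 \<le> S k" unfolding eventually_sequentially by blast
    then show ?thesis by (intro eventually_sequentiallyI[of "Suc N"]) auto
  qed
  have lp: "\<forall>\<^sub>F k in sequentially. 0 \<le> ln (s k)" using ln_s_top by (simp add: filterlim_at_top)
  have "filterlim (\<lambda>k. c + - (c0 / 2) * S k) at_bot sequentially"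
    using c0 by (intro filterlim_add_const_at_bot
      filterlim_tendsto_neg_mult_at_bot[OF tendsto_const _ S_top]) simp
  moreover have "\<forall>\<^sub>F k in sequentially. \<kappa> * (real (n k) - real k) + (\<Sum>j\<in>{1..<k}. ln (t j + 1) - 2 * r * ln (s j / 2)) - r * ln (s k)
      \<le> c + - (c0 / 2) * S k"
    using c small Sp lp eventually_ge_at_top[of 1]
  proof eventually_elim
    case (elim k)
    have "S (k - 1) = S k - ln (s k)" using S_Suc[of "k - 1"] elim(5) by simp
    then have p: "0 \<le> S k - ln (s k)" using elim(3) by simp
    have "(1 + e - 2 * r) * (S k - ln (s k)) = - e * (S k - ln (s k))" by (simp add: e_def field_simps)
    also have "\<dots> \<le> - c0 * (S k - ln (s k))" using p by (intro mult_right_mono) (auto simp: c0_def)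
    finally have 1: "(1 + e - 2 * r) * (S k - ln (s k)) \<le> - c0 * (S k - ln (s k))" .
    have 2: "- r * ln (s k) \<le> - c0 * ln (s k)" using elim(4) by (intro mult_right_mono) (auto simp: c0_def)
    have "\<kappa> * real (n k) \<le> \<bar>\<kappa>\<bar> * real (n k)" by (intro mult_right_mono) auto
    moreover have "(2 * r * ln 2 - \<kappa>) * real k \<le> \<bar>2 * r * ln 2 - \<kappa>\<bar> * real (n k)"
      using n_ge[OF elim(5)] by (intro mult_mono) auto
    ultimately have "\<kappa> * real (n k) + (2 * r * ln 2 - \<kappa>) * real k \<le> K * real (n k)" by (simp add: K_def distrib_right)
    also have "\<dots> \<le> (K + 1) * real (n k)" by (intro mult_right_mono) auto
    also have "\<dots> \<le> (K + 1) * (c0 / (2 * (K + 1)) * S k)" using elim(2) K by (intro mult_left_mono) auto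
    also have "\<dots> = c0 / 2 * S k" using K by (simp add: field_simps)
    finally show ?case using elim(1) 1 2 by (simp add: algebra_simps)
  qed
  ultimately show "\<exists>\<^sub>F k in sequentially. pressure r * (real (n k) - real k) +
      (\<Sum>j\<in>{1..<k}. ln (t j + 1) - 2 * r * ln (s j / 2)) - r * ln (s k) \<le> B" for B
    unfolding \<kappa>_def by (intro frequently_le_at_bot)
qed

text \<open>Splitting \<open>E_S\<close> by the bound \<open>M\<close> of the free digits makes
  their sums finite for every r > 0. At index k + 1 the exponent is about (1 - 2r) S_k - r ln
  s_(k+1), and for the infinitely many k with ln s_(k+1) > \<rho> S_k it is below (1 - r(2 +
  \<rho>)) S_k.\<close>

lemma null_E_infinite:
  assumes inf: "filterlim (\<lambda>k. S k / real (n k)) at_top sequentially"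
    and r: "0 < r" "1 < r * (2 + \<rho>)"
    and freq: "\<exists>\<^sub>F k in sequentially. \<rho> < ln (s (Suc k)) / S k"
  shows "hausdorff_measure r (E_S n \<inter> E_L n s t) = 0"
proof -
  define EM where "EM M = {x \<in> irr_unit. (\<forall>j\<ge>1. j \<notin> n ` {1..} \<longrightarrow> digits x j \<in> {1..M}) \<and>
      (\<forall>\<^sub>F k in sequentially. s k < real (digits x (n k)) \<and> real (digits x (n k)) \<le> s k + t k)}" for M
  have null: "hausdorff_measure r (EM M) = 0" if M: "1 \<le> M" for M
    unfolding EM_def
  proof (rule hausdorff_null_forced_digits[OF n_mono n_ge1 s_pos t_pos s_top r(1) _ _ zsum_bounded_alphabet[OF M]])
    fix B :: real
    define \<kappa> where "\<kappa> = ln (real M)"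
    have "((\<lambda>e. (1 + e - 2 * r + e) - (r - e) * \<rho>) \<longlongrightarrow> (1 + 0 - 2 * r + 0) - (r - 0) * \<rho>) (at_right 0)"
      by (intro tendsto_intros)
    moreover have "(1 + 0 - 2 * r + 0) - (r - 0) * \<rho> < 0" using r(2) by (simp add: algebra_simps)
    ultimately have "\<forall>\<^sub>F e in at_right 0. (1 + e - 2 * r + e) - (r - e) * \<rho> < 0" by (rule order_tendstoD)
    moreover have "\<forall>\<^sub>F e in at_right (0::real). e \<in> {0<..<r}" by (rule eventually_at_right_real[OF r(1)])
    ultimately have "\<forall>\<^sub>F e in at_right 0. (1 + e - 2 * r + e) - (r - e) * \<rho> < 0 \<and> e \<in> {0<..<r}"
      by (rule eventually_conj)
    then obtain e where e: "(1 + e - 2 * r + e) - (r - e) * \<rho> < 0" "0 < e" "e < r"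
      using eventually_happens[of _ "at_right (0::real)"] by auto
    define K where "K = \<bar>\<kappa>\<bar> + \<bar>2 * r * ln 2 - \<kappa>\<bar> + 1"
    have K: "0 < K" by (simp add: K_def add_nonneg_pos)
    obtain c where c: "\<forall>\<^sub>F k in sequentially.
      \<kappa> * (real (n k) - real k) + (\<Sum>j\<in>{1..<k}. ln (t j + 1) - 2 * r * ln (s j / 2)) - r * ln (s k)
      \<le> (1 + e - 2 * r) * (S k - ln (s k)) - r * ln (s k) + \<kappa> * real (n k) + (2 * r * ln 2 - \<kappa>) * real k + c"
      using exponent_upper[OF r(1) e(2), of \<kappa>] by blast
    have small: "\<forall>\<^sub>F k in sequentially. real (n k) \<le> e / K * S k"
      using e K by (intro n_small_S[OF inf]) simp
    have Sp: "\<forall>\<^sub>F k in sequentially. 0 < S k" using S_top by (simp add: filterlim_at_top_dense)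
    \<comment> \<open>The coefficient of \<open>S k\<close> after inserting n_(k+1) \<le> (e/K)(S_k
      + ln s_(k+1)): one e comes from comparing t with s, the other from the free letters, which
      also weaken r to r - e in front of ln s_(k+1).\<close>
    let ?D = "(1 + e - 2 * r + e) - (r - e) * \<rho>"
    have "filterlim (\<lambda>k. c + ?D * S k) at_bot sequentially"
      using e(1) by (intro filterlim_add_const_at_bot
        filterlim_tendsto_neg_mult_at_bot[OF tendsto_const _ S_top])
    then have bot: "\<forall>\<^sub>F k in sequentially. c + ?D * S k \<le> B" by (simp add: filterlim_at_bot)
    let ?\<Phi> = "\<lambda>k. \<kappa> * (real (n k) - real k) + (\<Sum>j\<in>{1..<k}. ln (t j + 1) - 2 * r * ln (s j / 2)) - r * ln (s k)"
    have "\<forall>\<^sub>F k in sequentially. ?\<Phi> (Suc k) \<le> (1 + e - 2 * r) * (S (Suc k) - ln (s (Suc k))) - r * ln (s (Suc k)) +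
        \<kappa> * real (n (Suc k)) + (2 * r * ln 2 - \<kappa>) * real (Suc k) + c"
      by (rule eventually_sequentially_Suc[THEN iffD2, OF c])
    moreover have "\<forall>\<^sub>F k in sequentially. real (n (Suc k)) \<le> e / K * S (Suc k)"
      by (rule eventually_sequentially_Suc[THEN iffD2, OF small])
    ultimately have "\<forall>\<^sub>F k in sequentially. \<rho> < ln (s (Suc k)) / S k \<longrightarrow> ?\<Phi> (Suc k) \<le> B"
      using Sp bot
    proof eventually_elim
      case (elim k)
      show ?case
      proof
        assume "\<rho> < ln (s (Suc k)) / S k"
        then have \<rho>: "\<rho> * S k \<le> ln (s (Suc k))" using elim(3) by (simp add: pos_less_divide_eq)
        have "\<kappa> * real (n (Suc k)) \<le> \<bar>\<kappa>\<bar> * real (n (Suc k))" by (intro mult_right_mono) auto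
        moreover have "(2 * r * ln 2 - \<kappa>) * real (Suc k) \<le> \<bar>2 * r * ln 2 - \<kappa>\<bar> * real (n (Suc k))"
          using n_ge[of "Suc k"] by (intro mult_mono) auto
        ultimately have "\<kappa> * real (n (Suc k)) + (2 * r * ln 2 - \<kappa>) * real (Suc k) \<le> K * real (n (Suc k))"
          unfolding K_def distrib_right by linarith
        also have "\<dots> \<le> K * (e / K * S (Suc k))" using elim(2) K by (intro mult_left_mono) auto
        also have "\<dots> = e * (S k + ln (s (Suc k)))" using K by (simp add: S_Suc)
        finally have *: "\<kappa> * real (n (Suc k)) + (2 * r * ln 2 - \<kappa>) * real (Suc k) \<le> e * (S k + ln (s (Suc k)))" .
        have "(r - e) * (\<rho> * S k) \<le> (r - e) * ln (s (Suc k))" using \<rho> e by (intro mult_left_mono) auto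
        moreover have "(1 + e - 2 * r) * (S (Suc k) - ln (s (Suc k))) = (1 + e - 2 * r) * S k" by (simp add: S_Suc)
        ultimately have "?\<Phi> (Suc k) \<le> c + ?D * S k" using elim(1) * by (simp add: algebra_simps)
        then show "?\<Phi> (Suc k) \<le> B" using elim(4) by linarith
      qed
    qed
    then have "\<exists>\<^sub>F k in sequentially. ?\<Phi> (Suc k) \<le> B"
      using freq by (rule frequently_mp)
    then show "\<exists>\<^sub>F k in sequentially. ln (real M) * (real (n k) - real k) +
        (\<Sum>j\<in>{1..<k}. ln (t j + 1) - 2 * r * ln (s j / 2)) - r * ln (s k) \<le> B"
      unfolding frequently_def \<kappa>_def[symmetric] using eventually_sequentially_Suc[of "\<lambda>k. \<not> ?\<Phi> k \<le> B"] by simp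
  qed (use r in auto)
  have "E_S n \<inter> E_L n s t \<subseteq> (\<Union>M\<in>{1..}. EM M)"
  proof
    fix x assume x: "x \<in> E_S n \<inter> E_L n s t"
    then obtain M where M: "\<And>j. j \<in> {1..} - n ` {1..} \<Longrightarrow> digits x j \<le> M"
      unfolding E_S_digits by (auto simp: bdd_above_def)
    have "1 \<le> digits x j" if "1 \<le> j" for j using x digits_pos_seq that by (auto simp: E_L_digits pos_seq_def)
    moreover have "digits x j \<le> max M 1" if "1 \<le> j" "j \<notin> n ` {1..}" for j using M[of j] that by auto
    ultimately have "x \<in> EM (max M 1)" using x by (auto simp: EM_def E_L_digits)
    then show "x \<in> (\<Union>M\<in>{1..}. EM M)" by (intro UN_I[of "max M 1"]) auto
  qed
  then have "hausdorff_measure r (E_S n \<inter> E_L n s t) \<le> hausdorff_measure r (\<Union>M\<in>{1..}. EM M)"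
    by (rule hausdorff_measure_subset)
  also have "\<dots> = 0" using null by (intro hausdorff_measure_null_UN) auto
  finally show ?thesis by simp
qed

lemma null_E_L_doubly_exponential:
  assumes b: "1 < b" and r: "0 < r" "1 < r * (b + 1)"
    and freq: "\<exists>\<^sub>F k in sequentially. b < exp (ln (ln (s k)) / real (n k))"
  shows "hausdorff_measure r (E_L n s t) = 0"
proof -
  have "E_L n s t \<subseteq> {x \<in> irr_unit. \<exists>\<^sub>F m in sequentially. exp (b ^ m) \<le> real (digits x m)}"
  proof
    fix x assume x: "x \<in> E_L n s t"
    have "\<forall>\<^sub>F k in sequentially. 1 < ln (s k)" using ln_s_top by (simp add: filterlim_at_top_dense)
    moreover have "\<forall>\<^sub>F k in sequentially. s k < real (digits x (n k)) \<and> real (digits x (n k)) \<le> s k + t k"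
      using x by (simp add: E_L_digits)
    ultimately have ev: "\<forall>\<^sub>F k in sequentially. 1 < ln (s k) \<and> s k < real (digits x (n k))"
      by eventually_elim simp
    have "\<exists>\<^sub>F m in sequentially. exp (b ^ m) \<le> real (digits x m)"
      unfolding frequently_sequentially
    proof
      fix N
      have "\<forall>\<^sub>F k in sequentially. (1 < ln (s k) \<and> s k < real (digits x (n k))) \<and> max N 1 \<le> k"
        using ev by (rule eventually_conj) (rule eventually_ge_at_top)
      with freq have "\<exists>\<^sub>F k in sequentially. b < exp (ln (ln (s k)) / real (n k)) \<and>
          (1 < ln (s k) \<and> s k < real (digits x (n k))) \<and> max N 1 \<le> k"
        by (rule frequently_eventually_frequently)
      then obtain k where k: "b < exp (ln (ln (s k)) / real (n k))" "1 < ln (s k)" "s k < real (digits x (n k))" "N \<le> k" "1 \<le> k"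
        using frequently_ex by fastforce
      have n1: "0 < real (n k)" using n_ge1[OF k(5)] by simp
      have "ln b < ln (ln (s k)) / real (n k)" using k(1) b by (subst exp_less_cancel_iff[symmetric]) simp
      then have "real (n k) * ln b < ln (ln (s k))" using n1 by (simp add: pos_less_divide_eq mult.commute)
      then have "exp (real (n k) * ln b) < exp (ln (ln (s k)))" by simp
      then have "b ^ n k < ln (s k)" using b k(2) by (simp add: exp_of_nat_mult)
      then have "exp (b ^ n k) < exp (ln (s k))" by simp
      also have "exp (ln (s k)) = s k" using s_pos[OF k(5)] by simp
      finally have "exp (b ^ n k) \<le> real (digits x (n k))" using k(3) by linarith
      moreover have "N \<le> n k" using n_ge[OF k(5)] k(4) by linarith
      ultimately show "\<exists>m\<ge>N. exp (b ^ m) \<le> real (digits x m)" by blast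
    qed
    then show "x \<in> {x \<in> irr_unit. \<exists>\<^sub>F m in sequentially. exp (b ^ m) \<le> real (digits x m)}"
      using x by (simp add: E_L_digits)
  qed
  then have "hausdorff_measure r (E_L n s t) \<le> hausdorff_measure r {x \<in> irr_unit. \<exists>\<^sub>F m in sequentially. exp (b ^ m) \<le> real (digits x m)}"
    by (rule hausdorff_measure_subset)
  then show ?thesis using hausdorff_null_doubly_exponential[OF b r] by simp
qed

subsection \<open>Lower bounds\<close>

lemma between_consecutive_n:
  assumes K: "1 \<le> K" and m: "n K \<le> m"
  obtains k where "K \<le> k" "n k \<le> m" "m < n (Suc k)"
proof -
  define k where "k = Max {k. K \<le> k \<and> n k \<le> m}"
  have fin: "finite {k. K \<le> k \<and> n k \<le> m}"
    by (rule finite_subset[of _ "{..m}"]) (use n_ge K in \<open>auto intro: order_trans\<close>)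
  have ne: "{k. K \<le> k \<and> n k \<le> m} \<noteq> {}" using m by auto
  have k: "K \<le> k" "n k \<le> m" using Max_in[OF fin ne] by (auto simp: k_def)
  have "m < n (Suc k)"
  proof (rule ccontr)
    assume "\<not> ?thesis"
    then have "Suc k \<in> {k. K \<le> k \<and> n k \<le> m}" using k by auto
    from Max_ge[OF fin this] show False by (simp add: k_def)
  qed
  then show ?thesis using that k by blast
qed

lemma forced_upto:
  assumes K: "1 \<le> K" "K \<le> k" and m: "n k \<le> m" "m < n (Suc k)"
  shows "n ` {K..} \<inter> {1..m} = n ` {K..k}"
proof -
  have 1: "i \<le> k" if i: "K \<le> i" "n i \<le> m" for i
  proof (rule ccontr)
    assume "\<not> ?thesis"
    then have "n (Suc k) \<le> n i" using n_less_iff[of "Suc k" i] K by (cases "i = Suc k") auto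
    then show False using i m by simp
  qed
  have 2: "n i \<le> m" if i: "K \<le> i" "i \<le> k" for i
  proof -
    have "n i \<le> n k" using n_less_iff[of i k] i K by (cases "i = k") auto
    then show ?thesis using m by simp
  qed
  have 3: "1 \<le> n i" if "K \<le> i" for i using n_ge1[of i] that K by simp
  show ?thesis
  proof
    show "n ` {K..} \<inter> {1..m} \<subseteq> n ` {K..k}"
    proof
      fix j assume "j \<in> n ` {K..} \<inter> {1..m}"
      then obtain i where i: "K \<le> i" "j = n i" "n i \<le> m" by auto
      then show "j \<in> n ` {K..k}" using 1[OF i(1,3)] by simp
    qed
    show "n ` {K..k} \<subseteq> n ` {K..} \<inter> {1..m}"
    proof
      fix j assume "j \<in> n ` {K..k}"
      then obtain i where i: "K \<le> i" "i \<le> k" "j = n i" by auto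
      then show "j \<in> n ` {K..} \<inter> {1..m}" using 2[OF i(1,2)] 3[OF i(1)] by simp
    qed
  qed
qed

text \<open>Positions \<open>n k\<close> with \<open>k < K\<close> are treated as free ones.\<close>

lemma dimension_E_ge:
  assumes \<theta>: "0 < \<theta>" "\<theta> \<le> 1" and M: "1 \<le> M" and l: "1 \<le> l" and e: "0 < e"
    and \<kappa>: "\<kappa> = ln ((\<Sum>w\<in>words (\<lambda>_. {1..M}) l. cf_den w 0 powr (- 2 * \<theta>)) / 4 powr \<theta>) / real l"
    and bound: "\<And>C. \<forall>\<^sub>F k in sequentially. \<forall>m. n k \<le> m \<and> m < n (Suc k) \<longrightarrow>
      (2 * \<theta> - 1 + e) * S k + 4 * real k + C - \<kappa> * (real m - real k) +
      (if Suc m = n (Suc k) then \<theta> * (1 + e) * ln (s (Suc k)) else 0) \<le> 0"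
  shows "ereal \<theta> \<le> hausdorff_dim (E_S n \<inter> E_L n s t)"
proof -
  obtain K0 where K0: "\<And>k. K0 \<le> k \<Longrightarrow> 2 \<le> s k \<and> 1 \<le> real (card (window k)) \<and> (1 - e) * ln (s k) \<le> ln (real (card (window k)))"
    using ln_card_window[OF e] unfolding eventually_sequentially by blast
  define K where "K = max K0 1"
  have K1: "1 \<le> K" by (simp add: K_def)
  have K: "2 \<le> s k" "1 \<le> real (card (window k))" "(1 - e) * ln (s k) \<le> ln (real (card (window k)))" if "K \<le> k" for k
    using K0[of k] that by (auto simp: K_def)
  define F where "F = n ` {K..}"
  define idx where "idx = inv_into {1..} n"
  have idx: "idx (n k) = k" if "K \<le> k" for k
    using inv_into_f_f[OF n_inj, of k] that K1 by (simp add: idx_def)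
  define A where "A j = window (idx j)" for j
  define u where "u j = s (idx j)" for j
  have Fn: "\<exists>k\<ge>K. j = n k" if "j \<in> F" for j using that by (auto simp: F_def)
  interpret C: cantor_set F A u M l \<theta>
  proof
    fix j assume "j \<in> F"
    then obtain k where k: "K \<le> k" "j = n k" using Fn by blast
    then have Au: "A j = window k" "u j = s k" using idx by (simp_all add: A_def u_def)
    have k1: "1 \<le> k" using k K1 by simp
    show "finite (A j)" unfolding Au by (rule window(1)[OF k1])
    show "A j \<noteq> {}" using K(2)[OF k(1)] unfolding Au by auto
    show "2 \<le> u j" using K(1)[OF k(1)] unfolding Au by simp
    show "u j \<le> real a \<and> real a \<le> 2 * u j" if "a \<in> A j" for a
      using window(2)[OF k1] that unfolding Au by blast
  qed (use M l \<theta> in auto)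
  have C\<kappa>: "C.\<kappa> = \<kappa>" unfolding C.\<kappa>_def C.Z_def C.blocks_def \<kappa> ..
  define ex where "ex m = C.exponent m + (if Suc m \<in> F then \<theta> * (2 * ln (u (Suc m)) - ln (real (card (A (Suc m))))) else 0)" for m
  \<comment> \<open>Collects the contribution of the indices below \<open>K\<close> and of counting
    \<open>k - K + 1\<close> prescribed positions as \<open>k\<close>; it depends on neither
    \<open>k\<close> nor \<open>m\<close>.\<close>
  define c where "c = - (2 * \<theta> - 1 + e) * S (K - 1) + \<bar>\<kappa>\<bar> * real K"
  have main: "ex m \<le> (2 * \<theta> - 1 + e) * S k + 4 * real k + c - \<kappa> * (real m - real k) +
      (if Suc m = n (Suc k) then \<theta> * (1 + e) * ln (s (Suc k)) else 0)"
    if k: "K \<le> k" and m: "n k \<le> m" "m < n (Suc k)" for k m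
  proof -
    have Fm: "F \<inter> {1..m} = n ` {K..k}" unfolding F_def by (rule forced_upto[OF K1 k m])
    have injK: "inj_on n {K..k}" using K1 by (intro inj_on_subset[OF n_inj]) auto
    have "(\<Sum>j\<in>F \<inter> {1..m}. 2 * \<theta> * ln (5 * u j) - ln (real (card (A j))))
        = (\<Sum>i\<in>{K..k}. 2 * \<theta> * ln (5 * s i) - ln (real (card (window i))))"
      unfolding Fm sum.reindex[OF injK] using idx by (intro sum.cong) (auto simp: u_def A_def)
    also have "\<dots> \<le> (\<Sum>i\<in>{K..k}. (2 * \<theta> - 1 + e) * ln (s i) + 4)"
    proof (rule sum_mono)
      fix i assume "i \<in> {K..k}"
      then have i: "2 \<le> s i" "(1 - e) * ln (s i) \<le> ln (real (card (window i)))" using K by auto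
      have l5: "ln (5 * s i) = ln 5 + ln (s i)" using i by (simp add: ln_mult)
      \<comment> \<open>Source of the constant 4 per prescribed digit: 2 \<theta> ln 5 is at most 4
        because \<theta> \<le> 1.\<close>
      have "ln (5::real) \<le> 2"
      proof -
        have "(1 + 1 / real 2 * 1) ^ 2 \<le> exp (1::real)" using exp_ge_one_plus_x_over_n_power_n[of 2 1] by simp
        then have "(9/4 :: real) * (9/4) \<le> exp 1 * exp 1" by (intro mult_mono) (auto simp: power2_eq_square)
        then have "5 \<le> exp (2::real)" by (simp add: exp_add[symmetric])
        then have "ln 5 \<le> ln (exp (2::real))" by (subst ln_le_cancel_iff) auto
        then show ?thesis by simp
      qed
      then have "2 * \<theta> * ln 5 \<le> 2 * 1 * 2" using \<theta> by (intro mult_mono) auto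
      then show "2 * \<theta> * ln (5 * s i) - ln (real (card (window i))) \<le> (2 * \<theta> - 1 + e) * ln (s i) + 4"
        using i(2) unfolding l5 by (simp add: algebra_simps)
    qed
    also have "\<dots> = (2 * \<theta> - 1 + e) * (\<Sum>i\<in>{K..k}. ln (s i)) + 4 * real (Suc k - K)"
      by (simp add: sum.distrib sum_distrib_left)
    also have "(\<Sum>i\<in>{K..k}. ln (s i)) = S k - S (K - 1)"
    proof -
      have "{1..k} = {1..K - 1} \<union> {K..k}" using K1 k by auto
      moreover have "{1..K - 1} \<inter> {K..k} = {}" using K1 by auto
      ultimately show ?thesis unfolding S_def by (simp add: sum.union_disjoint)
    qed
    finally have 1: "(\<Sum>j\<in>F \<inter> {1..m}. 2 * \<theta> * ln (5 * u j) - ln (real (card (A j))))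
        \<le> (2 * \<theta> - 1 + e) * S k - (2 * \<theta> - 1 + e) * S (K - 1) + 4 * real k"
      using K1 k by (simp add: right_diff_distrib of_nat_diff)
    have 2: "real (C.nfree m) = real m - (real (Suc k) - real K)"
    proof -
      have "{1..m} - F = {1..m} - F \<inter> {1..m}" by blast
      then have "C.nfree m = card {1..m} - card (F \<inter> {1..m})"
        unfolding C.nfree_def by (simp only: card_Diff_subset[OF finite_Int Int_lower2] finite_atLeastAtMost simp_thms)
      moreover have "card (F \<inter> {1..m}) = Suc k - K" unfolding Fm using card_image[OF injK] by simp
      moreover have "card (F \<inter> {1..m}) \<le> card {1..m}" by (rule card_mono) auto
      ultimately show ?thesis using k by (simp add: of_nat_diff)
    qed
    have "- \<kappa> * real (C.nfree m) = - \<kappa> * (real m - real k) + - \<kappa> * (real K - 1)"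
      unfolding 2 by (simp add: algebra_simps)
    also have "- \<kappa> * (real K - 1) \<le> \<bar>\<kappa>\<bar> * real K"
    proof -
      have "- \<kappa> * (real K - 1) \<le> \<bar>\<kappa>\<bar> * (real K - 1)" using K1 by (intro mult_right_mono) auto
      also have "\<dots> \<le> \<bar>\<kappa>\<bar> * real K" by (intro mult_left_mono) auto
      finally show ?thesis .
    qed
    finally have 3: "C.exponent m \<le> (2 * \<theta> - 1 + e) * S k + 4 * real k + c - \<kappa> * (real m - real k)"
      using 1 unfolding C.exponent_def C\<kappa> c_def by (simp only: minus_mult_left[symmetric]) linarith
    \<comment> \<open>As \<open>m\<close> lies between \<open>n k\<close> and
      \<open>n (Suc k)\<close>, the position m + 1 can be prescribed only if it is
      \<open>n (Suc k)\<close>.\<close>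
    have 4: "(if Suc m \<in> F then \<theta> * (2 * ln (u (Suc m)) - ln (real (card (A (Suc m))))) else 0)
        \<le> (if Suc m = n (Suc k) then \<theta> * (1 + e) * ln (s (Suc k)) else 0)"
    proof (cases "Suc m \<in> F")
      case True
      then obtain i where i: "K \<le> i" "Suc m = n i" using Fn by blast
      have "n k < n i" "n i \<le> n (Suc k)" using i m by auto
      then have "k < i" "\<not> Suc k < i" using n_less_iff[of k i] n_less_iff[of "Suc k" i] K1 k i by auto
      then have ik: "i = Suc k" by simp
      have Kk: "K \<le> Suc k" using k by simp
      have uA: "u (Suc m) = s (Suc k)" "A (Suc m) = window (Suc k)"
        using idx[OF Kk] i(2) by (simp_all add: u_def A_def ik)
      have "\<theta> * (2 * ln (s (Suc k)) - ln (real (card (window (Suc k))))) \<le> \<theta> * ((1 + e) * ln (s (Suc k)))"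
        using K(3)[OF Kk] \<theta> by (intro mult_left_mono) (auto simp: algebra_simps)
      then show ?thesis using True i(2) ik uA by (simp add: mult.assoc)
    next
      case False
      have "n (Suc k) \<in> F" using k by (auto simp: F_def)
      then have "Suc m \<noteq> n (Suc k)" using False by metis
      then show ?thesis using False by simp
    qed
    show ?thesis using 3 4 unfolding ex_def by linarith
  qed
  have "\<forall>\<^sub>F m in sequentially. ex m \<le> 0"
  proof -
    obtain k0 where k0: "\<And>k m. k0 \<le> k \<Longrightarrow> n k \<le> m \<Longrightarrow> m < n (Suc k) \<Longrightarrow>
      (2 * \<theta> - 1 + e) * S k + 4 * real k + c - \<kappa> * (real m - real k) +
      (if Suc m = n (Suc k) then \<theta> * (1 + e) * ln (s (Suc k)) else 0) \<le> 0"
      using bound[of c] unfolding eventually_sequentially by blast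
    have "ex m \<le> 0" if m: "n (max k0 K) \<le> m" for m
    proof -
      have "1 \<le> max k0 K" using K1 by simp
      from between_consecutive_n[OF this m] obtain k where k: "max k0 K \<le> k" "n k \<le> m" "m < n (Suc k)" .
      show ?thesis using main[of k m] k0[of k m] k by simp
    qed
    then show ?thesis by (rule eventually_sequentiallyI)
  qed
  from eventually_bounded_above[OF this] obtain B where "\<And>m. ex m \<le> B" by blast
  then have dim: "ereal \<theta> \<le> hausdorff_dim {x \<in> irr_unit. \<forall>j\<ge>1. if j \<in> F then digits x j \<in> A j else digits x j \<le> M}"
    unfolding ex_def by (rule C.dimension_ge)
  have "{x \<in> irr_unit. \<forall>j\<ge>1. if j \<in> F then digits x j \<in> A j else digits x j \<le> M} \<subseteq> E_S n \<inter> E_L n s t"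
  proof
    fix x assume x: "x \<in> {x \<in> irr_unit. \<forall>j\<ge>1. if j \<in> F then digits x j \<in> A j else digits x j \<le> M}"
    have "digits x j \<le> M" if j: "j \<in> {1..} - n ` {1..}" for j
    proof -
      have "j \<notin> F" using j K1 by (auto simp: F_def)
      then show ?thesis using x j by auto
    qed
    then have 1: "x \<in> E_S n" unfolding E_S_digits using x by (auto intro!: bdd_aboveI2)
    have "s k < real (digits x (n k)) \<and> real (digits x (n k)) \<le> s k + t k" if k: "K \<le> k" for k
    proof -
      have "n k \<in> F" "1 \<le> n k" using k K1 n_ge1[of k] by (auto simp: F_def)
      then have "digits x (n k) \<in> A (n k)" using x by auto
      then have "digits x (n k) \<in> window k" using idx[OF k] by (simp add: A_def)
      then show ?thesis using window(3)[of k] k K1 by simp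
    qed
    then have "x \<in> E_L n s t" unfolding E_L_digits using x by (auto intro: eventually_sequentiallyI)
    then show "x \<in> E_S n \<inter> E_L n s t" using 1 by simp
  qed
  from hausdorff_dim_subset[OF this] dim show ?thesis by (rule order_trans[rotated])
qed

text \<open>As \<kappa> > 0, the exponent decreases in \<open>m\<close> along a gap, so only two
  places matter: m = n_k, and m = n_(k+1) - 1, where the next window costs \<theta> ln s_(k+1). The
  second is the assumed inequality for the pressure; the first needs only (2\<theta> - 1) a <
  P(\<theta>), which is weaker because b (1 - \<theta>) is nonnegative.\<close>

lemma dimension_E_ge_finite:
  assumes a: "(\<lambda>k. S k / real (n k)) \<longlonglongrightarrow> a" and b: "(\<lambda>k. ln (s k) / real (n k)) \<longlonglongrightarrow> b"
    and ab: "0 \<le> a" "0 \<le> b" and \<theta>: "1 / 2 < \<theta>" "\<theta> < 1" and P: "(2 * a - b) * \<theta> - (a - b) < pressure \<theta>"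
  shows "ereal \<theta> \<le> hausdorff_dim (E_S n \<inter> E_L n s t)"
proof -
  have P0: "0 < pressure \<theta>"
  proof -
    have "0 < (1 - \<theta>) * ln 2" using \<theta> by simp
    moreover have "(1 - \<theta>) * ln 2 \<le> pressure \<theta>" using pressure_decreasing[of \<theta> 1] \<theta> pressure_1 by simp
    ultimately show ?thesis by linarith
  qed
  have "(2 * a - b) * \<theta> - (a - b) = (2 * \<theta> - 1) * a + b * (1 - \<theta>)" by (simp add: algebra_simps)
  moreover have "0 \<le> b * (1 - \<theta>)" using ab \<theta> by simp
  ultimately have P2: "(2 * \<theta> - 1) * a < pressure \<theta>" using P by linarith
  have "\<forall>\<^sub>F e in at_right (0::real). (2 * \<theta> - 1 + e) * (a - b) + \<theta> * (1 + e) * b - (pressure \<theta> - e) < 0"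
  proof (rule order_tendstoD)
    show "((\<lambda>e. (2 * \<theta> - 1 + e) * (a - b) + \<theta> * (1 + e) * b - (pressure \<theta> - e)) \<longlongrightarrow>
      (2 * \<theta> - 1 + 0) * (a - b) + \<theta> * (1 + 0) * b - (pressure \<theta> - 0)) (at_right 0)" by (intro tendsto_intros)
    show "(2 * \<theta> - 1 + 0) * (a - b) + \<theta> * (1 + 0) * b - (pressure \<theta> - 0) < 0" using P by (simp add: algebra_simps)
  qed
  moreover have "\<forall>\<^sub>F e in at_right (0::real). (2 * \<theta> - 1 + e) * a - (pressure \<theta> - e) < 0"
  proof (rule order_tendstoD)
    show "((\<lambda>e. (2 * \<theta> - 1 + e) * a - (pressure \<theta> - e)) \<longlongrightarrow> (2 * \<theta> - 1 + 0) * a - (pressure \<theta> - 0)) (at_right 0)"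
      by (intro tendsto_intros)
    show "(2 * \<theta> - 1 + 0) * a - (pressure \<theta> - 0) < 0" using P2 by simp
  qed
  moreover have "\<forall>\<^sub>F e in at_right (0::real). e \<in> {0<..<pressure \<theta>}" by (rule eventually_at_right_real[OF P0])
  ultimately have "\<forall>\<^sub>F e in at_right (0::real). (2 * \<theta> - 1 + e) * (a - b) + \<theta> * (1 + e) * b - (pressure \<theta> - e) < 0 \<and>
      (2 * \<theta> - 1 + e) * a - (pressure \<theta> - e) < 0 \<and> e \<in> {0<..<pressure \<theta>}"
    by eventually_elim simp
  then obtain e where e: "(2 * \<theta> - 1 + e) * (a - b) + \<theta> * (1 + e) * b - (pressure \<theta> - e) < 0"
      "(2 * \<theta> - 1 + e) * a - (pressure \<theta> - e) < 0" "0 < e" "e < pressure \<theta>"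
    using eventually_happens[of _ "at_right (0::real)"] by auto
  obtain M l where Ml: "1 \<le> M" "1 \<le> l" "pressure \<theta> - e
    \<le> ln ((\<Sum>w\<in>words (\<lambda>_. {1..M}) l. cf_den w 0 powr (- 2 * \<theta>)) / 4 powr \<theta>) / real l"
    using exists_good_blocks[OF \<theta>(1) e(3)] by blast
  define \<kappa> where "\<kappa> = ln ((\<Sum>w\<in>words (\<lambda>_. {1..M}) l. cf_den w 0 powr (- 2 * \<theta>)) / 4 powr \<theta>) / real l"
  have \<kappa>: "pressure \<theta> - e \<le> \<kappa>" "0 < \<kappa>" using Ml(3) e(4) by (auto simp: \<kappa>_def)
  show ?thesis
  proof (rule dimension_E_ge[OF _ _ Ml(1,2) e(3) \<kappa>_def])
    fix C
    let ?g = "\<lambda>k. (2 * \<theta> - 1 + e) * (S k / real (n k)) + (4 + \<kappa>) * (real k / real (n k)) + C / real (n k) - \<kappa>"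
    have "?g \<longlonglongrightarrow> (2 * \<theta> - 1 + e) * a + (4 + \<kappa>) * 0 + 0 - \<kappa>"
      by (intro tendsto_intros a k_over_n const_over_n)
    moreover have "(2 * \<theta> - 1 + e) * a + (4 + \<kappa>) * 0 + 0 - \<kappa> < 0" using e(2) \<kappa>(1) by simp
    ultimately have g: "\<forall>\<^sub>F k in sequentially. ?g k < 0" by (rule order_tendstoD)
    let ?h = "\<lambda>k. (2 * \<theta> - 1 + e) * (S k / real (n k) - ln (s k) / real (n k)) + \<theta> * (1 + e) * (ln (s k) / real (n k)) +
      (4 + \<kappa>) * (real k / real (n k)) + (C + \<kappa>) / real (n k) - \<kappa>"
    have "?h \<longlonglongrightarrow> (2 * \<theta> - 1 + e) * (a - b) + \<theta> * (1 + e) * b + (4 + \<kappa>) * 0 + 0 - \<kappa>"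
      by (intro tendsto_intros a b k_over_n const_over_n)
    moreover have "(2 * \<theta> - 1 + e) * (a - b) + \<theta> * (1 + e) * b + (4 + \<kappa>) * 0 + 0 - \<kappa> < 0" using e(1) \<kappa>(1) by simp
    ultimately have "\<forall>\<^sub>F k in sequentially. ?h k < 0" by (rule order_tendstoD)
    then have h: "\<forall>\<^sub>F k in sequentially. ?h (Suc k) < 0" by (rule eventually_sequentially_Suc[THEN iffD2])
    show "\<forall>\<^sub>F k in sequentially. \<forall>m. n k \<le> m \<and> m < n (Suc k) \<longrightarrow>
      (2 * \<theta> - 1 + e) * S k + 4 * real k + C - \<kappa> * (real m - real k) +
      (if Suc m = n (Suc k) then \<theta> * (1 + e) * ln (s (Suc k)) else 0) \<le> 0"
      using g h eventually_ge_at_top[of 1]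
    proof eventually_elim
      case (elim k)
      have n0: "0 < real (n k)" "0 < real (n (Suc k))" using n_ge1[of k] n_ge1[of "Suc k"] elim(3) by simp_all
      have "?g k * real (n k) = (2 * \<theta> - 1 + e) * S k + (4 + \<kappa>) * real k + C - \<kappa> * real (n k)"
        using n0(1) by (simp add: field_simps)
      moreover have "?g k * real (n k) \<le> 0" using elim(1) n0(1) by (simp add: mult_nonpos_nonneg)
      ultimately have 1: "(2 * \<theta> - 1 + e) * S k + (4 + \<kappa>) * real k + C - \<kappa> * real (n k) \<le> 0" by simp
      have "?h (Suc k) * real (n (Suc k)) = (2 * \<theta> - 1 + e) * (S (Suc k) - ln (s (Suc k))) + \<theta> * (1 + e) * ln (s (Suc k)) +
          (4 + \<kappa>) * real (Suc k) + (C + \<kappa>) - \<kappa> * real (n (Suc k))"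
        using n0(2) by (simp add: field_simps)
      moreover have "?h (Suc k) * real (n (Suc k)) \<le> 0" using elim(2) n0(2) by (simp add: mult_nonpos_nonneg)
      ultimately have 2: "(2 * \<theta> - 1 + e) * S k + \<theta> * (1 + e) * ln (s (Suc k)) +
          (4 + \<kappa>) * real (Suc k) + (C + \<kappa>) - \<kappa> * real (n (Suc k)) \<le> 0"
        by (simp add: S_Suc)
      show ?case
      proof (intro allI impI)
        fix m assume m: "n k \<le> m \<and> m < n (Suc k)"
        have km: "\<kappa> * real (n k) \<le> \<kappa> * real m" using m \<kappa>(2) by (intro mult_left_mono) auto
        show "(2 * \<theta> - 1 + e) * S k + 4 * real k + C - \<kappa> * (real m - real k) +
          (if Suc m = n (Suc k) then \<theta> * (1 + e) * ln (s (Suc k)) else 0) \<le> 0"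
        proof (cases "Suc m = n (Suc k)")
          case True
          then have "\<kappa> * real (n (Suc k)) = \<kappa> * real m + \<kappa>" by (metis distrib_left mult.right_neutral of_nat_Suc add.commute)
          moreover have "(4 + \<kappa>) * real (Suc k) = 4 * real k + \<kappa> * real k + 4 + \<kappa>" by (simp add: algebra_simps)
          ultimately show ?thesis using 2 True \<kappa>(2) by (simp add: right_diff_distrib)
        next
          case False
          then show ?thesis using 1 km by (simp add: algebra_simps)
        qed
      qed
    qed
  qed (use \<theta> in auto)
qed

text \<open>Free positions are negligible against \<open>S k\<close>, so all free digits may be 1,
  that is M = l = 1. The worst place is just before n_(k+1): there the exponent is about (2\<theta>
  - 1) S_k + \<theta> ln s_(k+1), at most (\<theta> (2 + \<xi>) - 1) S_k up to small errors.\<close>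

lemma dimension_E_ge_infinite:
  assumes inf: "filterlim (\<lambda>k. S k / real (n k)) at_top sequentially"
    and \<theta>: "0 < \<theta>" "\<theta> * (2 + \<xi>) < 1" and \<xi>: "0 \<le> \<xi>"
    and lim: "\<And>c. \<xi> < c \<Longrightarrow> \<forall>\<^sub>F k in sequentially. ln (s (Suc k)) / S k < c"
  shows "ereal \<theta> \<le> hausdorff_dim (E_S n \<inter> E_L n s t)"
proof -
  define \<kappa> where "\<kappa> = ln ((\<Sum>w\<in>words (\<lambda>_. {1..1}) 1. cf_den w 0 powr (- 2 * \<theta>)) / 4 powr \<theta>) / real 1"
  define K where "K = \<bar>4 + \<kappa>\<bar> + \<bar>\<kappa>\<bar> + 1"
  have K: "0 < K" by (simp add: K_def add_nonneg_pos)
  let ?D = "\<lambda>e. - (1 - 2 * \<theta> - e) + K * (e * (1 + \<xi> + e)) + \<theta> * (1 + e) * (\<xi> + e) :: real"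
  have "(?D \<longlongrightarrow> - (1 - 2 * \<theta> - 0) + K * (0 * (1 + \<xi> + 0)) + \<theta> * (1 + 0) * (\<xi> + 0)) (at_right 0)"
    by (intro tendsto_intros)
  moreover have "- (1 - 2 * \<theta> - 0) + K * (0 * (1 + \<xi> + 0)) + \<theta> * (1 + 0) * (\<xi> + 0) < 0"
    using \<theta>(2) by (simp add: algebra_simps)
  ultimately have "\<forall>\<^sub>F e in at_right 0. ?D e < 0" by (rule order_tendstoD)
  moreover have "\<forall>\<^sub>F e in at_right (0::real). 0 < e" by (rule eventually_at_right_less)
  ultimately have "\<forall>\<^sub>F e in at_right 0. ?D e < 0 \<and> 0 < e" by (rule eventually_conj)
  then obtain e where e: "?D e < 0" "0 < e" using eventually_happens[of _ "at_right (0::real)"] by auto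
  have \<theta>1: "\<theta> \<le> 1"
  proof -
    have "\<theta> * 1 \<le> \<theta> * (2 + \<xi>)" using \<theta>(1) \<xi> by (intro mult_left_mono) auto
    then show ?thesis using \<theta>(2) by simp
  qed
  show ?thesis
  proof (rule dimension_E_ge[OF \<theta>(1) \<theta>1 _ _ e(2) \<kappa>_def])
    fix C
    have "\<forall>\<^sub>F k in sequentially. real (n k) \<le> e * S k" by (rule n_small_S[OF inf e(2)])
    then have small: "\<forall>\<^sub>F k in sequentially. real (n (Suc k)) \<le> e * S (Suc k)"
      by (rule eventually_sequentially_Suc[THEN iffD2])
    have ratio: "\<forall>\<^sub>F k in sequentially. ln (s (Suc k)) / S k < \<xi> + e" using e(2) by (intro lim) simp
    have Sp: "\<forall>\<^sub>F k in sequentially. 0 < S k" using S_top by (simp add: filterlim_at_top_dense)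
    have "\<forall>\<^sub>F k in sequentially. 0 \<le> ln (s k)" using ln_s_top by (simp add: filterlim_at_top)
    then have lp: "\<forall>\<^sub>F k in sequentially. 0 \<le> ln (s (Suc k))" by (rule eventually_sequentially_Suc[THEN iffD2])
    have "filterlim (\<lambda>k. C + ?D e * S k) at_bot sequentially"
      using e(1) by (intro filterlim_add_const_at_bot
        filterlim_tendsto_neg_mult_at_bot[OF tendsto_const _ S_top])
    then have "\<forall>\<^sub>F k in sequentially. C + ?D e * S k \<le> 0" by (simp add: filterlim_at_bot)
    then show "\<forall>\<^sub>F k in sequentially. \<forall>m. n k \<le> m \<and> m < n (Suc k) \<longrightarrow>
      (2 * \<theta> - 1 + e) * S k + 4 * real k + C - \<kappa> * (real m - real k) +
      (if Suc m = n (Suc k) then \<theta> * (1 + e) * ln (s (Suc k)) else 0) \<le> 0"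
      using small ratio Sp lp eventually_ge_at_top[of 1]
    proof eventually_elim
      case (elim k)
      have ls: "ln (s (Suc k)) \<le> (\<xi> + e) * S k" using elim(3,4) by (simp add: pos_divide_less_eq)
      have "real (n (Suc k)) \<le> e * (S k + ln (s (Suc k)))" using elim(2) by (simp add: S_Suc)
      also have "\<dots> \<le> e * ((1 + \<xi> + e) * S k)" using ls e(2) by (intro mult_left_mono) (auto simp: algebra_simps)
      finally have nS: "K * real (n (Suc k)) \<le> K * (e * (1 + \<xi> + e)) * S k"
        using mult_left_mono[of "real (n (Suc k))" "e * ((1 + \<xi> + e) * S k)" K] K by (simp add: mult.assoc)
      have 1: "\<theta> * (1 + e) * ln (s (Suc k)) \<le> \<theta> * (1 + e) * ((\<xi> + e) * S k)"
        using ls \<theta> e(2) by (intro mult_left_mono) auto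
      have 2: "0 \<le> \<theta> * (1 + e) * ln (s (Suc k))" using \<theta> e(2) elim(5) by simp
      show ?case
      proof (intro allI impI)
        fix m assume m: "n k \<le> m \<and> m < n (Suc k)"
        have "(4 + \<kappa>) * real k \<le> \<bar>4 + \<kappa>\<bar> * real (n (Suc k))"
          using n_ge[OF elim(6)] m by (intro mult_mono) auto
        moreover have "- \<kappa> * real m \<le> \<bar>\<kappa>\<bar> * real (n (Suc k))" using m by (intro mult_mono) auto
        ultimately have "4 * real k - \<kappa> * (real m - real k) \<le> K * real (n (Suc k))"
          unfolding K_def by (simp add: algebra_simps)
        then have 3: "4 * real k - \<kappa> * (real m - real k) \<le> K * (e * (1 + \<xi> + e)) * S k" using nS by linarith
        have "(2 * \<theta> - 1 + e) * S k + K * (e * (1 + \<xi> + e)) * S k + \<theta> * (1 + e) * ((\<xi> + e) * S k) = ?D e * S k"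
          by (simp add: algebra_simps)
        then show "(2 * \<theta> - 1 + e) * S k + 4 * real k + C - \<kappa> * (real m - real k) +
          (if Suc m = n (Suc k) then \<theta> * (1 + e) * ln (s (Suc k)) else 0) \<le> 0"
          using 1 2 3 elim(1) by (cases "Suc m = n (Suc k)") simp_all
      qed
    qed
  qed auto
qed

text \<open>Sparsity in counting form: prescribed positions have density 0. The finitely many
  indices before the ratio gets small are absorbed by a large \<open>m\<close>.\<close>

lemma card_forced_small:
  assumes "0 < d"
  shows "\<forall>\<^sub>F m in sequentially. real (card (n ` {1..} \<inter> {1..m})) \<le> d * real m"
proof -
  have "\<forall>\<^sub>F k in sequentially. real k / real (n k) < d"
    using k_over_n assms by (rule order_tendstoD)
  then obtain k0 where k0: "\<And>k. k0 \<le> k \<Longrightarrow> real k / real (n k) < d" unfolding eventually_sequentially by blast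
  have "real (card (n ` {1..} \<inter> {1..m})) \<le> d * real m" if m: "real k0 / d \<le> real m" for m
  proof -
    have "n ` {1..} \<inter> {1..m} \<subseteq> n ` {1..nat \<lfloor>d * real m\<rfloor>}"
    proof
      fix j assume "j \<in> n ` {1..} \<inter> {1..m}"
      then obtain k where k: "1 \<le> k" "j = n k" "n k \<le> m" by auto
      have "real k \<le> d * real m"
      proof (cases "k0 \<le> k")
        case True
        have "0 < real (n k)" using n_ge1[OF k(1)] by simp
        then have "real k \<le> d * real (n k)" using k0[OF True] by (simp add: pos_divide_less_eq)
        also have "\<dots> \<le> d * real m" using k(3) assms by (intro mult_left_mono) auto
        finally show ?thesis .
      next
        case False
        then have "real k \<le> real k0" by simp
        also have "\<dots> \<le> d * real m" using m assms by (simp add: pos_divide_le_eq mult.commute)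
        finally show ?thesis .
      qed
      then have "k \<le> nat \<lfloor>d * real m\<rfloor>" by (simp add: le_nat_floor)
      then show "j \<in> n ` {1..nat \<lfloor>d * real m\<rfloor>}" using k by simp
    qed
    then have "card (n ` {1..} \<inter> {1..m}) \<le> card (n ` {1..nat \<lfloor>d * real m\<rfloor>})" by (rule card_mono[rotated]) simp
    also have "\<dots> \<le> card {1..nat \<lfloor>d * real m\<rfloor>}" by (rule card_image_le) simp
    finally have "card (n ` {1..} \<inter> {1..m}) \<le> nat \<lfloor>d * real m\<rfloor>" by simp
    then have "real (card (n ` {1..} \<inter> {1..m})) \<le> real (nat \<lfloor>d * real m\<rfloor>)" by simp
    also have "\<dots> \<le> d * real m" using assms by (simp add: of_nat_floor)
    finally show ?thesis .
  qed
  moreover have "\<forall>\<^sub>F m in sequentially. real k0 / d \<le> real m"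
    using filterlim_real_sequentially by (simp add: filterlim_at_top)
  ultimately show ?thesis by (auto elim: eventually_mono)
qed

text \<open>At a free position \<open>j\<close> the digit is of size \<open>exp (b ^ f j)\<close>, where \<open>f j\<close> counts only the free
  positions up to \<open>j\<close>: counting all positions would break the growth rate after a cluster of
  prescribed ones.\<close>

lemma dimension_E_L_ge:
  assumes b: "1 < b0" "b0 < b" and \<theta>: "0 < \<theta>" "\<theta> * (b + 1) < 1"
    and s_le: "\<forall>\<^sub>F k in sequentially. ln (s k) \<le> b0 ^ n k"
  shows "ereal \<theta> \<le> hausdorff_dim (E_L n s t)"
proof -
  have b1: "1 < b" using b by simp
  have \<theta>2: "2 * \<theta> < 1"
  proof -
    have "\<theta> * 2 \<le> \<theta> * (b + 1)" using \<theta>(1) b1 by (intro mult_left_mono) auto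
    then show ?thesis using \<theta>(2) by linarith
  qed
  \<comment> \<open>The coefficient of X = b^(f m + 1) in the final exponent: the next digit costs
    \<theta> (1 + e), terms linear in \<open>m\<close> cost e, and the sum of the
    \<open>ln (u j)\<close>, about X/(b - 1) at least, carries the weight -(1 - 2\<theta> - e). At e
    = 0 negativity means precisely \<theta> (b + 1) < 1.\<close>
  let ?G = "\<lambda>e. \<theta> * (1 + e) + e - (1 - 2 * \<theta> - e) / (b - 1)"
  have "(?G \<longlongrightarrow> \<theta> * (1 + 0) + 0 - (1 - 2 * \<theta> - 0) / (b - 1)) (at_right 0)"
    using b1 by (intro tendsto_intros) auto
  moreover have "\<theta> * (1 + 0) + 0 - (1 - 2 * \<theta> - 0) / (b - 1) < 0"
  proof -
    have "\<theta> * (b - 1) < 1 - 2 * \<theta>" using \<theta>(2) by (simp add: algebra_simps)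
    then have "\<theta> < (1 - 2 * \<theta>) / (b - 1)" using b1 by (simp add: pos_less_divide_eq)
    then show ?thesis by simp
  qed
  ultimately have "\<forall>\<^sub>F e in at_right 0. ?G e < 0" by (rule order_tendstoD)
  moreover have "\<forall>\<^sub>F e in at_right (0::real). e \<in> {0<..<min 1 (1 - 2 * \<theta>)}"
    using \<theta>2 by (intro eventually_at_right_real) simp
  ultimately have "\<forall>\<^sub>F e in at_right 0. ?G e < 0 \<and> e \<in> {0<..<min 1 (1 - 2 * \<theta>)}" by (rule eventually_conj)
  then obtain e where e: "?G e < 0" "0 < e" "e < 1 - 2 * \<theta>" "e < 1"
    using eventually_happens[of _ "at_right (0::real)"] by auto
  have "\<forall>\<^sub>F k in sequentially. (2 \<le> s k \<and> 1 \<le> real (card (window k)) \<and> (1 - e) * ln (s k) \<le> ln (real (card (window k))))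
      \<and> ln (s k) \<le> b0 ^ n k"
    using ln_card_window[OF e(2)] s_le by (rule eventually_conj)
  then obtain K0 where K0: "\<And>k. K0 \<le> k \<Longrightarrow> (2 \<le> s k \<and> 1 \<le> real (card (window k)) \<and> (1 - e) * ln (s k) \<le> ln (real (card (window k))))
      \<and> ln (s k) \<le> b0 ^ n k" unfolding eventually_sequentially by blast
  define K where "K = max K0 1"
  have K1: "1 \<le> K" by (simp add: K_def)
  have K: "2 \<le> s k" "1 \<le> real (card (window k))" "(1 - e) * ln (s k) \<le> ln (real (card (window k)))" "ln (s k) \<le> b0 ^ n k"
    if "K \<le> k" for k using K0[of k] that by (auto simp: K_def)
  define F0 where "F0 = n ` {K..}"
  define idx where "idx = inv_into {1..} n"
  have idx: "idx (n k) = k" if "K \<le> k" for k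
    using inv_into_f_f[OF n_inj, of k] that K1 by (simp add: idx_def)
  have F0D: "\<exists>k\<ge>K. j = n k \<and> idx j = k" if jF: "j \<in> F0" for j
  proof -
    obtain k where "K \<le> k" "j = n k" using jF by (auto simp: F0_def)
    then show ?thesis using idx by blast
  qed
  define f where "f m = card ({1..m} - F0)" for m
  define u where "u j = (if j \<in> F0 then s (idx j) else exp (b ^ f j))" for j
  define A where "A j = (if j \<in> F0 then window (idx j) else {a::nat. exp (b ^ f j) < real a \<and> real a \<le> exp (b ^ f j) + exp (b ^ f j)})" for j
  have f0: "f 0 = 0" by (simp add: f_def)
  have f_Suc: "f (Suc m) = (if Suc m \<in> F0 then f m else Suc (f m))" for m
  proof -
    have "{1..Suc m} - F0 = (if Suc m \<in> F0 then {1..m} - F0 else insert (Suc m) ({1..m} - F0))"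
      by (auto simp: le_Suc_eq)
    then show ?thesis by (simp add: f_def)
  qed
  have ln2: "0 \<le> ln (2::real)" "ln (2::real) \<le> 1" using ln_2_less_1 by (auto simp: less_imp_le)
  have uA: "2 \<le> u j \<and> finite (A j) \<and> (\<forall>a\<in>A j. u j \<le> real a \<and> real a \<le> 2 * u j) \<and> 1 \<le> real (card (A j)) \<and>
      (1 - e) * ln (u j) - ln 2 \<le> ln (real (card (A j)))" for j
  proof (cases "j \<in> F0")
    case True
    then obtain k where k: "K \<le> k" "j = n k" "idx j = k" using F0D by blast
    have k1: "1 \<le> k" using k(1) K1 by simp
    have eq: "u j = s k" "A j = window k" using True k(3) by (simp_all add: u_def A_def)
    have "(1 - e) * ln (s k) - ln 2 \<le> ln (real (card (window k)))" using K(3)[OF k(1)] ln2(1) by linarith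
    then show ?thesis unfolding eq using K(1,2)[OF k(1)] window(1)[OF k1] window(2)[OF k1] by blast
  next
    case False
    define v where "v = exp (b ^ f j)"
    have eq: "u j = v" "A j = {a::nat. v < real a \<and> real a \<le> v + v}" using False by (simp_all add: u_def A_def v_def)
    have "1 \<le> b ^ f j" using b1 by (simp add: one_le_power)
    then have "exp 1 \<le> v" by (simp add: v_def)
    then have v: "2 \<le> v" using exp_ge_add_one_self[of 1] by linarith
    have fin: "finite (A j)" unfolding eq using v by (intro finite_nat_interval) auto
    have "v - 1 \<le> real (card (A j))" unfolding eq using v by (intro card_nat_interval_ge) auto
    then have c: "v / 2 \<le> real (card (A j))" "1 \<le> real (card (A j))" using v by linarith+
    then have "ln (v / 2) \<le> ln (real (card (A j)))" using v by (subst ln_le_cancel_iff) auto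
    then have "ln v - ln 2 \<le> ln (real (card (A j)))" using v by (simp add: ln_div)
    moreover have "(1 - e) * ln v \<le> ln v" using v e by (simp add: mult_left_le_one_le)
    ultimately have "(1 - e) * ln v - ln 2 \<le> ln (real (card (A j)))" by linarith
    then show ?thesis using v fin c(2) unfolding eq(1) by (auto simp: eq(2))
  qed
  \<comment> \<open>Every position counts as prescribed, with the doubly exponential windows at the
    free ones, so \<open>nfree\<close> vanishes identically and no block is ever fixed.\<close>
  interpret C: cantor_set "{1..}" A u 1 1 \<theta>
  proof
    fix j
    show "finite (A j)" "2 \<le> u j" using uA[of j] by auto
    show "A j \<noteq> {}" using uA[of j] by auto
    show "u j \<le> real a \<and> real a \<le> 2 * u j" if "a \<in> A j" for a using uA[of j] that by blast
  qed (use \<theta> \<theta>2 in auto)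
  have lnu: "0 \<le> ln (u j)" for j using uA[of j] by simp
  define W where "W m = (\<Sum>j=1..m. ln (u j))" for m
  \<comment> \<open>A geometric sum: the free positions up to \<open>m\<close> contribute b, b^2,
    ..., b^(f m), and the prescribed ones only add nonnegative terms.\<close>
  have W: "b ^ (f m + 1) - b \<le> (b - 1) * W m" for m
  proof (induction m)
    case 0
    then show ?case by (simp add: W_def f0)
  next
    case (Suc m)
    have WS: "W (Suc m) = W m + ln (u (Suc m))" by (simp add: W_def)
    show ?case
    proof (cases "Suc m \<in> F0")
      case True
      have "0 \<le> (b - 1) * ln (u (Suc m))" using b1 lnu by simp
      then show ?thesis using Suc True by (simp add: WS f_Suc distrib_left)
    next
      case False
      then have 1: "ln (u (Suc m)) = b ^ (f m + 1)" and 2: "f (Suc m) = f m + 1"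
        by (simp_all add: u_def f_Suc)
      have 3: "b ^ (f m + 1 + 1) = (b - 1) * b ^ (f m + 1) + b ^ (f m + 1)" by (simp add: algebra_simps)
      show ?thesis using Suc unfolding WS distrib_left 1 2 3 by linarith
    qed
  qed
  \<comment> \<open>Chosen so that b0 \<le> b^(1 - d): when prescribed positions have density at
    most d, b0^m is at most b^(f m). The cap 1/2 gives m \<le> 2 f m for the linear error
    terms.\<close>
  define d where "d = min (1 / 2) (1 - ln b0 / ln b)"
  have lnb: "0 < ln b0" "ln b0 < ln b" using b by auto
  have d: "0 < d" "d \<le> 1 / 2" "ln b0 \<le> (1 - d) * ln b"
  proof -
    have "ln b0 / ln b < 1" using lnb by simp
    then show "0 < d" by (simp add: d_def)
    show "d \<le> 1 / 2" unfolding d_def by (rule min.cobounded1)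
    have "d \<le> 1 - ln b0 / ln b" unfolding d_def by (rule min.cobounded2)
    then have "ln b0 / ln b \<le> 1 - d" by linarith
    then show "ln b0 \<le> (1 - d) * ln b" using lnb by (simp add: pos_divide_le_eq)
  qed
  have f_ge: "\<forall>\<^sub>F m in sequentially. (1 - d) * real m \<le> real (f m)"
    using card_forced_small[OF d(1)]
  proof eventually_elim
    case (elim m)
    have "{1..m} - F0 = {1..m} - F0 \<inter> {1..m}" by blast
    then have "f m = card {1..m} - card (F0 \<inter> {1..m})"
      unfolding f_def by (simp only: card_Diff_subset[OF finite_Int Int_lower2] finite_atLeastAtMost simp_thms)
    then have "real m - real (card (F0 \<inter> {1..m})) \<le> real (f m)" by simp
    moreover have "card (F0 \<inter> {1..m}) \<le> card (n ` {1..} \<inter> {1..m})"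
      using K1 by (intro card_mono) (auto simp: F0_def)
    ultimately show ?case using elim by (simp add: left_diff_distrib)
  qed
  have f_top: "filterlim f at_top sequentially"
    unfolding filterlim_at_top
  proof
    fix Z :: nat
    have "\<forall>\<^sub>F m in sequentially. 2 * Z \<le> m" by (rule eventually_ge_at_top)
    with f_ge show "\<forall>\<^sub>F m in sequentially. Z \<le> f m"
    proof eventually_elim
      case (elim m)
      have "1 / 2 * real m \<le> (1 - d) * real m" using d by (intro mult_right_mono) auto
      then have "real Z \<le> real (f m)" using elim by linarith
      then show ?case by simp
    qed
  qed
  have small: "\<forall>\<^sub>F m in sequentially. 5 * real m \<le> e * b ^ (f m + 1)"
  proof -
    have "(\<lambda>x. real x * (1 / b) ^ x) \<longlonglongrightarrow> 0"
      using b1 powser_times_n_limit_0[of "1 / b"] by simp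
    then have "\<forall>\<^sub>F x in sequentially. real x * (1 / b) ^ x < e / 10"
      using e(2) by (intro order_tendstoD) auto
    then have "\<forall>\<^sub>F m in sequentially. real (f m) * (1 / b) ^ f m < e / 10"
      using f_top by (rule eventually_compose_filterlim)
    then show ?thesis using f_ge
    proof eventually_elim
      case (elim m)
      have "1 / 2 * real m \<le> (1 - d) * real m" using d by (intro mult_right_mono) auto
      then have 1: "real m \<le> 2 * real (f m)" using elim(2) by linarith
      have "real (f m) < e / 10 * b ^ f m" using elim(1) b1 by (simp add: power_one_over field_simps)
      moreover have "b ^ f m \<le> b ^ (f m + 1)" using b1 by (intro power_increasing) auto
      then have "e / 10 * b ^ f m \<le> e / 10 * b ^ (f m + 1)" using e(2) by (intro mult_left_mono) auto
      ultimately show ?case using 1 by linarith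
    qed
  qed
  \<comment> \<open>The growth condition on \<open>s\<close> enters here: a prescribed digit is of
    no larger order than the window that a free position would receive in its place.\<close>
  have next_le: "\<forall>\<^sub>F m in sequentially. ln (u (Suc m)) \<le> b ^ (f m + 1)"
    using f_ge
  proof eventually_elim
    case (elim m)
    show ?case
    proof (cases "Suc m \<in> F0")
      case True
      then obtain k where k: "K \<le> k" "Suc m = n k" "idx (Suc m) = k" using F0D by blast
      have "ln (u (Suc m)) \<le> b0 ^ Suc m" using K(4)[OF k(1)] True k by (simp add: u_def)
      also have "\<dots> = exp (real (Suc m) * ln b0)" using b by (simp add: exp_of_nat_mult del: of_nat_Suc power_Suc)
      also have "\<dots> \<le> exp (real (f m + 1) * ln b)"
      proof -
        have "real m * ln b0 \<le> real m * ((1 - d) * ln b)" using d(3) by (intro mult_left_mono) auto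
        also have "\<dots> = (1 - d) * real m * ln b" by simp
        also have "\<dots> \<le> real (f m) * ln b" using elim lnb by (intro mult_right_mono) auto
        finally show ?thesis using lnb by (simp add: distrib_right)
      qed
      also have "\<dots> = b ^ (f m + 1)" using b1 by (simp only: exp_of_nat_mult) simp
      finally show ?thesis .
    next
      case False
      then show ?thesis by (simp add: u_def f_Suc)
    qed
  qed
  define ex where "ex m = C.exponent m + (if Suc m \<in> {1..} then \<theta> * (2 * ln (u (Suc m)) - ln (real (card (A (Suc m))))) else 0)" for m
  have "\<forall>\<^sub>F m in sequentially. ex m \<le> (1 - 2 * \<theta> - e) * b / (b - 1) + 1"
    using small next_le
  proof eventually_elim
    case (elim m)
    define X where "X = b ^ (f m + 1)"
    have X: "0 < X" using b1 by (simp add: X_def)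
    have "C.exponent m = (\<Sum>j=1..m. 2 * \<theta> * ln (5 * u j) - ln (real (card (A j))))"
    proof -
      have "{1..} \<inter> {1..m} = {1..m}" "{1..m} - {1..} = {}" by auto
      then show ?thesis unfolding C.exponent_def C.nfree_def by simp
    qed
    also have "\<dots> \<le> (\<Sum>j=1..m. - (1 - 2 * \<theta> - e) * ln (u j) + 5)"
    proof (rule sum_mono)
      fix j
      have "ln (5 * u j) = ln 5 + ln (u j)" using uA[of j] by (simp add: ln_mult)
      moreover have "ln (5::real) \<le> 4" using ln_le_minus_one[of 5] by simp
      then have "2 * \<theta> * ln 5 \<le> 1 * 4" using \<theta> \<theta>2 by (intro mult_mono) auto
      moreover have "(1 - e) * ln (u j) - ln 2 \<le> ln (real (card (A j)))" using uA[of j] by blast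
      ultimately show "2 * \<theta> * ln (5 * u j) - ln (real (card (A j))) \<le> - (1 - 2 * \<theta> - e) * ln (u j) + 5"
        using ln2 by (simp add: algebra_simps)
    qed
    also have "\<dots> = - (1 - 2 * \<theta> - e) * W m + 5 * real m"
      unfolding W_def sum.distrib sum_distrib_left[symmetric] by simp
    finally have 1: "C.exponent m \<le> - (1 - 2 * \<theta> - e) * W m + 5 * real m" .
    have "(X - b) / (b - 1) \<le> W m" using W[of m] b1 by (simp add: X_def pos_divide_le_eq mult.commute)
    then have "(1 - 2 * \<theta> - e) * ((X - b) / (b - 1)) \<le> (1 - 2 * \<theta> - e) * W m" using e by (intro mult_left_mono) auto
    moreover have "c * ((X - b) / (b - 1)) = c / (b - 1) * X - c * b / (b - 1)" for c
      by (simp add: diff_divide_distrib right_diff_distrib)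
    ultimately have 2: "- (1 - 2 * \<theta> - e) * W m \<le> (1 - 2 * \<theta> - e) * b / (b - 1) - (1 - 2 * \<theta> - e) / (b - 1) * X"
      by (simp only: mult_minus_left)
    have "\<theta> * (2 * ln (u (Suc m)) - ln (real (card (A (Suc m))))) \<le> \<theta> * ((1 + e) * ln (u (Suc m)) + ln 2)"
      using uA[of "Suc m"] \<theta> by (intro mult_left_mono) (auto simp: algebra_simps)
    also have "\<dots> \<le> \<theta> * ((1 + e) * X + ln 2)"
      using elim(2) \<theta> e unfolding X_def by (intro mult_left_mono add_right_mono) auto
    also have "\<dots> \<le> \<theta> * (1 + e) * X + 1"
    proof -
      have "\<theta> * ln 2 \<le> 1 * 1" using \<theta> \<theta>2 ln2 by (intro mult_mono) auto
      then show ?thesis unfolding distrib_left[of \<theta> "(1 + e) * X"] mult.assoc by simp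
    qed
    finally have 3: "\<theta> * (2 * ln (u (Suc m)) - ln (real (card (A (Suc m))))) \<le> \<theta> * (1 + e) * X + 1" .
    have "?G e * X \<le> 0" using e(1) X by (simp add: mult_nonpos_nonneg)
    then have "\<theta> * (1 + e) * X + e * X - (1 - 2 * \<theta> - e) / (b - 1) * X \<le> 0"
      by (simp only: distrib_right left_diff_distrib)
    moreover have "5 * real m \<le> e * X" using elim(1) by (simp add: X_def)
    moreover have "ex m = C.exponent m + \<theta> * (2 * ln (u (Suc m)) - ln (real (card (A (Suc m)))))" by (simp add: ex_def)
    ultimately show ?case using 1 2 3 by linarith
  qed
  from eventually_bounded_above[OF this] obtain B where "\<And>m. ex m \<le> B" by blast
  then have dim: "ereal \<theta> \<le> hausdorff_dim {x \<in> irr_unit. \<forall>j\<ge>1. if j \<in> {1..} then digits x j \<in> A j else digits x j \<le> 1}"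
    unfolding ex_def by (rule C.dimension_ge)
  have "{x \<in> irr_unit. \<forall>j\<ge>1. if j \<in> {1..} then digits x j \<in> A j else digits x j \<le> 1} \<subseteq> E_L n s t"
  proof
    fix x assume x: "x \<in> {x \<in> irr_unit. \<forall>j\<ge>1. if j \<in> {1..} then digits x j \<in> A j else digits x j \<le> 1}"
    have "s k < real (digits x (n k)) \<and> real (digits x (n k)) \<le> s k + t k" if k: "K \<le> k" for k
    proof -
      have "n k \<in> F0" "1 \<le> n k" using k K1 n_ge1[of k] by (auto simp: F0_def)
      then have "digits x (n k) \<in> window k" using x idx[OF k] by (auto simp: A_def)
      then show ?thesis using window(3)[of k] k K1 by simp
    qed
    then show "x \<in> E_L n s t" unfolding E_L_digits using x by (auto intro: eventually_sequentiallyI)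
  qed
  from hausdorff_dim_subset[OF this] dim show ?thesis by (rule order_trans[rotated])
qed

end

section \<open>The three cases of the theorem\<close>

lemma ereal_le_of_reals_below:
  assumes "c0 < c" "\<And>x. c0 < x \<Longrightarrow> x < c \<Longrightarrow> ereal x \<le> y"
  shows "ereal c \<le> y"
proof (rule ccontr)
  assume "\<not> ?thesis"
  then have "y < ereal c" by simp
  then obtain z where z: "y < ereal z" "z < c" using ereal_dense2[of y "ereal c"] by auto
  define x where "x = max z ((c0 + c) / 2)"
  have "c0 < x" "x < c" "z \<le> x" using z assms(1) by (auto simp: x_def max_def)
  then have "ereal z \<le> y" using assms(2)[of x] by (meson ereal_less_eq(3) order_trans)
  then show False using z(1) by simp
qed

lemma less_Limsup_frequently:
  assumes "c < Limsup F (f :: 'a \<Rightarrow> ereal)"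
  shows "\<exists>\<^sub>F x in F. c < f x"
proof (rule ccontr)
  assume "\<not> ?thesis"
  then have "\<forall>\<^sub>F x in F. f x \<le> c" by (simp add: frequently_def not_less)
  then have "Limsup F f \<le> c" by (rule Limsup_bounded)
  then show False using assms by simp
qed

text \<open>Since \<open>E\<close> is contained in \<open>E_L n s t\<close>, the cases \<alpha>
  finite need only an upper bound for the larger set and a lower bound for the smaller one. For
  \<alpha> = \<infinity> the two dimensions may differ, and each set gets its own pair of bounds,
  split by whether the limsup is finite.\<close>

theorem theorem1:
  fixes n :: "nat \<Rightarrow> nat" and s t :: "nat \<Rightarrow> real" and \<alpha> \<beta> :: ereal
  assumes "strict_mono_on {1..} n" and "\<And>k. k \<ge> 1 \<Longrightarrow> n k \<ge> 1"
    and "\<And>k. k \<ge> 1 \<Longrightarrow> s k > 0" and "\<And>k. k \<ge> 1 \<Longrightarrow> t k > 0"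
    and "filterlim s at_top sequentially" and "filterlim t at_top sequentially"
    and "filterlim (\<lambda>k. real (n k) / real k) at_top sequentially"
    and "(\<lambda>k. ln (s k) / ln (t k)) \<longlonglongrightarrow> 1"
    and "0 \<le> \<alpha>" and "(\<lambda>k. ereal ((\<Sum>j=1..k. ln (s j)) / real (n k))) \<longlonglongrightarrow> \<alpha>"
    and "0 \<le> \<beta>" and "(\<lambda>k. ereal (ln (s k) / real (n k))) \<longlonglongrightarrow> \<beta>"
  defines "E \<equiv> E_S n \<inter> E_L n s t"
    and "\<xi> \<equiv> limsup (\<lambda>k. ereal (ln (s (Suc k)) / (\<Sum>j=1..k. ln (s j))))"
    and "\<gamma> \<equiv> limsup (\<lambda>k. ereal (exp (ln (ln (s k)) / real (n k))))"
  shows "(0 < \<alpha> \<and> \<alpha> < \<infinity> \<longrightarrow>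
            (\<exists>!\<theta>. pressure_solution \<alpha> \<beta> \<theta>) \<and>
            (\<forall>\<theta>. pressure_solution \<alpha> \<beta> \<theta> \<longrightarrow>
               hausdorff_dim E = ereal \<theta> \<and> hausdorff_dim (E_L n s t) = ereal \<theta>)) \<and>
         (\<alpha> = 0 \<longrightarrow> hausdorff_dim E = 1 \<and> hausdorff_dim (E_L n s t) = 1) \<and>
         (\<alpha> = \<infinity> \<longrightarrow>
            0 \<le> \<xi> \<and> hausdorff_dim E = 1 / (2 + \<xi>) \<and>
            1 \<le> \<gamma> \<and> hausdorff_dim (E_L n s t) = 1 / (\<gamma> + 1))"
proof -
  interpret D: digit_constraints n s t
    using assms(1-8) by unfold_locales
  have E: "E = E_S n \<inter> E_L n s t" and \<xi>_eq: "\<xi> = limsup (\<lambda>k. ereal (ln (s (Suc k)) / D.S k))"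
    unfolding E_def \<xi>_def D.S_def by simp_all
  have S_lim: "(\<lambda>k. ereal (D.S k / real (n k))) \<longlonglongrightarrow> \<alpha>"
    using assms(10) by (simp only: D.S_def)
  have E_le: "hausdorff_dim E \<le> hausdorff_dim (E_L n s t)"
    unfolding E by (rule hausdorff_dim_subset) simp
  have S_nonneg: "\<forall>\<^sub>F k in sequentially. 0 \<le> D.S k"
    using D.S_top by (simp add: filterlim_at_top)
  have S_pos: "\<forall>\<^sub>F k in sequentially. 0 < D.S k"
    using D.S_top by (simp add: filterlim_at_top_dense)
  \<comment> \<open>\<open>ln (s k)\<close> is \<open>D.S k - D.S (k - 1)\<close>, and the partial
    sums are eventually nonnegative. So \<beta> is finite whenever \<alpha> is.\<close>
  have "\<beta> \<le> \<alpha>"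
  proof (rule LIMSEQ_le[OF assms(12) S_lim])
    obtain N where N: "\<And>k. N \<le> k \<Longrightarrow> 0 \<le> D.S k" using S_nonneg unfolding eventually_sequentially by blast
    have "ln (s k) / real (n k) \<le> D.S k / real (n k)" if "Suc N \<le> k" for k
      using N[of "k - 1"] D.S_Suc[of "k - 1"] that by (intro divide_right_mono) auto
    then show "\<exists>N. \<forall>k\<ge>N. ereal (ln (s k) / real (n k)) \<le> ereal (D.S k / real (n k))" by auto
  qed
  have finite_case: "\<exists>a b. \<alpha> = ereal a \<and> \<beta> = ereal b \<and> 0 \<le> b \<and> b \<le> a \<and>
      (\<lambda>k. D.S k / real (n k)) \<longlonglongrightarrow> a \<and> (\<lambda>k. ln (s k) / real (n k)) \<longlonglongrightarrow> b" if fin: "\<alpha> < \<infinity>"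
  proof -
    obtain a where a: "\<alpha> = ereal a" using fin assms(9) by (cases \<alpha>) auto
    obtain b where b: "\<beta> = ereal b" using \<open>\<beta> \<le> \<alpha>\<close> a assms(11) by (cases \<beta>) auto
    show ?thesis
      using S_lim assms(11,12) \<open>\<beta> \<le> \<alpha>\<close> a b by (auto simp: lim_ereal)
  qed
  have part1: "(\<exists>!\<theta>. pressure_solution \<alpha> \<beta> \<theta>) \<and> (\<forall>\<theta>. pressure_solution \<alpha> \<beta> \<theta> \<longrightarrow>
      hausdorff_dim E = ereal \<theta> \<and> hausdorff_dim (E_L n s t) = ereal \<theta>)" if \<alpha>: "0 < \<alpha>" "\<alpha> < \<infinity>"
  proof -
    obtain a b where ab: "\<alpha> = ereal a" "\<beta> = ereal b" "0 \<le> b" "b \<le> a"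
      and lim: "(\<lambda>k. D.S k / real (n k)) \<longlonglongrightarrow> a" "(\<lambda>k. ln (s k) / real (n k)) \<longlonglongrightarrow> b"
      using finite_case[OF \<alpha>(2)] by blast
    have a: "0 < a" using \<alpha> ab by simp
    have sol: "pressure_solution \<alpha> \<beta> \<theta> \<longleftrightarrow> 1 / 2 < \<theta> \<and> pressure \<theta> = (2 * a - b) * \<theta> - (a - b)" for \<theta>
    proof -
      have "(2 * \<alpha> - \<beta>) * ereal \<theta> - (\<alpha> - \<beta>) = ereal ((2 * a - b) * \<theta> - (a - b))"
        unfolding ab numeral_eq_ereal by simp
      then show ?thesis by (simp add: pressure_solution_def)
    qed
    have dims: "hausdorff_dim E = ereal \<theta> \<and> hausdorff_dim (E_L n s t) = ereal \<theta>"
      if \<theta>: "1 / 2 < \<theta>" "pressure \<theta> = (2 * a - b) * \<theta> - (a - b)" for \<theta>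
    proof -
      have "\<theta> < 1" using pressure_equation(2)[OF a ab(3,4) \<theta>] .
      have slope: "(2 * a - b) * x < (2 * a - b) * y" if "x < y" for x y
        using that a ab(4) by (intro mult_strict_left_mono) auto
      have dec: "pressure y < pressure x" if "1 / 2 < x" "x < y" for x y
      proof -
        have "0 < (y - x) * ln 2" using that by simp
        then show ?thesis using pressure_decreasing[of x y] that by linarith
      qed
      have "hausdorff_dim (E_L n s t) \<le> ereal \<theta>"
      proof (rule hausdorff_dim_leI)
        fix r assume "\<theta> < r"
        then show "hausdorff_measure r (E_L n s t) = 0"
          using \<theta> slope[of \<theta> r] dec[of \<theta> r] by (intro D.null_E_L_finite[OF lim]) linarith+
      qed (use \<theta> in simp)
      moreover have "ereal \<theta> \<le> hausdorff_dim E"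
      proof (rule ereal_le_of_reals_below[of "1 / 2"])
        fix x assume x: "1 / 2 < x" "x < \<theta>"
        then show "ereal x \<le> hausdorff_dim E"
          unfolding E using \<theta> \<open>\<theta> < 1\<close> slope[of x \<theta>] dec[of x \<theta>] ab a
          by (intro D.dimension_E_ge_finite[OF lim]) linarith+
      qed (use \<theta> in simp)
      ultimately show ?thesis using E_le by (meson order_antisym order_trans)
    qed
    show ?thesis
      unfolding sol using pressure_equation(1)[OF a ab(3,4)] dims by blast
  qed
  have part2: "hausdorff_dim E = 1 \<and> hausdorff_dim (E_L n s t) = 1" if \<alpha>: "\<alpha> = 0"
  proof -
    have "\<alpha> < \<infinity>" using \<alpha> by simp
    from finite_case[OF this] obtain a b where ab: "\<alpha> = ereal a" "0 \<le> b" "b \<le> a"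
      and lim: "(\<lambda>k. D.S k / real (n k)) \<longlonglongrightarrow> a" "(\<lambda>k. ln (s k) / real (n k)) \<longlonglongrightarrow> b" by blast
    \<comment> \<open>The bounds of the finite case remain valid at a = b = 0, where they only ask
      for the sign of the pressure; that sign changes at 1.\<close>
    have ab0: "a = 0" "b = 0" using \<alpha> ab by auto
    note lim0 = lim[unfolded ab0]
    have "hausdorff_dim (E_L n s t) \<le> ereal 1"
    proof (rule hausdorff_dim_leI)
      fix r :: real assume r: "1 < r"
      then have "0 < (r - 1) * ln 2" by simp
      moreover have "pressure r + (r - 1) * ln 2 \<le> 0" using pressure_decreasing[of 1 r] r pressure_1 by simp
      ultimately have "pressure r < 0" by linarith
      then show "hausdorff_measure r (E_L n s t) = 0" using r by (intro D.null_E_L_finite[OF lim0]) auto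
    qed simp
    moreover have "ereal 1 \<le> hausdorff_dim E"
    proof (rule ereal_le_of_reals_below[of "1 / 2"])
      fix x :: real assume x: "1 / 2 < x" "x < 1"
      then have "0 < (1 - x) * ln 2" by simp
      moreover have "(1 - x) * ln 2 \<le> pressure x" using pressure_decreasing[of x 1] x pressure_1 by simp
      ultimately have "0 < pressure x" by linarith
      then show "ereal x \<le> hausdorff_dim E" unfolding E using x by (intro D.dimension_E_ge_finite[OF lim0]) auto
    qed simp
    ultimately show ?thesis using E_le by (metis one_ereal_def order_antisym order_trans)
  qed
  have part3: "0 \<le> \<xi> \<and> hausdorff_dim E = 1 / (2 + \<xi>) \<and> 1 \<le> \<gamma> \<and> hausdorff_dim (E_L n s t) = 1 / (\<gamma> + 1)" if \<alpha>: "\<alpha> = \<infinity>"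
  proof -
    have inf: "filterlim (\<lambda>k. D.S k / real (n k)) at_top sequentially"
      using S_lim \<alpha> by (simp add: tendsto_PInfty_eq_at_top)
    have ln_pos: "\<forall>\<^sub>F k in sequentially. 1 < ln (s k)" using D.ln_s_top by (simp add: filterlim_at_top_dense)
    have "\<forall>\<^sub>F k in sequentially. 1 < ln (s (Suc k))" by (rule eventually_sequentially_Suc[THEN iffD2, OF ln_pos])
    with S_pos have "\<forall>\<^sub>F k in sequentially. 0 \<le> ereal (ln (s (Suc k)) / D.S k)"
      by eventually_elim simp
    then have \<xi>0: "0 \<le> \<xi>" unfolding \<xi>_eq by (intro le_Limsup) auto
    have dimE: "hausdorff_dim E = 1 / (2 + \<xi>)"
    proof (rule order_antisym)
      have freq: "\<exists>\<^sub>F k in sequentially. \<rho> < ln (s (Suc k)) / D.S k" if "ereal \<rho> < \<xi>" for \<rho>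
        using less_Limsup_frequently[OF that[unfolded \<xi>_eq]] by simp
      show "hausdorff_dim E \<le> 1 / (2 + \<xi>)"
      proof (cases \<xi>)
        case (real x)
        then have x: "0 \<le> x" using \<xi>0 by simp
        have "hausdorff_dim E \<le> ereal (1 / (2 + x))"
        proof (rule hausdorff_dim_leI)
          fix r :: real assume r: "1 / (2 + x) < r" "0 < r"
          have "1 / r - 2 < x" using r x by (simp add: field_simps)
          then obtain \<rho> where \<rho>: "1 / r - 2 < \<rho>" "\<rho> < x" using dense by blast
          then have "1 < r * (2 + \<rho>)" using r(2) by (simp add: field_simps)
          then show "hausdorff_measure r E = 0"
            unfolding E using \<rho>(2) real r(2) by (intro D.null_E_infinite[OF inf _ _ freq]) auto
        qed (use x in simp)
        then show ?thesis using real x by (simp add: one_ereal_def numeral_eq_ereal)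
      next
        case PInf
        have "hausdorff_dim E \<le> ereal 0"
        proof (rule hausdorff_dim_leI)
          fix r :: real assume r: "0 < r"
          then have "1 < r * (2 + 1 / r)" by (simp add: field_simps)
          then show "hausdorff_measure r E = 0"
            unfolding E using PInf r by (intro D.null_E_infinite[OF inf _ _ freq]) auto
        qed simp
        then show ?thesis using PInf by (simp add: zero_ereal_def)
      qed (use \<xi>0 in simp)
      show "1 / (2 + \<xi>) \<le> hausdorff_dim E"
      proof (cases \<xi>)
        case (real x)
        then have x: "0 \<le> x" using \<xi>0 by simp
        have "ereal (1 / (2 + x)) \<le> hausdorff_dim E"
        proof (rule ereal_le_of_reals_below[of 0])
          fix \<theta> :: real assume \<theta>: "0 < \<theta>" "\<theta> < 1 / (2 + x)"
          then have "\<theta> * (2 + x) < 1" using x by (simp add: pos_less_divide_eq)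
          moreover have "\<forall>\<^sub>F k in sequentially. ln (s (Suc k)) / D.S k < c" if "x < c" for c
          proof -
            have "\<xi> < ereal c" using real that by simp
            from Limsup_lessD[OF this[unfolded \<xi>_eq]] show ?thesis by simp
          qed
          ultimately show "ereal \<theta> \<le> hausdorff_dim E"
            unfolding E using \<theta>(1) x by (intro D.dimension_E_ge_infinite[OF inf]) auto
        qed (use x in simp)
        then show ?thesis using real x by (simp add: one_ereal_def numeral_eq_ereal)
      next
        case PInf
        then show ?thesis by (simp add: hausdorff_dim_nonneg)
      qed (use \<xi>0 in simp)
    qed
    let ?h = "\<lambda>k. exp (ln (ln (s k)) / real (n k))"
    have "\<forall>\<^sub>F k in sequentially. 1 \<le> ereal (?h k)"
      using ln_pos by eventually_elim simp
    then have \<gamma>1: "1 \<le> \<gamma>" unfolding \<gamma>_def by (intro le_Limsup) auto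
    have dimL: "hausdorff_dim (E_L n s t) = 1 / (\<gamma> + 1)"
    proof (rule order_antisym)
      have freq: "\<exists>\<^sub>F k in sequentially. b < ?h k" if "ereal b < \<gamma>" for b
        using less_Limsup_frequently[OF that[unfolded \<gamma>_def]] by simp
      show "hausdorff_dim (E_L n s t) \<le> 1 / (\<gamma> + 1)"
      proof (cases \<gamma>)
        case (real g)
        then have g: "1 \<le> g" using \<gamma>1 by simp
        have "hausdorff_dim (E_L n s t) \<le> ereal (1 / (g + 1))"
        proof (rule hausdorff_dim_leI)
          fix r :: real assume r: "1 / (g + 1) < r" "0 < r"
          show "hausdorff_measure r (E_L n s t) = 0"
          \<comment> \<open>For \<gamma> = 1 there is no b with 1 < b < \<gamma>; the bound 1/2 =
            1/(1 + 1) then comes from the ordinary covering.\<close>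
          proof (cases "g = 1")
            case True
            then show ?thesis using r by (intro D.null_E_L_infinite[OF inf]) simp
          next
            case False
            have "1 / r - 1 < g" using r g by (simp add: field_simps)
            then have "max 1 (1 / r - 1) < g" using g False by simp
            then obtain b where b: "max 1 (1 / r - 1) < b" "b < g" using dense by blast
            have "1 < b" "1 / r - 1 < b" using b(1) by auto
            then have "1 < r * (b + 1)" using r(2) by (simp add: field_simps)
            then show ?thesis
              using \<open>1 < b\<close> b(2) real r(2) by (intro D.null_E_L_doubly_exponential[OF _ _ _ freq, of b]) auto
          qed
        qed (use g in simp)
        then show ?thesis using real g by (simp add: one_ereal_def)
      next
        case PInf
        have "hausdorff_dim (E_L n s t) \<le> ereal 0"
        proof (rule hausdorff_dim_leI)
          fix r :: real assume r: "0 < r"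
          have "1 < r * ((1 + 1 / r) + 1)" using r by (simp add: field_simps)
          moreover have "1 < 1 + 1 / r" using r by simp
          ultimately show "hausdorff_measure r (E_L n s t) = 0"
            using PInf r by (intro D.null_E_L_doubly_exponential[OF _ _ _ freq, of "1 + 1 / r"]) auto
        qed simp
        then show ?thesis using PInf by (simp add: zero_ereal_def)
      qed (use \<gamma>1 in simp)
      show "1 / (\<gamma> + 1) \<le> hausdorff_dim (E_L n s t)"
      proof (cases \<gamma>)
        case (real g)
        then have g: "1 \<le> g" using \<gamma>1 by simp
        have "ereal (1 / (g + 1)) \<le> hausdorff_dim (E_L n s t)"
        proof (rule ereal_le_of_reals_below[of 0])
          fix \<theta> :: real assume \<theta>: "0 < \<theta>" "\<theta> < 1 / (g + 1)"
          then have "g < 1 / \<theta> - 1" using g by (simp add: field_simps)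
          then obtain b where b: "g < b" "b < 1 / \<theta> - 1" using dense by blast
          obtain b0 where b0: "g < b0" "b0 < b" using dense b(1) by blast
          have "\<gamma> < ereal b0" using real b0 by simp
          from Limsup_lessD[OF this[unfolded \<gamma>_def]] have "\<forall>\<^sub>F k in sequentially. ?h k < b0" by simp
          then have "\<forall>\<^sub>F k in sequentially. ln (s k) \<le> b0 ^ n k"
            using ln_pos eventually_ge_at_top[of 1]
          proof eventually_elim
            case (elim k)
            have n0: "0 < real (n k)" using D.n_ge1[OF elim(3)] by simp
            have "ln (ln (s k)) / real (n k) < ln b0"
              using elim(1) g b0 by (subst exp_less_cancel_iff[symmetric]) simp
            then have "ln (ln (s k)) < real (n k) * ln b0" using n0 by (simp add: pos_divide_less_eq mult.commute)
            then have "exp (ln (ln (s k))) < exp (real (n k) * ln b0)" by simp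
            then show ?case using elim(2) g b0 by (simp add: exp_of_nat_mult)
          qed
          moreover have "\<theta> * (b + 1) < 1" using b(2) \<theta>(1) by (simp add: field_simps)
          ultimately show "ereal \<theta> \<le> hausdorff_dim (E_L n s t)"
            using g b0 \<theta>(1) by (intro D.dimension_E_L_ge[of b0 b]) auto
        qed (use g in simp)
        then show ?thesis using real g by (simp add: one_ereal_def)
      next
        case PInf
        then show ?thesis by (simp add: hausdorff_dim_nonneg)
      qed (use \<gamma>1 in simp)
    qed
    show ?thesis using \<xi>0 dimE \<gamma>1 dimL by blast
  qed
  show ?thesis using part1 part2 part3 by blast
qed

end
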